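(* Every connected compact $n$-manifold $M$ is $\mathsf H_n$-minimal. Every connected compact $n$-manifold with boundary, considered as the pair $(M,\partial M)$, is $\mathsf H_n$-minimal.
   Context: An $n$-manifold is a Hausdorff space in which every point has an open neighborhood homeomorphic to $\mathbb R^n$; an $n$-manifold with boundary is a Hausdorff space in which every point has an open neighborhood homeomorphic to $\mathbb R^n$ or to $\{x\in\mathbb R^n:x_n\ge0\}$ via a homeomorphism sending the point to a point with $x_n=0$; the boundary $\partial M$ is the set of points of the latter kind. Fix $p\in\mathbb S_n$ (the $n$-sphere). For compact $A\subseteq X$, the pair $(X,A)$ is in $\mathsf H_n$ if there is a continuous $f:X\to\mathbb S_n$ with $f(A)\subseteq\{p\}$ which is not null-homotopic relative to $A$, i.e. not homotopic to the constant map $p$ through a homotopy $H:X\times[0,1]\to\mathbb S_n$ with $H(a,t)=p$ for all $a\in A$, $t\in[0,1]$. A space $X$ is in $\mathsf H_n$ if $(X,\emptyset)$ is. $(X',A')$ is a proper subpair of $(X,A)$ if $X'\subsetneq X$ and $A'\subseteq A$; $(X,A)$ is $\mathsf H_n$-minimal if $(X,A)\in\mathsf H_n$ and no proper subpair of it is in $\mathsf H_n$ (for a single space $X$, consider the pair $(X,\emptyset)$). *)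

theory Defs
  imports "HOL-Analysis.Analysis"
begin

(* Spaces are abstract topologies. Euclidean_space n is the space of real sequences vanishing
   from index n on, so the coordinates of R^n are indexed by 0, ..., n - 1. *)

definition euclidean_point :: "nat \<Rightarrow> 'a topology \<Rightarrow> 'a \<Rightarrow> bool" where
  "euclidean_point n M x \<longleftrightarrow>
     (\<exists>U. openin M U \<and> x \<in> U \<and> subtopology M U homeomorphic_space Euclidean_space n)"

(* The last coordinate x_n has index n - 1. *)
definition half_space :: "nat \<Rightarrow> (nat \<Rightarrow> real) topology" where
  "half_space n = subtopology (Euclidean_space n) {y. y (n - 1) \<ge> 0}"

(* For n = 0 there is no last coordinate, hence no half-space chart. Without the guard 0 < n,
   the truncated index n - 1 = 0 would make every point of a 0-manifold a boundary point. *)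
definition boundary_point :: "nat \<Rightarrow> 'a topology \<Rightarrow> 'a \<Rightarrow> bool" where
  "boundary_point n M x \<longleftrightarrow>
     0 < n \<and>
     (\<exists>U h. openin M U \<and> x \<in> U \<and>
        homeomorphic_map (subtopology M U) (half_space n) h \<and> h x (n - 1) = 0)"

definition manifold :: "nat \<Rightarrow> 'a topology \<Rightarrow> bool" where
  "manifold n M \<longleftrightarrow> Hausdorff_space M \<and> (\<forall>x\<in>topspace M. euclidean_point n M x)"

definition manifold_with_boundary :: "nat \<Rightarrow> 'a topology \<Rightarrow> bool" where
  "manifold_with_boundary n M \<longleftrightarrow>
     Hausdorff_space M \<and> (\<forall>x\<in>topspace M. euclidean_point n M x \<or> boundary_point n M x)"

definition manifold_boundary :: "nat \<Rightarrow> 'a topology \<Rightarrow> 'a set" where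
  "manifold_boundary n M = {x \<in> topspace M. boundary_point n M x}"

(* Membership of the pair (X, A) in the class H_n, with base point p in the n-sphere.
   compactin includes that A is a subset of X. *)
definition in_H :: "nat \<Rightarrow> (nat \<Rightarrow> real) \<Rightarrow> 'a topology \<Rightarrow> 'a set \<Rightarrow> bool" where
  "in_H n p X A \<longleftrightarrow>
     compactin X A \<and>
     (\<exists>f. continuous_map X (nsphere n) f \<and> f ` A \<subseteq> {p} \<and>
        \<not> homotopic_with (\<lambda>g. \<forall>a\<in>A. g a = p) X (nsphere n) f (\<lambda>x. p))"

(* A proper subpair consists of an arbitrary proper subspace X' and a subset A' of A;
   in_H forces A' to be a compact subset of X'. *)
definition H_minimal :: "nat \<Rightarrow> (nat \<Rightarrow> real) \<Rightarrow> 'a topology \<Rightarrow> 'a set \<Rightarrow> bool" where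
  "H_minimal n p X A \<longleftrightarrow>
     in_H n p X A \<and>
     (\<forall>X' A'. X' \<subset> topspace X \<and> A' \<subseteq> A \<longrightarrow> \<not> in_H n p (subtopology X X') A')"

end

theory Submission
  imports Defs "HOL-Homology.Homology"
begin

text \<open>A map \<open>f\<close> on a proper subspace \<open>X\<close> of \<open>M\<close> with values in the \<open>n\<close>-sphere is homotopic to the normalisation of a
  map \<open>g\<close> from \<open>M\<close> to \<open>n + 1\<close>-space that vanishes somewhere outside \<open>X\<close>. Off the zeros of \<open>g\<close> the normalisation is
  null-homotopic: the missing point leaves room in some chart, and the null-homotopy is pushed across charts one at a time,
  as a map from part of the boundary of an \<open>n + 1\<close>-cube into the \<open>n\<close>-sphere extends over the cube minus one point.

  Conversely, collapsing the complement of a chart of \<open>M\<close> gives a map to the \<open>n\<close>-sphere. It is essential because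
  a manifold has a fundamental class modulo 2 on every compact set of interior points; working modulo 2 makes
  orientability irrelevant. Singular homology in the library has integer coefficients only, so classes modulo 2
  are treated as integral chains up to twice a chain.\<close>

section \<open>Maps into spheres\<close>

text \<open>The obstruction to extending a homotopy into the n-sphere over an (n + 1)-dimensional
  prism is a degree, and a degree can be pushed into any place that is left out. The homotopy is
  built along an exhaustion of the complement of the zero set, with earlier values frozen, and such
  a place must remain at every stage. Connectedness of \<open>M\<close> makes the initial stage
  empty. Homotopies relative to a set \<open>A\<close> of boundary points need no separate argument:
  charts are cubes in which boundary points of \<open>M\<close> lie on faces, so over
  \<open>A\<close> values are prescribed on the boundary of the prism only. In the other direction a
  cycle modulo 2 need not be an integral relative cycle. Mayer-Vietoris, excision and homotopy
  invariance are therefore carried out on chains, with explicit correction terms and doubles,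
  instead of being read off from homology groups.\<close>

abbreviation interval :: "real topology" where "interval \<equiv> top_of_set {0..1}"

text \<open>Points of \<open>nsphere n\<close> are sequences supported on the indices up to
  \<open>n\<close>, so later entries are cut off; \<open>v\<close> may be arbitrary there.\<close>

definition unit_vec :: "nat \<Rightarrow> (nat \<Rightarrow> real) \<Rightarrow> nat \<Rightarrow> real" where
  "unit_vec n v = (\<lambda>i. if i \<le> n then v i / sqrt (\<Sum>j\<le>n. (v j)\<^sup>2) else 0)"

lemma topspace_nsphere: "topspace (nsphere n) = {x. (\<Sum>i\<le>n. (x i)\<^sup>2) = 1 \<and> (\<forall>i>n. x i = 0)}"
  by (simp add: nsphere)

lemma unit_vec_in_nsphere:
  assumes "(\<Sum>j\<le>n. (v j)\<^sup>2) \<noteq> 0"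
  shows "unit_vec n v \<in> topspace (nsphere n)"
proof -
  have "(\<Sum>j\<le>n. (v j)\<^sup>2) > 0"
    using assms by (metis less_eq_real_def sum_nonneg zero_le_power2)
  then have "(\<Sum>j\<le>n. (unit_vec n v j)\<^sup>2) = 1"
    by (simp add: unit_vec_def power_divide flip: sum_divide_distrib)
  then show ?thesis
    by (simp add: topspace_nsphere unit_vec_def)
qed

lemma unit_vec_scale:
  assumes v: "v \<in> topspace (nsphere n)" and c: "c > 0" and w: "\<And>i. i \<le> n \<Longrightarrow> w i = c * v i"
  shows "unit_vec n w = v"
proof -
  have "(\<Sum>j\<le>n. (w j)\<^sup>2) = c\<^sup>2 * (\<Sum>j\<le>n. (v j)\<^sup>2)"
    by (simp add: w power_mult_distrib sum_distrib_left)
  then have "(\<Sum>j\<le>n. (w j)\<^sup>2) = c\<^sup>2"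
    using v by (simp add: topspace_nsphere)
  then show ?thesis
    using v c by (auto simp: unit_vec_def topspace_nsphere w)
qed

lemma continuous_map_nsphere_iff:
  "continuous_map X (nsphere n) f \<longleftrightarrow>
   (\<forall>i\<le>n. continuous_map X euclideanreal (\<lambda>x. f x i)) \<and> f \<in> topspace X \<rightarrow> topspace (nsphere n)"
proof -
  have "continuous_map X euclideanreal (\<lambda>x. f x i)"
    if "f \<in> topspace X \<rightarrow> topspace (nsphere n)" "\<not> i \<le> n" for i
    by (rule continuous_map_eq [of _ _ "\<lambda>x. 0"]) (use that in \<open>force simp: topspace_nsphere Pi_iff\<close>)+
  then show ?thesis
    by (auto simp: nsphere continuous_map_in_subtopology continuous_map_componentwise_UNIV)
qed

lemma continuous_map_unit_vec:
  assumes "\<And>i. i \<le> n \<Longrightarrow> continuous_map X euclideanreal (\<lambda>x. g x i)"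
    and "\<And>x. x \<in> topspace X \<Longrightarrow> (\<Sum>j\<le>n. (g x j)\<^sup>2) \<noteq> 0"
  shows "continuous_map X (nsphere n) (\<lambda>x. unit_vec n (g x))"
  unfolding continuous_map_nsphere_iff
proof (intro conjI allI impI)
  fix i assume "i \<le> n"
  have "continuous_map X euclideanreal (\<lambda>x. sqrt (\<Sum>j\<le>n. (g x j)\<^sup>2))"
    by (intro continuous_intros assms continuous_map_sqrt) (auto simp: assms)
  then show "continuous_map X euclideanreal (\<lambda>x. unit_vec n (g x) i)"
    using \<open>i \<le> n\<close> assms
    by (auto simp: unit_vec_def intro!: continuous_map_real_divide)
qed (use assms unit_vec_in_nsphere in auto)

lemma continuous_map_union_closed:
  assumes "closedin X A" "closedin X B"
    and "continuous_map (subtopology X A) Y f" "continuous_map (subtopology X B) Y g"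
    and eq: "\<And>x. \<lbrakk>x \<in> A; x \<in> B\<rbrakk> \<Longrightarrow> f x = g x"
  shows "continuous_map (subtopology X (A \<union> B)) Y (\<lambda>x. if x \<in> A then f x else g x)"
proof (rule pasting_lemma_closed [where I = "{True,False}" and T = "\<lambda>b. if b then A else B"
        and f = "\<lambda>b. if b then f else g"])
  fix b show "closedin (subtopology X (A \<union> B)) (if b then A else B)"
    using assms by (auto simp: closedin_subset_topspace intro: closedin_subset_topspace)
  show "continuous_map (subtopology (subtopology X (A \<union> B)) (if b then A else B)) Y (if b then f else g)"
    using assms by (simp add: subtopology_subtopology inf_absorb2)
qed (use eq in auto)

lemma continuous_map_interval_iff:
  "continuous_map X interval f \<longleftrightarrow> continuous_map X euclideanreal f \<and> f \<in> topspace X \<rightarrow> {0..1}"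
  by (simp add: continuous_map_in_subtopology)

text \<open>The segment from \<open>f x\<close> to \<open>g x\<close> avoids the origin, since all
  its points have positive inner product with \<open>f x\<close>. The last conclusion makes the
  homotopy usable relative to a set: where \<open>g\<close> is a positive multiple of
  \<open>f\<close>, it stands still.\<close>

lemma linear_homotopy_unit_vec:
  assumes f: "continuous_map X (nsphere n) f"
    and g: "\<And>i. i \<le> n \<Longrightarrow> continuous_map X euclideanreal (\<lambda>x. g x i)"
    and pos: "\<And>x. x \<in> topspace X \<Longrightarrow> (\<Sum>i\<le>n. f x i * g x i) > 0"
  obtains h where "continuous_map (prod_topology interval X) (nsphere n) h"
    "\<And>x. x \<in> topspace X \<Longrightarrow> h (0, x) = f x"
    "\<And>x. x \<in> topspace X \<Longrightarrow> h (1, x) = unit_vec n (g x)"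
    "\<And>t x c. \<lbrakk>t \<in> {0..1}; x \<in> topspace X; c > 0; \<And>i. i \<le> n \<Longrightarrow> g x i = c * f x i\<rbrakk> \<Longrightarrow> h (t, x) = f x"
proof
  define G where "G = (\<lambda>(t, x) i. (1 - t) * f x i + t * g x i)"
  have fS: "f x \<in> topspace (nsphere n)" if "x \<in> topspace X" for x
    using f that by (auto simp: continuous_map_def)
  have nz: "(\<Sum>j\<le>n. (G (t, x) j)\<^sup>2) \<noteq> 0" if "x \<in> topspace X" "t \<in> {0..1}" for t x
  proof
    assume "(\<Sum>j\<le>n. (G (t, x) j)\<^sup>2) = 0"
    then have 0: "G (t, x) j = 0" if "j \<le> n" for j
      using that by (simp add: sum_nonneg_eq_0_iff)
    have "0 = (\<Sum>j\<le>n. f x j * G (t, x) j)"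
      by (simp add: 0)
    also have "\<dots> = (1 - t) * (\<Sum>j\<le>n. (f x j)\<^sup>2) + t * (\<Sum>j\<le>n. f x j * g x j)"
      by (simp add: G_def algebra_simps sum.distrib sum_distrib_left power2_eq_square sum_subtractf)
    also have "\<dots> = (1 - t) + t * (\<Sum>j\<le>n. f x j * g x j)"
      using fS [OF that(1)] by (simp add: topspace_nsphere)
    also have "\<dots> > 0"
    proof (cases "t = 0")
      case False
      then have "t * (\<Sum>j\<le>n. f x j * g x j) > 0"
        using pos that by simp
      then show ?thesis
        using that by auto
    qed auto
    finally show False by simp
  qed
  have comp: "continuous_map (prod_topology interval X) euclideanreal (\<lambda>z. f (snd z) i)"
             "continuous_map (prod_topology interval X) euclideanreal (\<lambda>z. g (snd z) i)" if "i \<le> n" for i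
    using f g that continuous_map_compose [OF continuous_map_snd, of X euclideanreal "\<lambda>x. f x i" interval]
      continuous_map_compose [OF continuous_map_snd, of X euclideanreal "\<lambda>x. g x i" interval]
    by (simp_all add: continuous_map_nsphere_iff o_def)
  have fst: "continuous_map (prod_topology interval X) euclideanreal fst"
    using continuous_map_fst [of interval X] continuous_map_into_fulltopology by blast
  show "continuous_map (prod_topology interval X) (nsphere n) (\<lambda>z. unit_vec n (G z))"
  proof (rule continuous_map_unit_vec)
    fix i assume "i \<le> n"
    show "continuous_map (prod_topology interval X) euclideanreal (\<lambda>z. G z i)"
      unfolding G_def case_prod_unfold
      by (intro continuous_intros comp fst \<open>i \<le> n\<close>)
  qed (use nz in force)
  show "unit_vec n (G (0, x)) = f x" if "x \<in> topspace X" for x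
    by (rule unit_vec_scale [of _ _ 1]) (use fS that in \<open>auto simp: G_def\<close>)
  show "unit_vec n (G (1, x)) = unit_vec n (g x)" for x
    by (simp add: G_def)
  show "unit_vec n (G (t, x)) = f x"
    if "t \<in> {0..1}" "x \<in> topspace X" "c > 0" "\<And>i. i \<le> n \<Longrightarrow> g x i = c * f x i" for t x c
  proof (rule unit_vec_scale [of _ _ "1 - t + t * c"])
    show "0 < 1 - t + t * c"
    proof (cases "t = 0")
      case False
      then have "t * c > 0" using that by simp
      then show ?thesis using that by auto
    qed auto
  qed (use fS that in \<open>auto simp: G_def algebra_simps\<close>)
qed

text \<open>Tietze's theorem in each coordinate. The extension takes values in (n + 1)-space and may
  vanish away from \<open>D\<close>; its zeros are either cut out or removed by a small translation
  later.\<close>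

lemma nsphere_tietze:
  assumes "normal_space X" "closedin X D" "continuous_map (subtopology X D) (nsphere n) f"
  obtains g :: "'a \<Rightarrow> nat \<Rightarrow> real" where "\<And>i. i \<le> n \<Longrightarrow> continuous_map X euclideanreal (\<lambda>x. g x i)"
    "\<And>x i. \<lbrakk>x \<in> D; i \<le> n\<rbrakk> \<Longrightarrow> g x i = f x i"
proof -
  have "\<exists>h. continuous_map X euclideanreal h \<and> (\<forall>x\<in>D. h x = f x i)" if "i \<le> n" for i
    using Tietze_extension_realinterval [OF assms(1,2), of UNIV "\<lambda>x. f x i"] assms(3) that
    unfolding continuous_map_nsphere_iff by (metis UNIV_not_empty is_interval_univ top_greatest)
  then obtain h where "\<And>i. i \<le> n \<Longrightarrow> continuous_map X euclideanreal (h i) \<and> (\<forall>x\<in>D. h i x = f x i)"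
    by metis
  then show thesis
    by (intro that [of "\<lambda>x i. h i x"]) auto
qed

lemma openin_nonzero_set:
  fixes n :: nat
  assumes "\<And>i. i \<le> n \<Longrightarrow> continuous_map X euclideanreal (\<lambda>x. g x i)"
  shows "openin X {x \<in> topspace X. (\<Sum>j\<le>n. (g x j :: real)\<^sup>2) \<noteq> 0}"
proof -
  have "continuous_map X euclideanreal (\<lambda>x. \<Sum>j\<le>n. (g x j)\<^sup>2)"
    by (intro continuous_intros assms finite_atMost) auto
  moreover have "openin euclideanreal (- {0})"
    by (simp add: closed_def [symmetric])
  ultimately have "openin X {x \<in> topspace X. (\<Sum>j\<le>n. (g x j)\<^sup>2) \<in> - {0}}"
    by (rule openin_continuous_map_preimage)
  then show ?thesis
    by simp
qed

text \<open>The sphere is a retract of (n + 1)-space without the origin, so a Tietze extension can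
  be normalised off its zeros, on an open set containing \<open>D\<close>.\<close>

lemma nsphere_neighbourhood_extension:
  assumes "normal_space X" "closedin X D" "continuous_map (subtopology X D) (nsphere n) f"
  obtains W g where "openin X W" "D \<subseteq> W" "continuous_map (subtopology X W) (nsphere n) g"
    "\<And>x. x \<in> D \<Longrightarrow> g x = f x"
proof -
  obtain g where g: "\<And>i. i \<le> n \<Longrightarrow> continuous_map X euclideanreal (\<lambda>x. g x i)"
    and gf: "\<And>x i. \<lbrakk>x \<in> D; i \<le> n\<rbrakk> \<Longrightarrow> g x i = f x i"
    using nsphere_tietze [OF assms] by blast
  let ?W = "{x \<in> topspace X. (\<Sum>j\<le>n. (g x j)\<^sup>2) \<noteq> 0}"
  have fS: "f x \<in> topspace (nsphere n)" if "x \<in> D" for x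
    using assms(2,3) that closedin_subset by (fastforce simp: continuous_map_def Pi_iff)
  show thesis
  proof
    show "openin X ?W"
      by (rule openin_nonzero_set [OF g])
    show "D \<subseteq> ?W"
      using gf fS closedin_subset [OF assms(2)] by (auto simp: topspace_nsphere)
    show "continuous_map (subtopology X ?W) (nsphere n) (\<lambda>x. unit_vec n (g x))"
      by (rule continuous_map_unit_vec) (auto intro: continuous_map_from_subtopology g)
    show "unit_vec n (g x) = f x" if "x \<in> D" for x
      by (rule unit_vec_scale [of _ _ 1]) (use that fS gf in auto)
  qed
qed

text \<open>Borsuk's argument: the initial map and the homotopy on \<open>A\<close> together live on
  a closed subset of the cylinder and extend to a neighbourhood of it. Time is then slowed down so
  that the whole cylinder is carried into that neighbourhood.\<close>

lemma homotopy_extension_nsphere: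
  assumes X: "compact_space X" "Hausdorff_space X" and A: "closedin X A"
    and f: "continuous_map X (nsphere n) f"
    and h: "continuous_map (prod_topology interval (subtopology X A)) (nsphere n) h"
    and hf: "\<And>x. x \<in> A \<Longrightarrow> h (0, x) = f x"
  obtains H where "continuous_map (prod_topology interval X) (nsphere n) H"
    "\<And>x. x \<in> topspace X \<Longrightarrow> H (0, x) = f x"
    "\<And>t x. \<lbrakk>t \<in> {0..1}; x \<in> A\<rbrakk> \<Longrightarrow> H (t, x) = h (t, x)"
proof -
  let ?P = "prod_topology interval X"
  have cI: "compact_space interval"
    by (simp add: compact_space_subtopology)
  have nP: "normal_space ?P" and nX: "normal_space X"
    using X cI by (simp_all add: compact_Hausdorff_or_regular_imp_normal_space compact_space_prod_topology
        Hausdorff_space_prod_topology Hausdorff_space_subtopology)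
  let ?D0 = "{0} \<times> topspace X" and ?D1 = "{0..1} \<times> A"
  have c0: "closedin ?P ?D0" and c1: "closedin ?P ?D1"
    using A by (auto simp: closedin_prod_Times_iff)
  have f': "continuous_map (subtopology ?P ?D0) (nsphere n) (f \<circ> snd)"
    by (intro continuous_map_compose [OF _ f] continuous_map_from_subtopology continuous_map_snd)
  have "subtopology ?P ?D1 = prod_topology interval (subtopology X A)"
    using subtopology_Times [of interval X "{0..1}" A] by (simp add: subtopology_subtopology)
  with h have h': "continuous_map (subtopology ?P ?D1) (nsphere n) h"
    by simp
  have "(f \<circ> snd) x = h x" if "x \<in> ?D0" "x \<in> ?D1" for x
    using that hf by auto
  from continuous_map_union_closed [OF c0 c1 f' h' this]
  have "continuous_map (subtopology ?P (?D0 \<union> ?D1)) (nsphere n) (\<lambda>x. if x \<in> ?D0 then (f \<circ> snd) x else h x)"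
    by blast
  from nsphere_neighbourhood_extension [OF nP closedin_Un [OF c0 c1] this] obtain W g where W: "openin ?P W" "?D0 \<union> ?D1 \<subseteq> W" and g: "continuous_map (subtopology ?P W) (nsphere n) g"
    and gh: "\<And>x. x \<in> ?D0 \<union> ?D1 \<Longrightarrow> g x = (if x \<in> ?D0 then (f \<circ> snd) x else h x)"
    by blast
  \<comment> \<open>Tube lemma: projection along the compact interval is closed, so \<open>V\<close>
    is open and \<open>W\<close> contains every segment over \<open>V\<close>.\<close>
  define V where "V = topspace X - snd ` (topspace ?P - W)"
  have "closedin X (snd ` (topspace ?P - W))"
    using closed_map_snd [OF cI, of X] W(1) closedin_diff [OF closedin_topspace W(1)]
    unfolding closed_map_def by blast
  then have V: "closedin X (topspace X - V)"
    by (metis V_def double_diff closedin_subset order_refl)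
  have VW: "(t, x) \<in> W" if "x \<in> V" "t \<in> {0..1}" for t x
    using that by (force simp: V_def image_iff)
  have AV: "A \<subseteq> V"
    using W(2) closedin_subset [OF A] by (auto simp: V_def)
  \<comment> \<open>\<open>l\<close> is 1 on \<open>A\<close>, where the full homotopy is needed,
    and 0 outside \<open>V\<close>, where only time 0 is known to lie in \<open>W\<close>.\<close>
  obtain l where l: "continuous_map X interval l" and l0: "l ` (topspace X - V) \<subseteq> {0}" and l1: "l ` A \<subseteq> {1}"
    using Urysohn_lemma [OF nX V A, of 0 1] AV by (auto simp: disjnt_iff)
  define k where "k = (\<lambda>(t, x). (t * l x, x))"
  have kW: "k (t, x) \<in> W" if "t \<in> {0..1}" "x \<in> topspace X" for t x
  proof (cases "x \<in> V")
    case True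
    have "l x \<in> {0..1}"
      using l that by (auto simp: continuous_map_interval_iff)
    then show ?thesis
      using that True by (auto simp: k_def intro!: VW mult_le_one)
  next
    case False
    then have "l x = 0"
      using l0 that by auto
    then show ?thesis
      using that W(2) by (auto simp: k_def)
  qed
  have lS: "continuous_map ?P euclideanreal (\<lambda>z. l (snd z))"
    using l continuous_map_compose [OF continuous_map_snd, of X euclideanreal l interval]
    by (simp add: continuous_map_interval_iff o_def)
  have fst: "continuous_map ?P euclideanreal fst"
    using continuous_map_fst [of interval X] continuous_map_into_fulltopology by blast
  have "continuous_map ?P ?P k"
    unfolding k_def case_prod_unfold continuous_map_pairwise o_def
  proof (intro conjI)
    show "continuous_map ?P interval (\<lambda>x. fst (fst x * l (snd x), snd x))"
      using l by (auto simp: continuous_map_interval_iff Pi_iff intro!: continuous_intros lS fst mult_le_one)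
  qed (auto intro: continuous_map_snd)
  then have "continuous_map ?P (subtopology ?P W) k"
    using kW by (auto simp: continuous_map_in_subtopology)
  from continuous_map_compose [OF this g] have "continuous_map ?P (nsphere n) (g \<circ> k)" .
  moreover have "(g \<circ> k) (0, x) = f x" if "x \<in> topspace X" for x
    using gh [of "(0, x)"] that by (simp add: k_def)
  moreover have "(g \<circ> k) (t, x) = h (t, x)" if "t \<in> {0..1}" "x \<in> A" for t x
    using gh [of "(t, x)"] that l1 hf by (auto simp: k_def)
  ultimately show thesis
    by (rule that)
qed

lemma continuous_map_slice:
  assumes "continuous_map (prod_topology interval X) Y H" "t \<in> {0..1}"
  shows "continuous_map X Y (\<lambda>x. H (t, x))"
proof -
  have "continuous_map X (prod_topology interval X) (\<lambda>x. (t, x))"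
    using assms(2) unfolding continuous_map_pairwise o_def fst_conv snd_conv by auto
  from continuous_map_compose [OF this assms(1)] show ?thesis
    by (simp add: o_def)
qed

section \<open>Extension from the boundary of a cube\<close>

text \<open>Coordinates from \<open>m\<close> on are 0, so cubes of all dimensions share one type
  and \<open>cube n\<close> is the face of \<open>cube (Suc n)\<close> where coordinate
  \<open>n\<close> vanishes. That coordinate later carries the time.\<close>

definition cube :: "nat \<Rightarrow> (nat \<Rightarrow> real) set" where
  "cube m = {x. (\<forall>i<m. 0 \<le> x i \<and> x i \<le> 1) \<and> (\<forall>i\<ge>m. x i = 0)}"

definition cube_boundary :: "nat \<Rightarrow> (nat \<Rightarrow> real) set" where
  "cube_boundary m = {x \<in> cube m. \<exists>i<m. x i = 0 \<or> x i = 1}"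

lemma continuous_on_coordinate: "continuous_on S (\<lambda>x::nat \<Rightarrow> real. x i)"
  by (rule continuous_on_subset [OF continuous_on_product_coordinates]) auto

lemma compact_cube: "compact (cube m)"
proof -
  have "cube m = (\<Pi>\<^sub>E i\<in>UNIV. if i < m then {0..1} else {0})"
    by (auto simp: cube_def PiE_iff split: if_splits)
  moreover have "compactin (powertop_real UNIV) (\<Pi>\<^sub>E i\<in>UNIV. if i < m then {0..1} else {0})"
    by (auto simp: compactin_PiE)
  ultimately show ?thesis
    by (metis compactin_euclidean_iff euclidean_product_topology)
qed

lemma closed_cube_boundary: "closed (cube_boundary m)"
proof -
  have "closed {x::nat \<Rightarrow> real. x i = a}" for i a
    by (intro closed_Collect_eq continuous_on_coordinate continuous_on_const)
  moreover have "cube_boundary m = (\<Union>i<m. cube m \<inter> {x. x i = 0} \<union> cube m \<inter> {x. x i = 1})"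
    by (auto simp: cube_boundary_def)
  ultimately show ?thesis
    using compact_imp_closed [OF compact_cube] by (simp add: closed_UN closed_Un closed_Int)
qed

lemma compact_cube_boundary: "compact (cube_boundary m)"
  by (metis (no_types, lifting) closed_cube_boundary compact_Int_closed compact_cube cube_boundary_def inf.absorb2 mem_Collect_eq subsetI)

text \<open>A Lipschitz image of the \<open>n\<close>-dimensional boundary of a cube misses points near the origin of
  \<open>n + 1\<close>-space: \<open>O(N\<^sup>n)\<close> small cells cannot hit all \<open>N\<^sup>n\<^sup>+\<^sup>1\<close> points of a grid.\<close>

lemma lipschitz_image_misses_point:
  fixes G :: "(nat \<Rightarrow> real) \<Rightarrow> nat \<Rightarrow> real" and L e :: real and n :: nat
  assumes Lip: "\<And>x y k. \<lbrakk>x \<in> cube_boundary (Suc n); y \<in> cube_boundary (Suc n); k \<le> n\<rbrakk>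
      \<Longrightarrow> \<bar>G x k - G y k\<bar> \<le> L * (\<Sum>i\<le>n. \<bar>x i - y i\<bar>)"
    and "0 \<le> L" "0 < e"
  obtains v where "\<And>k. k \<le> n \<Longrightarrow> 0 \<le> v k \<and> v k \<le> e"
    "\<And>x. x \<in> cube_boundary (Suc n) \<Longrightarrow> \<exists>k\<le>n. G x k \<noteq> v k"
proof -
  let ?B = "cube_boundary (Suc n)"
  obtain c0 :: nat where c0: "real c0 > L * (n + 1) / e"
    using reals_Archimedean2 by blast
  \<comment> \<open>\<open>c\<close> relates the domain grid \<open>N = c * R\<close> to the target
    grid of spacing \<open>e / R\<close>: over a cell of side \<open>1 / N\<close> each coordinate
    of \<open>G\<close> varies by at most \<open>L * (n + 1) / N\<close>, which is below
    \<open>e / R\<close>.\<close>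
  define c where "c = Suc c0"
  have c: "L * (n + 1) < c * e" "c > 0"
    using c0 \<open>0 < e\<close> by (auto simp: c_def field_simps)
  \<comment> \<open>\<open>R\<close> exceeds the factor \<open>2 * (n + 1) * (2 * c) ^ n\<close> in
    the bound for the number of cells, so the \<open>R * R ^ n\<close> grid points outnumber
    them.\<close>
  define R where "R = 2 * (n + 1) * (2 * c) ^ n + 1"
  define N where "N = c * R"
  have RN: "R > 0" "N > 0"
    using c by (auto simp: R_def N_def)
  define T where "T = (\<Pi>\<^sub>E k\<in>{..n}. {..<R})"
  \<comment> \<open>A code names a face and a cell. On that face the fixed coordinate is rounded to
    exactly \<open>0\<close> or \<open>N\<close>, which lowers the exponent in the count from
    \<open>n + 1\<close> to \<open>n\<close>.\<close>
  define J where "J = (SIGMA i:{..n}. \<Pi>\<^sub>E k\<in>{..n}. if k = i then {0, N} else {..N})"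
  define side where "side = (\<lambda>x::nat \<Rightarrow> real. SOME i. i \<le> n \<and> (x i = 0 \<or> x i = 1))"
  define code where "code = (\<lambda>x::nat \<Rightarrow> real. (side x, \<lambda>k\<in>{..n}. nat \<lfloor>N * x k\<rfloor>))"
  have side: "side x \<le> n \<and> (x (side x) = 0 \<or> x (side x) = 1)" if "x \<in> ?B" for x
  proof -
    have "\<exists>i. i \<le> n \<and> (x i = 0 \<or> x i = 1)"
      using that by (auto simp: cube_boundary_def less_Suc_eq_le)
    then show ?thesis
      unfolding side_def by (rule someI_ex)
  qed
  have finJ: "finite J"
    by (auto simp: J_def intro!: finite_PiE)
  have cardT: "card T = R ^ (n + 1)"
    by (simp add: T_def card_PiE)
  have "card J \<le> (\<Sum>i\<le>n. 2 * (N + 1) ^ n)"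
  proof -
    have "card (\<Pi>\<^sub>E k\<in>{..n}. if k = i then {0, N} else {..N}) \<le> 2 * (N + 1) ^ n" if "i \<le> n" for i
    proof -
      have "card (\<Pi>\<^sub>E k\<in>{..n}. if k = i then {0, N} else {..N}) = (\<Prod>k\<le>n. card (if k = i then {0, N} else {..N}))"
        by (simp add: card_PiE)
      also have "\<dots> = card {0, N} * (\<Prod>k\<in>{..n} - {i}. card (if k = i then {0, N} else {..N}))"
        using that by (subst prod.remove [of _ i]) auto
      also have "(\<Prod>k\<in>{..n} - {i}. card (if k = i then {0, N} else {..N})) = (\<Prod>k\<in>{..n} - {i}. N + 1)"
        by (intro prod.cong) auto
      also have "\<dots> = (N + 1) ^ n"
        using that by simp
      finally show ?thesis
        using RN by simp
    qed
    then show ?thesis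
      unfolding J_def by (subst card_SigmaI) (auto intro!: sum_mono finite_PiE simp del: sum_constant)
  qed
  also have "\<dots> = 2 * (n + 1) * (N + 1) ^ n"
    by simp
  also have "\<dots> \<le> 2 * (n + 1) * (2 * N) ^ n"
    using RN by (intro mult_left_mono power_mono) auto
  also have "\<dots> = (2 * (n + 1) * (2 * c) ^ n) * R ^ n"
    by (simp add: N_def power_mult_distrib algebra_simps)
  also have "\<dots> < R * R ^ n"
    using RN by (intro mult_strict_right_mono) (auto simp: R_def)
  finally have lt: "card J < card T"
    by (simp add: cardT)
  define v where "v = (\<lambda>m::nat \<Rightarrow> nat. \<lambda>k. e * m k / R)"
  have "\<exists>m\<in>T. \<forall>x\<in>?B. \<exists>k\<le>n. G x k \<noteq> v m k"
  proof (rule ccontr)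
    assume "\<not> ?thesis"
    then obtain x where x: "\<And>m. m \<in> T \<Longrightarrow> x m \<in> ?B" and Gx: "\<And>m k. \<lbrakk>m \<in> T; k \<le> n\<rbrakk> \<Longrightarrow> G (x m) k = v m k"
      by metis
    have "code (x m) \<in> J" if "m \<in> T" for m
    proof -
      have "nat \<lfloor>N * x m k\<rfloor> \<le> N" if "k \<le> n" for k
      proof -
        have "real N * x m k \<le> real N * 1"
          using x [OF \<open>m \<in> T\<close>] that by (intro mult_left_mono) (auto simp: cube_boundary_def cube_def)
        then show ?thesis
          by (simp add: floor_le_iff nat_le_iff)
      qed
      moreover have "nat \<lfloor>N * x m (side (x m))\<rfloor> \<in> {0, N}"
        using side [OF x [OF that]] by auto
      ultimately show ?thesis
        using side [OF x [OF that]] by (auto simp: J_def code_def)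
    qed
    \<comment> \<open>Points with equal codes are so close that their images, being grid points,
      cannot differ in any coordinate.\<close>
    moreover have "inj_on (\<lambda>m. code (x m)) T"
    proof (rule inj_onI)
      fix m m' assume m: "m \<in> T" "m' \<in> T" and eq: "code (x m) = code (x m')"
      have d: "\<bar>x m i - x m' i\<bar> \<le> 1 / N" if "i \<le> n" for i
      proof -
        have "nat \<lfloor>N * x m i\<rfloor> = nat \<lfloor>N * x m' i\<rfloor>"
          using eq that unfolding code_def by (metis (no_types, lifting) atMost_iff prod.inject restrict_apply')
        moreover have "0 \<le> N * x m i" "0 \<le> N * x m' i"
          using x m that by (auto simp: cube_boundary_def cube_def)
        ultimately have "\<lfloor>N * x m i\<rfloor> = \<lfloor>N * x m' i\<rfloor>"
          by (metis eq_nat_nat_iff zero_le_floor)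
        then have "\<bar>N * x m i - N * x m' i\<bar> \<le> 1"
          by linarith
        then have "N * \<bar>x m i - x m' i\<bar> \<le> 1"
          by (metis abs_mult abs_of_nat right_diff_distrib)
        then show ?thesis
          using RN by (simp add: field_simps)
      qed
      have "m k = m' k" if "k \<le> n" for k
      proof -
        have "\<bar>v m k - v m' k\<bar> \<le> L * (\<Sum>i\<le>n. \<bar>x m i - x m' i\<bar>)"
          using Lip [OF x x that] m Gx [OF _ that] by auto
        also have "\<dots> \<le> L * (\<Sum>i\<le>n. 1 / N)"
          using d \<open>0 \<le> L\<close> by (intro mult_left_mono sum_mono) auto
        also have "\<dots> = L * (n + 1) / N"
          by simp
        also have "\<dots> < c * e / N"
          using c RN by (intro divide_strict_right_mono) auto
        also have "\<dots> = e / R"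
          using c by (simp add: N_def)
        finally have "\<bar>e * (real (m k) - real (m' k)) / R\<bar> < e / R"
          by (simp add: v_def right_diff_distrib diff_divide_distrib)
        then have "e * \<bar>real (m k) - real (m' k)\<bar> / R < e / R"
          using \<open>0 < e\<close> RN by (simp add: abs_mult)
        then have "\<bar>real (m k) - real (m' k)\<bar> < 1"
          using \<open>0 < e\<close> RN by (simp add: divide_less_cancel)
        then show ?thesis by linarith
      qed
      then show "m = m'"
        using m unfolding T_def by (intro PiE_ext) auto
    qed
    ultimately have "card T \<le> card J"
      by (intro card_inj_on_le [OF _ _ finJ]) auto
    with lt show False by simp
  qed
  then obtain m where m: "m \<in> T" "\<forall>x\<in>?B. \<exists>k\<le>n. G x k \<noteq> v m k"
    by blast
  have "0 \<le> v m k \<and> v m k \<le> e" if "k \<le> n" for k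
  proof -
    have "real (m k) \<le> real R"
      using m(1) that by (auto simp: T_def PiE_iff intro!: less_imp_le)
    then show ?thesis
      using \<open>0 < e\<close> RN by (auto simp: v_def field_simps)
  qed
  with m(2) show thesis
    by (intro that [of "v m"]) auto
qed

text \<open>Stone-Weierstrass for the algebra of functions that are Lipschitz for the sum distance
  in the first \<open>n + 1\<close> coordinates. Boundedness on the compact set \<open>S\<close>
  gives closure under products, and \<open>sep\<close> lets the coordinate functions separate
  points.\<close>

lemma lipschitz_approximation:
  fixes S :: "(nat \<Rightarrow> real) set" and f :: "(nat \<Rightarrow> real) \<Rightarrow> real"
  assumes S: "compact S" and sep: "\<And>x y. \<lbrakk>x \<in> S; y \<in> S; x \<noteq> y\<rbrakk> \<Longrightarrow> \<exists>i\<le>n. x i \<noteq> y i"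
    and f: "continuous_on S f" and "e > 0"
  obtains g L where "continuous_on S g" "L \<ge> 0" "\<And>x y. \<lbrakk>x \<in> S; y \<in> S\<rbrakk> \<Longrightarrow> \<bar>g x - g y\<bar> \<le> L * (\<Sum>i\<le>n. \<bar>x i - y i\<bar>)"
    "\<And>x. x \<in> S \<Longrightarrow> \<bar>f x - g x\<bar> < e"
proof -
  let ?d = "\<lambda>x y. \<Sum>i\<le>n. \<bar>x i - y i\<bar>"
  define P where "P = (\<lambda>g::(nat \<Rightarrow> real) \<Rightarrow> real. continuous_on S g \<and> (\<exists>L\<ge>0. \<forall>x\<in>S. \<forall>y\<in>S. \<bar>g x - g y\<bar> \<le> L * ?d x y))"
  have d0: "?d x y \<ge> 0" for x y :: "nat \<Rightarrow> real"
    by (simp add: sum_nonneg)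
  have bdd: "\<exists>M\<ge>0. \<forall>x\<in>S. \<bar>g x\<bar> \<le> M" if "continuous_on S g" for g :: "(nat \<Rightarrow> real) \<Rightarrow> real"
  proof -
    have "bounded (g ` S)"
      by (simp add: S compact_continuous_image compact_imp_bounded that)
    then show ?thesis
      unfolding bounded_pos by (metis image_eqI less_eq_real_def real_norm_def)
  qed
  have "\<exists>g. P g \<and> (\<forall>x\<in>S. \<bar>f x - g x\<bar> < e)"
  proof (rule Stone_Weierstrass_HOL [where P = P, OF S _ _ _ _ _ f \<open>e > 0\<close>])
    show "P (\<lambda>x. c)" for c
      unfolding P_def by (auto intro!: exI [of _ 0])
    show "P g \<Longrightarrow> continuous_on S g" for g
      by (simp add: P_def)
    fix g h assume gh: "P g \<and> P h"
    then obtain K L where KL: "K \<ge> 0" "\<forall>x\<in>S. \<forall>y\<in>S. \<bar>g x - g y\<bar> \<le> K * ?d x y"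
      "L \<ge> 0" "\<forall>x\<in>S. \<forall>y\<in>S. \<bar>h x - h y\<bar> \<le> L * ?d x y"
      unfolding P_def by blast
    have "\<bar>g x + h x - (g y + h y)\<bar> \<le> (K + L) * ?d x y" if "x \<in> S" "y \<in> S" for x y
    proof -
      have "\<bar>g x - g y\<bar> \<le> K * ?d x y" "\<bar>h x - h y\<bar> \<le> L * ?d x y"
        using KL that by auto
      then show ?thesis
        unfolding distrib_right by linarith
    qed
    then show "P (\<lambda>x. g x + h x)"
      using gh KL unfolding P_def by (intro conjI exI [of _ "K + L"] continuous_intros) auto
    have "continuous_on S g" "continuous_on S h"
      using gh by (auto simp: P_def)
    from bdd [OF this(1)] bdd [OF this(2)]
    obtain A B where AB: "A \<ge> 0" "\<forall>x\<in>S. \<bar>g x\<bar> \<le> A" "B \<ge> 0" "\<forall>x\<in>S. \<bar>h x\<bar> \<le> B"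
      by blast
    have "\<bar>g x * h x - g y * h y\<bar> \<le> (A * L + B * K) * ?d x y" if "x \<in> S" "y \<in> S" for x y
    proof -
      have "g x * h x - g y * h y = g x * (h x - h y) + h y * (g x - g y)"
        by (simp add: algebra_simps)
      then have "\<bar>g x * h x - g y * h y\<bar> \<le> \<bar>g x\<bar> * \<bar>h x - h y\<bar> + \<bar>h y\<bar> * \<bar>g x - g y\<bar>"
        by (metis abs_mult abs_triangle_ineq)
      also have "\<dots> \<le> A * (L * ?d x y) + B * (K * ?d x y)"
        using KL AB that by (intro add_mono mult_mono) auto
      finally show ?thesis
        by (simp add: algebra_simps)
    qed
    then show "P (\<lambda>x. g x * h x)"
      using gh KL AB unfolding P_def by (intro conjI exI [of _ "A * L + B * K"] continuous_intros) auto
  next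
    fix x y assume "x \<in> S \<and> y \<in> S \<and> x \<noteq> y"
    then obtain i where i: "i \<le> n" "x i \<noteq> y i"
      using sep by blast
    have "\<bar>x i - y i\<bar> \<le> 1 * ?d x y" for x y :: "nat \<Rightarrow> real"
      using i member_le_sum [of i "{..n}" "\<lambda>i. \<bar>x i - y i\<bar>"] by simp
    then have "P (\<lambda>x. x i)"
      unfolding P_def using continuous_on_coordinate by (intro conjI exI [of _ 1]) auto
    with i show "\<exists>f. P f \<and> f x \<noteq> f y"
      by blast
  qed
  then show thesis
    using that unfolding P_def by metis
qed

text \<open>General position: a Lipschitz approximation of a Tietze extension is translated by a
  small vector that it misses, and can then be normalised on the whole boundary. On \<open>D\<close>
  the result is only near \<open>f\<close>; a linear homotopy there, extended by
  \<open>homotopy_extension_nsphere\<close>, corrects it.\<close>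

lemma nsphere_extension_cube_boundary:
  assumes D: "closed D" "D \<subseteq> cube_boundary (Suc n)"
    and f: "continuous_map (top_of_set D) (nsphere n) f"
  obtains F where "continuous_map (top_of_set (cube_boundary (Suc n))) (nsphere n) F" "\<And>x. x \<in> D \<Longrightarrow> F x = f x"
proof -
  let ?B = "cube_boundary (Suc n)"
  let ?X = "top_of_set ?B"
  have X: "compact_space ?X" "Hausdorff_space ?X"
    using compact_cube_boundary by (auto simp: compact_space_subtopology Hausdorff_space_subtopology)
  then have nX: "normal_space ?X"
    by (simp add: compact_Hausdorff_or_regular_imp_normal_space)
  have cD: "closedin ?X D"
    using D by (simp add: closed_subset)
  have sD: "subtopology ?X D = top_of_set D"
    using D by (simp add: subtopology_subtopology inf_absorb2)
  have "continuous_map (subtopology ?X D) (nsphere n) f"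
    using f sD by simp
  from nsphere_tietze [OF nX cD this] obtain g :: "(nat \<Rightarrow> real) \<Rightarrow> nat \<Rightarrow> real"
    where g: "\<And>i. i \<le> n \<Longrightarrow> continuous_map ?X euclideanreal (\<lambda>x. g x i)"
      and gf: "\<And>x i. \<lbrakk>x \<in> D; i \<le> n\<rbrakk> \<Longrightarrow> g x i = f x i"
    by blast
  \<comment> \<open>Approximation and translation each cost at most \<open>e\<close> in every
    coordinate. Over \<open>n + 1\<close> coordinates this adds up to \<open>1 / 2\<close>, less
    than the squared norm 1 of \<open>f x\<close>, so the inner product with \<open>f x\<close>
    stays positive.\<close>
  define e where "e = 1 / (4 * (real n + 1))"
  have e: "e > 0" "(real n + 1) * (2 * e) = 1 / 2"
    by (simp_all add: e_def field_simps)
  have ex: "\<exists>G L. continuous_on ?B G \<and> L \<ge> 0 \<and> (\<forall>x\<in>?B. \<forall>y\<in>?B. \<bar>G x - G y\<bar> \<le> L * (\<Sum>i\<le>n. \<bar>x i - y i\<bar>)) \<and> (\<forall>x\<in>?B. \<bar>g x k - G x\<bar> < e)"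
    if "k \<le> n" for k
  proof -
    have sep: "\<exists>i\<le>n. x i \<noteq> y i" if "x \<in> ?B" "y \<in> ?B" "x \<noteq> y" for x y
    proof (rule ccontr)
      assume "\<not> ?thesis"
      then have "x i = y i" for i
        using that by (cases "i \<le> n") (auto simp: cube_boundary_def cube_def)
      with that show False by auto
    qed
    have c: "continuous_on ?B (\<lambda>x. g x k)"
      using g [OF that] by simp
    show ?thesis
    proof (rule lipschitz_approximation [OF compact_cube_boundary _ c e(1)])
      fix G L assume "continuous_on ?B G" "L \<ge> 0"
        "\<And>x y. \<lbrakk>x \<in> ?B; y \<in> ?B\<rbrakk> \<Longrightarrow> \<bar>G x - G y\<bar> \<le> L * (\<Sum>i\<le>n. \<bar>x i - y i\<bar>)"
        "\<And>x. x \<in> ?B \<Longrightarrow> \<bar>g x k - G x\<bar> < e"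
      then show ?thesis
        by (intro exI [of _ G] exI [of _ L]) simp
    qed (rule sep)
  qed
  define Q where "Q k G L \<longleftrightarrow> continuous_on ?B G \<and> L \<ge> 0 \<and> (\<forall>x\<in>?B. \<forall>y\<in>?B. \<bar>G x - G y\<bar> \<le> L * (\<Sum>i\<le>n. \<bar>x i - y i\<bar>))
    \<and> (\<forall>x\<in>?B. \<bar>g x k - G x\<bar> < e)" for k G L
  have "\<forall>k\<in>{..n}. \<exists>G L. Q k G L"
    using ex by (auto simp: Q_def)
  from bchoice [OF this] obtain G where "\<forall>k\<in>{..n}. \<exists>L. Q k (G k) L" by blast
  from bchoice [OF this] obtain L where "\<forall>k\<in>{..n}. Q k (G k) (L k)" by blast
  then have contG: "\<And>k. k \<le> n \<Longrightarrow> continuous_on ?B (G k)" and GL: "\<And>k. k \<le> n \<Longrightarrow> L k \<ge> 0"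
    "\<And>k x y. \<lbrakk>k \<le> n; x \<in> ?B; y \<in> ?B\<rbrakk> \<Longrightarrow> \<bar>G k x - G k y\<bar> \<le> L k * (\<Sum>i\<le>n. \<bar>x i - y i\<bar>)"
    "\<And>k x. \<lbrakk>k \<le> n; x \<in> ?B\<rbrakk> \<Longrightarrow> \<bar>g x k - G k x\<bar> < e"
    by (auto simp: Q_def)
  have Lk: "L k \<le> (\<Sum>k\<le>n. L k)" if "k \<le> n" for k
    using that GL(1) by (intro member_le_sum) auto
  obtain v where v: "\<And>k. k \<le> n \<Longrightarrow> 0 \<le> v k \<and> v k \<le> e"
    and miss: "\<And>x. x \<in> ?B \<Longrightarrow> \<exists>k\<le>n. G k x \<noteq> v k"
  proof (rule lipschitz_image_misses_point [of n "\<lambda>x k. G k x" "\<Sum>k\<le>n. L k" e])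
    show "\<bar>G k x - G k y\<bar> \<le> (\<Sum>k\<le>n. L k) * (\<Sum>i\<le>n. \<bar>x i - y i\<bar>)"
      if "x \<in> ?B" "y \<in> ?B" "k \<le> n" for x y k
      using that Lk by (intro order_trans [OF GL(2)] mult_right_mono) (auto simp: sum_nonneg)
    show "0 \<le> (\<Sum>k\<le>n. L k)"
      by (rule sum_nonneg) (use GL(1) in auto)
  qed (use e that in blast)+
  define u where "u = (\<lambda>x k. G k x - v k)"
  have u: "continuous_map ?X euclideanreal (\<lambda>x. u x k)" if "k \<le> n" for k
    using contG [OF that] by (auto simp: u_def intro!: continuous_intros)
  have nz: "(\<Sum>j\<le>n. (u x j)\<^sup>2) \<noteq> 0" if "x \<in> ?B" for x
    using miss [OF that] by (auto simp: u_def sum_nonneg_eq_0_iff)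
  have F0: "continuous_map ?X (nsphere n) (\<lambda>x. unit_vec n (u x))"
    using nz by (intro continuous_map_unit_vec u) auto
  have fS: "f x \<in> topspace (nsphere n)" if "x \<in> D" for x
    using f that by (auto simp: continuous_map_def)
  have pos: "(\<Sum>k\<le>n. unit_vec n (u x) k * f x k) > 0" if "x \<in> D" for x
  proof -
    have xB: "x \<in> ?B" using that D by auto
    have "\<bar>f x k\<bar> \<le> 1" for k
      using topspace_nsphere_1 [OF fS [OF that]] by (simp add: abs_square_le_1)
    moreover have "\<bar>u x k - f x k\<bar> \<le> 2 * e" if "k \<le> n" for k
      using GL(3) [OF that xB] v [OF that] gf [OF \<open>x \<in> D\<close> that] by (auto simp: u_def)
    ultimately have "(\<Sum>k\<le>n. \<bar>(u x k - f x k) * f x k\<bar>) \<le> (\<Sum>k\<le>n. 2 * e * 1)"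
      unfolding abs_mult using e by (intro sum_mono mult_mono) auto
    moreover have "(\<Sum>k\<le>n. 2 * e * 1) = 1 / 2"
      using e(2) by (simp add: algebra_simps)
    ultimately have "\<bar>\<Sum>k\<le>n. (u x k - f x k) * f x k\<bar> \<le> 1 / 2"
      using sum_abs [of "\<lambda>k. (u x k - f x k) * f x k" "{..n}"] by linarith
    moreover have "(\<Sum>k\<le>n. u x k * f x k) = (\<Sum>k\<le>n. (f x k)\<^sup>2) + (\<Sum>k\<le>n. (u x k - f x k) * f x k)"
      by (simp add: algebra_simps power2_eq_square flip: sum.distrib)
    ultimately have "(\<Sum>k\<le>n. u x k * f x k) > 0"
      using fS [OF that] by (auto simp: topspace_nsphere)
    moreover have "sqrt (\<Sum>j\<le>n. (u x j)\<^sup>2) > 0"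
      using nz [OF xB] by (simp add: less_le sum_nonneg)
    moreover have "(\<Sum>k\<le>n. unit_vec n (u x) k * f x k) = (\<Sum>k\<le>n. u x k * f x k) / sqrt (\<Sum>j\<le>n. (u x j)\<^sup>2)"
      by (simp add: unit_vec_def sum_divide_distrib)
    ultimately show ?thesis by simp
  qed
  obtain h where h: "continuous_map (prod_topology interval (top_of_set D)) (nsphere n) h"
    "\<And>x. x \<in> D \<Longrightarrow> h (0, x) = unit_vec n (u x)" "\<And>x. x \<in> D \<Longrightarrow> h (1, x) = unit_vec n (f x)"
  proof (rule linear_homotopy_unit_vec [of "top_of_set D" n "\<lambda>x. unit_vec n (u x)" f])
    show "continuous_map (top_of_set D) (nsphere n) (\<lambda>x. unit_vec n (u x))"
      using continuous_map_from_subtopology [OF F0, of D] sD by simp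
  qed (use f pos in \<open>auto simp: continuous_map_nsphere_iff\<close>)
  obtain H where H: "continuous_map (prod_topology interval ?X) (nsphere n) H"
    "\<And>t x. \<lbrakk>t \<in> {0..1}; x \<in> D\<rbrakk> \<Longrightarrow> H (t, x) = h (t, x)"
  proof (rule homotopy_extension_nsphere [OF X cD F0, of h])
  qed (use h sD in auto)
  show thesis
  proof
    show "continuous_map ?X (nsphere n) (\<lambda>x. H (1, x))"
      by (rule continuous_map_slice [OF H(1)]) simp
    show "H (1, x) = f x" if "x \<in> D" for x
      using H(2) [of 1 x] h(3) [OF that] that unit_vec_scale [OF fS [OF that], of 1 "f x"] by auto
  qed
qed

lemma continuous_on_Max_lessThan:
  fixes f :: "nat \<Rightarrow> 'a::topological_space \<Rightarrow> real"
  assumes "\<And>i. i \<le> m \<Longrightarrow> continuous_on S (f i)"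
  shows "continuous_on S (\<lambda>x. Max ((\<lambda>i. f i x) ` {..m}))"
  using assms
proof (induction m)
  case (Suc m)
  have "Max ((\<lambda>i. f i x) ` {..Suc m}) = max (f (Suc m) x) (Max ((\<lambda>i. f i x) ` {..m}))" for x
    by (simp add: atMost_Suc)
  then show ?case
    using Suc by (simp add: continuous_on_max)
qed simp

text \<open>The gauge \<open>r\<close> of the cube centred at \<open>z\<close> is 1 exactly on the boundary.\<close>

lemma cube_radial_retraction:
  assumes z: "z \<in> cube (Suc n)" "z \<notin> cube_boundary (Suc n)"
  obtains r where "continuous_on (cube (Suc n) - {z}) r"
    "r \<in> cube (Suc n) - {z} \<rightarrow> cube_boundary (Suc n)" "\<And>x. x \<in> cube_boundary (Suc n) \<Longrightarrow> r x = x"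
proof -
  have z01: "0 < z i \<and> z i < 1" if "i \<le> n" for i
  proof -
    have "i < Suc n"
      using that by simp
    then have "0 \<le> z i \<and> z i \<le> 1" "z i \<noteq> 0 \<and> z i \<noteq> 1"
      using z by (auto simp: cube_def cube_boundary_def)
    then show ?thesis by linarith
  qed
  \<comment> \<open>The two quotients equal 1 on the faces where coordinate \<open>i\<close> is 1
    and 0 respectively; the larger one measures progress from \<open>z\<close> towards the face
    ahead.\<close>
  define a where "a = (\<lambda>i x. max ((x i - z i) / (1 - z i)) ((z i - x i) / z i))"
  define g where "g = (\<lambda>x. Max ((\<lambda>i. a i x) ` {..n}))"
  define r where "r = (\<lambda>x i. z i + (x i - z i) / g x)"
  have "continuous_on UNIV (a i)" if "i \<le> n" for i
    using z01 [OF that] unfolding a_def by (intro continuous_intros continuous_on_coordinate) auto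
  then have contg: "continuous_on UNIV g"
    unfolding g_def by (rule continuous_on_Max_lessThan)
  have ag: "a i x \<le> g x" if "i \<le> n" for i x
    using that by (auto simp: g_def)
  have ex: "\<exists>i\<le>n. g x = a i x" for x
  proof -
    have "g x \<in> (\<lambda>i. a i x) ` {..n}"
      unfolding g_def by (rule Max_in) auto
    then show ?thesis by auto
  qed
  have pos: "g x > 0" if "x \<in> cube (Suc n)" "x \<noteq> z" for x
  proof -
    obtain i where i: "x i \<noteq> z i"
      using \<open>x \<noteq> z\<close> by (auto simp: fun_eq_iff)
    then have "i \<le> n"
      using that z by (force simp: cube_def not_less_eq_eq [symmetric] not_le)
    then have "a i x > 0"
      using i z01 [OF \<open>i \<le> n\<close>] by (auto simp: a_def less_max_iff_disj zero_less_divide_iff)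
    then show ?thesis
      using ag [OF \<open>i \<le> n\<close>, of x] by linarith
  qed
  have r01: "0 \<le> r x i \<and> r x i \<le> 1" if "g x > 0" "i \<le> n" for x i
  proof -
    have "(x i - z i) / (1 - z i) \<le> g x" "(z i - x i) / z i \<le> g x"
      using ag [OF that(2), of x] by (auto simp: a_def)
    then have "x i - z i \<le> g x * (1 - z i)" "z i - x i \<le> g x * z i"
      using z01 [OF that(2)] by (auto simp: field_simps)
    then have "(x i - z i) / g x \<le> 1 - z i" "(z i - x i) / g x \<le> z i"
      using that(1) by (auto simp: field_simps)
    moreover have "(z i - x i) / g x = - ((x i - z i) / g x)"
      by (metis minus_diff_eq minus_divide_left)
    ultimately show ?thesis
      by (simp add: r_def)
  qed
  have rb: "r x \<in> cube_boundary (Suc n)" if x: "x \<in> cube (Suc n)" "x \<noteq> z" for x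
  proof -
    have "r x \<in> cube (Suc n)"
      using x z r01 [OF pos [OF x]] by (auto simp: cube_def r_def less_Suc_eq_le)
    moreover obtain i where i: "i \<le> n" "g x = a i x"
      using ex by blast
    then consider "g x = (x i - z i) / (1 - z i)" | "g x = (z i - x i) / z i"
      by (auto simp: a_def max_def split: if_splits)
    then have "r x i = 0 \<or> r x i = 1"
    proof cases
      case 1
      then have "x i - z i = g x * (1 - z i)"
        using z01 [OF i(1)] by (simp add: field_simps)
      then show ?thesis using pos [OF x] by (simp add: r_def)
    next
      case 2
      then have "x i - z i = - (g x * z i)"
        using z01 [OF i(1)] by (simp add: field_simps)
      then show ?thesis using pos [OF x] by (simp add: r_def)
    qed
    ultimately show ?thesis
      using i(1) by (auto simp: cube_boundary_def less_Suc_eq_le)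
  qed
  have g1: "g x = 1" if x: "x \<in> cube_boundary (Suc n)" for x
  proof -
    have "a i x \<le> 1" if "i \<le> n" for i
      using z01 [OF that] x that by (auto simp: a_def cube_boundary_def cube_def less_Suc_eq_le)
    then have "g x \<le> 1"
      using ex [of x] by auto
    moreover obtain i where i: "i \<le> n" "x i = 0 \<or> x i = 1"
      using x by (auto simp: cube_boundary_def less_Suc_eq_le)
    then have "a i x \<ge> 1"
      using z01 [OF i(1)] by (auto simp: a_def le_max_iff_disj)
    then have "g x \<ge> 1"
      using ag [OF i(1), of x] by linarith
    ultimately show ?thesis by simp
  qed
  show thesis
  proof
    show "continuous_on (cube (Suc n) - {z}) r"
    proof (rule continuous_on_coordinatewise_then_product)
      show "continuous_on (cube (Suc n) - {z}) (\<lambda>x. r x i)" for i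
        unfolding r_def using pos
        by (intro continuous_intros continuous_on_coordinate continuous_on_subset [OF contg]) force+
    qed
    show "r \<in> cube (Suc n) - {z} \<rightarrow> cube_boundary (Suc n)"
      using rb by auto
    show "r x = x" if "x \<in> cube_boundary (Suc n)" for x
      using g1 [OF that] by (simp add: r_def)
  qed
qed

text \<open>The extension over the boundary is pulled back by the radial retraction from
  \<open>z\<close>. The puncture cannot be avoided in general: a map on the full boundary may have
  nonzero degree.\<close>

lemma nsphere_extension_punctured_cube:
  assumes D: "closed D" "D \<subseteq> cube_boundary (Suc n)"
    and f: "continuous_map (top_of_set D) (nsphere n) f"
    and z: "z \<in> cube (Suc n)" "z \<notin> cube_boundary (Suc n)"
  obtains F where "continuous_map (top_of_set (cube (Suc n) - {z})) (nsphere n) F" "\<And>x. x \<in> D \<Longrightarrow> F x = f x"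
proof -
  obtain F where F: "continuous_map (top_of_set (cube_boundary (Suc n))) (nsphere n) F" "\<And>x. x \<in> D \<Longrightarrow> F x = f x"
    by (rule nsphere_extension_cube_boundary [OF D f]) blast
  obtain r where r: "continuous_on (cube (Suc n) - {z}) r"
    "r \<in> cube (Suc n) - {z} \<rightarrow> cube_boundary (Suc n)" "\<And>x. x \<in> cube_boundary (Suc n) \<Longrightarrow> r x = x"
    by (rule cube_radial_retraction [OF z]) blast
  have "continuous_map (top_of_set (cube (Suc n) - {z})) (top_of_set (cube_boundary (Suc n))) r"
    using r by (simp add: continuous_map_in_subtopology)
  from continuous_map_compose [OF this F(1)] show thesis
    using D(2) r(3) F(2) by (intro that [of "F \<circ> r"]) auto
qed

text \<open>A step towards the centre leaves every face at once, and a short step stays in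
  \<open>V\<close>. Thus a point outside a closed set, possibly on a face, is exchanged for one over
  which the prism may be punctured.\<close>

lemma open_cube_interior:
  assumes V: "openin (top_of_set (cube n)) V" and "V \<noteq> {}"
  obtains w where "w \<in> V" "w \<notin> cube_boundary n"
proof -
  obtain x where x: "x \<in> V" using assms by blast
  have xc: "x \<in> cube n"
    using openin_subset [OF V] x by auto
  let ?c = "\<lambda>t i. if i < n then x i + t * (1 / 2 - x i) else (0::real)"
  have c0: "?c 0 = x"
    using xc by (auto simp: cube_def fun_eq_iff)
  have conv: "0 \<le> a + t * (1 / 2 - a) \<and> a + t * (1 / 2 - a) \<le> 1" if "0 \<le> a" "a \<le> 1" "0 \<le> t" "t \<le> 1" for a t :: real
  proof -
    have eq: "a + t * (1 / 2 - a) = (1 - t) * a + t * (1 / 2)"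
      by (simp add: algebra_simps)
    have "0 \<le> (1 - t) * a" "(1 - t) * a \<le> (1 - t) * 1"
      using that mult_left_mono [of a 1 "1 - t"] by auto
    then show ?thesis
      unfolding eq using that by auto
  qed
  have cube: "?c t \<in> cube n" if "0 \<le> t" "t \<le> 1" for t
    using xc conv that by (auto simp: cube_def)
  have "continuous_on {0..1} ?c"
  proof (rule continuous_on_coordinatewise_then_product)
    show "continuous_on {0..1} (\<lambda>t. ?c t i)" for i
      by (cases "i < n") (auto intro!: continuous_intros)
  qed
  then have "continuous_map interval (top_of_set (cube n)) ?c"
    using cube by (auto simp: continuous_map_in_subtopology)
  from openin_continuous_map_preimage [OF this V]
  have "openin interval {t \<in> {0..1}. ?c t \<in> V}" by simp
  then obtain T where T: "open T" "{t \<in> {0..1}. ?c t \<in> V} = {0..1} \<inter> T"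
    by (auto simp: openin_open)
  have "0 \<in> {t \<in> {0..1::real}. ?c t \<in> V}"
    using x c0 by simp
  then have "0 \<in> T"
    using T(2) by blast
  then obtain e where e: "e > 0" "ball 0 e \<subseteq> T"
    using T(1) openE by blast
  define t where "t = min (e / 2) (1 / 2)"
  have t: "0 < t" "t \<le> 1 / 2" "t < e"
    using e by (auto simp: t_def)
  then have "t \<in> {0..1} \<inter> T"
    using e by (auto simp: dist_real_def)
  then have "?c t \<in> V"
    using T(2) by blast
  moreover have "?c t \<notin> cube_boundary n"
  proof
    assume "?c t \<in> cube_boundary n"
    then obtain i where i: "i < n" "x i + t * (1 / 2 - x i) = 0 \<or> x i + t * (1 / 2 - x i) = 1"
      by (auto simp: cube_boundary_def split: if_splits)
    have xi: "0 \<le> x i" "x i \<le> 1"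
      using xc i by (auto simp: cube_def)
    have eq: "x i + t * (1 / 2 - x i) = (1 - t) * x i + t * (1 / 2)"
      by (simp add: algebra_simps)
    have "0 \<le> (1 - t) * x i" "(1 - t) * x i \<le> 1 - t"
      using xi t mult_left_mono [of "x i" 1 "1 - t"] by auto
    then show False
      using i(2) t(1) unfolding eq by linarith
  qed
  ultimately show thesis by (rule that)
qed

section \<open>Extension of homotopies across charts\<close>

text \<open>\<open>Q\<close> is a closed cell and \<open>U\<close> an open set around
  \<open>y\<close> in it; \<open>U\<close> may differ from the interior of the cell, since a
  boundary point \<open>y\<close> itself lies on a face. The parts of \<open>Q\<close> outside
  \<open>U\<close> and in \<open>B\<close> lie on faces, so once \<open>U\<close> is removed from a
  closed set, values over \<open>Q\<close> are prescribed on the boundary of the prism only.\<close>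

definition cube_chart :: "nat \<Rightarrow> 'a topology \<Rightarrow> 'a set \<Rightarrow> 'a \<Rightarrow> 'a set \<Rightarrow> 'a set \<Rightarrow> ('a \<Rightarrow> nat \<Rightarrow> real) \<Rightarrow> bool" where
  "cube_chart n M B y Q U \<psi> \<longleftrightarrow> openin M U \<and> y \<in> U \<and> U \<subseteq> Q \<and> closedin M Q \<and>
     homeomorphic_map (subtopology M Q) (top_of_set (cube n)) \<psi> \<and>
     \<psi> ` (Q - U) \<subseteq> cube_boundary n \<and> \<psi> ` (Q \<inter> B) \<subseteq> cube_boundary n"

text \<open>If no member of the chain lay in \<open>V\<close>, the closed sets \<open>Y - V\<close>
  would have the finite intersection property. This is the limit step in the search for minimal
  closed sets.\<close>

lemma compact_chain_Inter_subset:
  assumes M: "compact_space M" and C: "\<And>Y. Y \<in> \<C> \<Longrightarrow> closedin M Y" "\<C> \<noteq> {}"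
    and chain: "\<And>Y Z. \<lbrakk>Y \<in> \<C>; Z \<in> \<C>\<rbrakk> \<Longrightarrow> Y \<subseteq> Z \<or> Z \<subseteq> Y"
    and V: "openin M V" "\<Inter>\<C> \<subseteq> V"
  obtains Y where "Y \<in> \<C>" "Y \<subseteq> V"
proof (rule ccontr)
  assume "\<not> thesis"
  then have ne: "\<And>Y. Y \<in> \<C> \<Longrightarrow> \<not> Y \<subseteq> V"
    using that by blast
  let ?F = "(\<lambda>Y. Y - V) ` \<C>"
  have min: "\<exists>Y\<in>\<C>. \<forall>Z\<in>\<D>. Y \<subseteq> Z" if "finite \<D>" "\<D> \<subseteq> \<C>" for \<D>
    using that
  proof (induction rule: finite_induct)
    case empty
    then show ?case using C(2) by blast
  next
    case (insert Z \<D>)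
    then obtain Y where Y: "Y \<in> \<C>" "\<forall>Z\<in>\<D>. Y \<subseteq> Z" by blast
    then show ?case
    proof (cases "Y \<subseteq> Z")
      case True
      with Y show ?thesis by blast
    next
      case False
      then have "Z \<subseteq> Y"
        using chain [of Y Z] insert.prems Y by blast
      with Y insert.prems show ?thesis by blast
    qed
  qed
  have "\<Inter>?F \<noteq> {}"
  proof (rule compact_space_fip [THEN iffD1, OF M, rule_format], intro conjI allI impI ballI)
    fix T assume "T \<in> ?F"
    then show "closedin M T"
      using C(1) V(1) by (auto intro: closedin_diff)
  next
    fix \<F> assume "finite \<F> \<and> \<F> \<subseteq> ?F"
    then obtain \<D> where \<D>: "finite \<D>" "\<D> \<subseteq> \<C>" "\<F> = (\<lambda>Y. Y - V) ` \<D>"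
      by (metis finite_subset_image)
    then obtain Y where "Y \<in> \<C>" "\<forall>Z\<in>\<D>. Y \<subseteq> Z"
      using min by blast
    then show "\<Inter>\<F> \<noteq> {}"
      using ne [of Y] \<D>(3) by blast
  qed
  then show False
    using V(2) C(2) by blast
qed

lemma continuous_map_euclidean_fun_iff:
  "continuous_map X (euclidean :: (nat \<Rightarrow> real) topology) f \<longleftrightarrow>
   (\<forall>i. continuous_map X euclideanreal (\<lambda>x. f x i))"
  by (simp add: continuous_map_componentwise_UNIV flip: euclidean_product_topology)

text \<open>With time as an extra coordinate the prism over \<open>Q\<close> is a cube of dimension
  \<open>n + 1\<close>. The ends and the sides over \<open>L\<close> lie in its boundary, and a
  puncture over \<open>w\<close>, a point missed by \<open>C\<close>, lets the map extend.\<close>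

lemma prism_chart_extension:
  assumes M: "compact_space M" and Q: "closedin M Q"
    and \<psi>: "homeomorphic_map (subtopology M Q) (top_of_set (cube n)) \<psi>"
    and C: "closedin M C" "C \<subseteq> Q" and L: "closedin M L" "L \<subseteq> C" "\<psi> ` L \<subseteq> cube_boundary n"
    and w: "w \<in> Q" "w \<notin> C" "\<psi> w \<notin> cube_boundary n"
    and \<Phi>: "continuous_map (subtopology (prod_topology interval M) ({0,1} \<times> C \<union> {0..1} \<times> L)) (nsphere n) \<Phi>"
  obtains \<Theta> where "continuous_map (subtopology (prod_topology interval M) ({0..1} \<times> C)) (nsphere n) \<Theta>"
    "\<And>z. z \<in> {0,1} \<times> C \<union> {0..1} \<times> L \<Longrightarrow> \<Theta> z = \<Phi> z"
proof -
  let ?P = "prod_topology interval M" and ?E = "{0,1::real} \<times> C \<union> {0..1} \<times> L"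
  have QM: "Q \<subseteq> topspace M"
    using Q closedin_subset by auto
  obtain \<phi> where "homeomorphic_maps (subtopology M Q) (top_of_set (cube n)) \<psi> \<phi>"
    using \<psi> homeomorphic_map_maps by blast
  then have c\<psi>: "continuous_map (subtopology M Q) (top_of_set (cube n)) \<psi>"
    and c\<phi>: "continuous_map (top_of_set (cube n)) (subtopology M Q) \<phi>"
    and \<phi>\<psi>: "\<And>x. x \<in> Q \<Longrightarrow> \<phi> (\<psi> x) = x"
    using QM by (auto simp: homeomorphic_maps_def)
  have \<psi>c: "\<psi> x \<in> cube n" if "x \<in> Q" for x
    using c\<psi> that QM by (auto simp: continuous_map_def Pi_iff)
  have \<psi>n: "(\<psi> x)(n := t, n := 0) = \<psi> x" if "x \<in> Q" for x t
    using \<psi>c [OF that] by (auto simp: cube_def)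
  \<comment> \<open>Time goes into coordinate \<open>n\<close>, the first one that
    \<open>cube n\<close> keeps at 0.\<close>
  define \<eta> where "\<eta> = (\<lambda>(t, x). (\<psi> x)(n := t))"
  define \<kappa> where "\<kappa> = (\<lambda>u. (u n, \<phi> (u(n := 0))))"
  have \<kappa>\<eta>: "\<kappa> (\<eta> (t, x)) = (t, x)" if "x \<in> Q" for t x
    using \<psi>n [OF that, of t] \<phi>\<psi> [OF that] by (simp add: \<kappa>_def \<eta>_def)
  have \<eta>c: "\<eta> (t, x) \<in> cube (Suc n)" if "t \<in> {0..1}" "x \<in> Q" for t x
    using \<psi>c [OF that(2)] that(1) by (auto simp: \<eta>_def cube_def less_Suc_eq)
  have c\<eta>: "continuous_map (subtopology ?P ({0..1} \<times> Q)) (top_of_set (cube (Suc n))) \<eta>"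
  proof -
    have snd: "continuous_map (subtopology ?P ({0..1} \<times> Q)) (subtopology M Q) snd"
      by (auto simp: continuous_map_in_subtopology intro: continuous_map_from_subtopology continuous_map_snd)
    have "continuous_map (subtopology ?P ({0..1} \<times> Q)) (top_of_set (cube n)) (\<psi> \<circ> snd)"
      by (rule continuous_map_compose [OF snd c\<psi>])
    then have i: "continuous_map (subtopology ?P ({0..1} \<times> Q)) euclideanreal (\<lambda>z. \<psi> (snd z) i)" for i
      by (simp add: continuous_map_in_subtopology continuous_map_euclidean_fun_iff)
    have fst: "continuous_map (subtopology ?P ({0..1} \<times> Q)) euclideanreal fst"
      using continuous_map_fst [of interval M] continuous_map_into_fulltopology continuous_map_from_subtopology by blast
    have "continuous_map (subtopology ?P ({0..1} \<times> Q)) euclideanreal (\<lambda>z. \<eta> z k)" for k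
      using i fst by (cases "k = n") (simp_all add: \<eta>_def case_prod_unfold)
    then show ?thesis
      using \<eta>c by (auto simp: continuous_map_in_subtopology continuous_map_euclidean_fun_iff)
  qed
  have c\<kappa>: "continuous_map (top_of_set (cube (Suc n))) ?P \<kappa>"
  proof -
    have 1: "continuous_map (top_of_set (cube (Suc n))) interval (\<lambda>u. u n)"
      using continuous_on_coordinate by (auto simp: continuous_map_in_subtopology cube_def)
    have "continuous_map (top_of_set (cube (Suc n))) euclideanreal (\<lambda>u. (u(n := 0)) k)" for k
      using continuous_on_coordinate by (cases "k = n") auto
    then have "continuous_map (top_of_set (cube (Suc n))) (top_of_set (cube n)) (\<lambda>u. u(n := 0))"
      by (auto simp: continuous_map_in_subtopology continuous_map_euclidean_fun_iff cube_def)
    from continuous_map_compose [OF this continuous_map_into_fulltopology [OF c\<phi>]]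
    have 2: "continuous_map (top_of_set (cube (Suc n))) M (\<lambda>u. \<phi> (u(n := 0)))"
      by (simp add: o_def)
    show ?thesis
      unfolding \<kappa>_def continuous_map_pairwise o_def fst_conv snd_conv using 1 2 by blast
  qed
  define D where "D = \<eta> ` ?E"
  have EQ: "?E \<subseteq> {0..1} \<times> Q"
    using C L by auto
  have "closedin ?P ?E"
    using C L by (intro closedin_Un) (auto simp: closedin_prod_Times_iff closed_subset)
  moreover have "compact_space ?P"
    using M by (simp add: compact_space_prod_topology compact_space_subtopology)
  ultimately have "compactin ?P ?E"
    by (simp add: closedin_compact_space)
  then have "compactin (subtopology ?P ({0..1} \<times> Q)) ?E"
    using EQ by (simp add: compactin_subtopology)
  from image_compactin [OF this c\<eta>] have "closed D"
    unfolding D_def by (simp add: compactin_subtopology compact_imp_closed)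
  have Db: "D \<subseteq> cube_boundary (Suc n)"
  proof
    fix u assume "u \<in> D"
    then obtain t x where tx: "(t, x) \<in> ?E" "u = \<eta> (t, x)"
      unfolding D_def by blast
    then have "t \<in> {0..1} \<and> x \<in> Q"
      using EQ by blast
    then have "u \<in> cube (Suc n)"
      using \<eta>c tx(2) by blast
    moreover have "\<exists>i<Suc n. u i = 0 \<or> u i = 1"
    proof (cases "t \<in> {0,1}")
      case True
      then show ?thesis
        using tx by (intro exI [of _ n]) (auto simp: \<eta>_def)
    next
      case False
      then have "\<psi> x \<in> cube_boundary n"
        using tx L by auto
      then obtain i where "i < n" "\<psi> x i = 0 \<or> \<psi> x i = 1"
        by (auto simp: cube_boundary_def)
      then show ?thesis
        using tx by (intro exI [of _ i]) (auto simp: \<eta>_def)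
    qed
    ultimately show "u \<in> cube_boundary (Suc n)"
      by (simp add: cube_boundary_def)
  qed
  have \<kappa>D: "\<kappa> ` D \<subseteq> ?E"
  proof
    fix y assume "y \<in> \<kappa> ` D"
    then obtain t x where tx: "(t, x) \<in> ?E" "y = \<kappa> (\<eta> (t, x))"
      unfolding D_def by blast
    then have "x \<in> Q"
      using EQ by blast
    with tx show "y \<in> ?E"
      using \<kappa>\<eta> by simp
  qed
  have "continuous_map (top_of_set D) ?P \<kappa>"
    using continuous_map_from_subtopology_mono [OF c\<kappa>, of D] Db by (auto simp: cube_boundary_def)
  then have "continuous_map (top_of_set D) (subtopology ?P ?E) \<kappa>"
    using \<kappa>D by (auto simp: continuous_map_in_subtopology)
  from continuous_map_compose [OF this \<Phi>]
  have f: "continuous_map (top_of_set D) (nsphere n) (\<Phi> \<circ> \<kappa>)" .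
  \<comment> \<open>Time \<open>1 / 2\<close> and a point \<open>w\<close> off the faces put the
    puncture in the interior of the cube; lying over \<open>w\<close>, it is outside the prism over
    \<open>C\<close>.\<close>
  define z where "z = \<eta> (1 / 2, w)"
  have z: "z \<in> cube (Suc n)" "z \<notin> cube_boundary (Suc n)"
  proof -
    show "z \<in> cube (Suc n)"
      unfolding z_def using w by (intro \<eta>c) auto
    show "z \<notin> cube_boundary (Suc n)"
      using w(3) \<psi>c [OF w(1)] by (auto simp: z_def \<eta>_def cube_boundary_def less_Suc_eq)
  qed
  from nsphere_extension_punctured_cube [OF \<open>closed D\<close> Db f z]
  obtain F where F: "continuous_map (top_of_set (cube (Suc n) - {z})) (nsphere n) F"
    and FD: "\<And>x. x \<in> D \<Longrightarrow> F x = (\<Phi> \<circ> \<kappa>) x"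
    by blast
  have \<eta>z: "\<eta> (t, x) \<noteq> z" if "x \<in> C" for t x
    using \<kappa>\<eta> [of x t] \<kappa>\<eta> [of w "1/2"] that w C by (auto simp: z_def)
  have "continuous_map (subtopology ?P ({0..1} \<times> C)) (top_of_set (cube (Suc n))) \<eta>"
    by (rule continuous_map_from_subtopology_mono [OF c\<eta>]) (use C in auto)
  then have "continuous_map (subtopology ?P ({0..1} \<times> C)) (top_of_set (cube (Suc n) - {z})) \<eta>"
    using \<eta>z by (auto simp: continuous_map_in_subtopology Pi_iff)
  from continuous_map_compose [OF this F]
  have "continuous_map (subtopology ?P ({0..1} \<times> C)) (nsphere n) (F \<circ> \<eta>)" .
  moreover have "(F \<circ> \<eta>) e = \<Phi> e" if "e \<in> ?E" for e
  proof -
    have "\<eta> e \<in> D"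
      using that unfolding D_def by blast
    moreover have "snd e \<in> Q"
      using that EQ by auto
    then have "\<kappa> (\<eta> e) = e"
      using \<kappa>\<eta> [of "snd e" "fst e"] by simp
    ultimately show ?thesis
      using FD by auto
  qed
  ultimately show thesis
    by (rule that)
qed

text \<open>The homotopy extends over all of \<open>X\<close>, for otherwise there is a minimal closed \<open>Y\<close> over which it does not.
  By the assumption on holes \<open>Y\<close> has a frontier point outside \<open>K\<close>. A chart there contains a point outside \<open>Y\<close>, from which
  the extension over \<open>Y\<close> minus the chart is completed radially.\<close>

lemma prism_extension:
  fixes M :: "'a topology"
  assumes M: "compact_space M" "Hausdorff_space M"
    and charts: "\<And>y G. \<lbrakk>openin M G; y \<in> G\<rbrakk> \<Longrightarrow> \<exists>Q U \<psi>. Q \<subseteq> G \<and> cube_chart n M B y Q U \<psi>"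
    and A: "closedin M A" "A \<subseteq> B" and K: "closedin M K" and X: "closedin M X" "K \<subseteq> X" "A \<subseteq> X"
    and hole: "\<And>T. \<lbrakk>openin M T; T \<subseteq> X; closedin M (T \<union> K)\<rbrakk> \<Longrightarrow> T \<subseteq> K"
    and \<Phi>: "continuous_map (subtopology (prod_topology interval M) ({0,1} \<times> X \<union> {0..1} \<times> (K \<union> A))) (nsphere n) \<Phi>"
  obtains \<Psi> where "continuous_map (subtopology (prod_topology interval M) ({0..1} \<times> X)) (nsphere n) \<Psi>"
    "\<And>z. z \<in> {0,1} \<times> X \<union> {0..1} \<times> (K \<union> A) \<Longrightarrow> \<Psi> z = \<Phi> z"
proof -
  let ?P = "prod_topology interval M" and ?D = "{0,1::real} \<times> X \<union> {0..1} \<times> (K \<union> A)"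
  let ?D' = "\<lambda>Y. {0,1::real} \<times> X \<union> {0..1} \<times> (Y \<union> (K \<union> A))"
  \<comment> \<open>\<open>E Y\<close> says that the prescribed values extend over the prism above
    \<open>Y\<close>. Both ends over all of \<open>X\<close> stay in the domain, so extensions over
    larger sets already agree with \<open>\<Phi>\<close> there.\<close>
  define E where "E = (\<lambda>Y. \<exists>\<Psi>. continuous_map (subtopology ?P (?D' Y)) (nsphere n) \<Psi> \<and> (\<forall>z\<in>?D. \<Psi> z = \<Phi> z))"
  have cI: "compact_space interval"
    by (simp add: compact_space_subtopology)
  have nP: "normal_space ?P"
    using M cI by (simp add: compact_Hausdorff_or_regular_imp_normal_space compact_space_prod_topology
        Hausdorff_space_prod_topology Hausdorff_space_subtopology)
  have closedP: "closedin ?P ({0..1} \<times> Y)" "closedin ?P ({0,1} \<times> Y)" if "closedin M Y" for Y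
    using that by (auto simp: closedin_prod_Times_iff closed_subset)
  have closedD': "closedin ?P (?D' Y)" if "closedin M Y" for Y
    by (intro closedin_Un closedP) (use that A(1) K X(1) in auto)
  have E0: "E Y" if "Y \<subseteq> K" for Y
  proof -
    have "?D' Y = ?D" using that by auto
    with \<Phi> have "continuous_map (subtopology ?P (?D' Y)) (nsphere n) \<Phi>"
      by (simp only:)
    then show ?thesis
      unfolding E_def by blast
  qed
  have "E X"
  proof (rule ccontr)
    assume "\<not> E X"
    \<comment> \<open>Minimal closed sets are sought as maximal open complements, the form in which
      \<open>subset_Zorn\<close> applies.\<close>
    define \<A> where "\<A> = {Z. openin M Z \<and> topspace M - X \<subseteq> Z \<and> \<not> E (topspace M - Z)}"
    have "\<exists>Z\<in>\<A>. \<forall>Z'\<in>\<A>. Z \<subseteq> Z' \<longrightarrow> Z' = Z"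
    proof (rule subset_Zorn)
      fix \<C> assume \<C>: "subset.chain \<A> \<C>"
      show "\<exists>U\<in>\<A>. \<forall>Z\<in>\<C>. Z \<subseteq> U"
      proof (cases "\<C> = {}")
        case True
        have "topspace M - (topspace M - X) = X"
          using X(1) closedin_subset by fastforce
        then have "topspace M - X \<in> \<A>"
          using \<open>\<not> E X\<close> X(1) by (simp add: \<A>_def openin_diff)
        with True show ?thesis by blast
      next
        case False
        have \<C>\<A>: "\<C> \<subseteq> \<A>"
          using \<C> by (simp add: subset_chain_def)
        have op: "openin M (\<Union>\<C>)"
          using \<C>\<A> by (auto simp: \<A>_def)
        \<comment> \<open>An extension over the intersection of a chain of closed sets spreads to a
          neighbourhood, which by compactness contains the prism over some member of the
          chain.\<close>
        have "\<not> E (topspace M - \<Union>\<C>)"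
        proof
          assume "E (topspace M - \<Union>\<C>)"
          then obtain \<Psi> where \<Psi>: "continuous_map (subtopology ?P (?D' (topspace M - \<Union>\<C>))) (nsphere n) \<Psi>"
            and \<Psi>\<Phi>: "\<And>z. z \<in> ?D \<Longrightarrow> \<Psi> z = \<Phi> z"
            unfolding E_def by blast
          from nsphere_neighbourhood_extension [OF nP closedD' \<Psi>] op
          obtain W g where W: "openin ?P W" "?D' (topspace M - \<Union>\<C>) \<subseteq> W"
            and g: "continuous_map (subtopology ?P W) (nsphere n) g"
            and g\<Psi>: "\<And>z. z \<in> ?D' (topspace M - \<Union>\<C>) \<Longrightarrow> g z = \<Psi> z"
            by blast
          define V where "V = topspace M - snd ` (topspace ?P - W)"
          have "closedin M (snd ` (topspace ?P - W))"
            using closed_map_snd [OF cI, of M] W(1) closedin_diff [OF closedin_topspace W(1)]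
            unfolding closed_map_def by blast
          then have V: "openin M V"
            by (simp add: V_def openin_diff)
          have VW: "(t, x) \<in> W" if "x \<in> V" "t \<in> {0..1}" for t x
            using that by (force simp: V_def image_iff)
          have "\<Inter>((\<lambda>Z. topspace M - Z) ` \<C>) \<subseteq> V"
          proof
            fix x assume "x \<in> \<Inter>((\<lambda>Z. topspace M - Z) ` \<C>)"
            then have "x \<in> topspace M - \<Union>\<C>" using False by blast
            moreover from this have "(a, x) \<in> W" if "a \<in> {0..1}" for a
              using W(2) that by blast
            ultimately show "x \<in> V"
              unfolding V_def by auto
          qed
          then obtain Y where "Y \<in> (\<lambda>Z. topspace M - Z) ` \<C>" "Y \<subseteq> V"
          proof (rule compact_chain_Inter_subset [OF M(1) _ _ _ V, rotated 3])
            fix Y Z assume "Y \<in> (\<lambda>Z. topspace M - Z) ` \<C>" "Z \<in> (\<lambda>Z. topspace M - Z) ` \<C>"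
            then show "Y \<subseteq> Z \<or> Z \<subseteq> Y"
              using \<C> unfolding subset_chain_def by blast
          qed (use \<C>\<A> False in \<open>auto simp: \<A>_def\<close>)
          then obtain Z where Z: "Z \<in> \<C>" "topspace M - Z \<subseteq> V"
            by blast
          have sub: "?D' (topspace M - Z) \<subseteq> W"
            using W(2) Z(2) VW by blast
          have "continuous_map (subtopology ?P (?D' (topspace M - Z))) (nsphere n) g"
            by (rule continuous_map_from_subtopology_mono [OF g sub])
          moreover have "g z = \<Phi> z" if "z \<in> ?D" for z
          proof -
            have "z \<in> ?D' (topspace M - \<Union>\<C>)"
              using that by blast
            then show ?thesis
              using g\<Psi> \<Psi>\<Phi> [OF that] by simp
          qed
          ultimately have "E (topspace M - Z)"
            unfolding E_def by blast
          with Z \<C>\<A> show False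
            by (auto simp: \<A>_def)
        qed
        then have "\<Union>\<C> \<in> \<A>"
          using op \<C>\<A> False by (auto simp: \<A>_def)
        then show ?thesis by blast
      qed
    qed
    then obtain Z where Z: "Z \<in> \<A>" and max: "\<And>Z'. \<lbrakk>Z' \<in> \<A>; Z \<subseteq> Z'\<rbrakk> \<Longrightarrow> Z' = Z"
      by blast
    define Y where "Y = topspace M - Z"
    have Y: "closedin M Y" "Y \<subseteq> X" "\<not> E Y"
      using Z by (auto simp: Y_def \<A>_def)
    have min: "E Y'" if "closedin M Y'" "Y' \<subset> Y" for Y'
    proof (rule ccontr)
      assume "\<not> E Y'"
      moreover have "topspace M - (topspace M - Y') = Y'"
        using that closedin_subset by fastforce
      ultimately have "topspace M - Y' \<in> \<A>"
        using that Y by (auto simp: \<A>_def openin_diff)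
      moreover have "Z \<subseteq> topspace M - Y'"
        using Z that openin_subset by (fastforce simp: \<A>_def Y_def)
      ultimately have "topspace M - Y' = Z"
        by (rule max)
      then show False
        using that closedin_subset [OF that(1)] by (auto simp: Y_def)
    qed
    \<comment> \<open>Were every point of \<open>Y - K\<close> interior to \<open>Y\<close>, then
      \<open>Y - K\<close> would be open with closed union with \<open>K\<close>, hence empty by
      \<open>hole\<close>.\<close>
    have "\<exists>y\<in>Y - K. \<forall>G. openin M G \<and> y \<in> G \<longrightarrow> \<not> G \<subseteq> Y"
    proof (rule ccontr)
      assume "\<not> ?thesis"
      then have nb: "\<exists>G. openin M G \<and> y \<in> G \<and> G \<subseteq> Y" if "y \<in> Y - K" for y
        using that by blast
      have "openin M (Y - K)"
      proof (subst openin_subopen, intro ballI)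
        fix y assume y: "y \<in> Y - K"
        from nb [OF this] obtain G where G: "openin M G" "y \<in> G" "G \<subseteq> Y" by blast
        then show "\<exists>T. openin M T \<and> y \<in> T \<and> T \<subseteq> Y - K"
          using y K by (intro exI [of _ "G - K"]) (auto intro: openin_diff)
      qed
      moreover have "closedin M ((Y - K) \<union> K)"
        using Y K by (simp add: closedin_Un)
      ultimately have "Y - K \<subseteq> K"
        using Y by (intro hole) auto
      then have "Y \<subseteq> K" by auto
      with E0 Y show False by blast
    qed
    then obtain y where y: "y \<in> Y - K" and fr: "\<And>G. \<lbrakk>openin M G; y \<in> G\<rbrakk> \<Longrightarrow> \<not> G \<subseteq> Y"
      by blast
    have yM: "y \<in> topspace M"
      using y Y closedin_subset by fastforce
    obtain Q U \<psi> where QK: "Q \<subseteq> topspace M - K" and chart: "cube_chart n M B y Q U \<psi>"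
      using charts [of "topspace M - K" y] K y yM by (auto simp: openin_diff)
    have U: "openin M U" "y \<in> U" "U \<subseteq> Q" and Q: "closedin M Q"
      and \<psi>: "homeomorphic_map (subtopology M Q) (top_of_set (cube n)) \<psi>"
      and bQ: "\<psi> ` (Q - U) \<subseteq> cube_boundary n" "\<psi> ` (Q \<inter> B) \<subseteq> cube_boundary n"
      using chart by (auto simp: cube_chart_def)
    have cYU: "closedin M (Y - U)"
      using Y U by (simp add: closedin_diff)
    have "E (Y - U)"
      by (rule min [OF cYU]) (use y U in blast)
    then obtain \<Psi> where \<Psi>: "continuous_map (subtopology ?P (?D' (Y - U))) (nsphere n) \<Psi>"
      and \<Psi>\<Phi>: "\<And>z. z \<in> ?D \<Longrightarrow> \<Psi> z = \<Phi> z"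
      unfolding E_def by blast
    have opUY: "openin M (U - Y)"
      using U Y by (simp add: openin_diff)
    have "openin (top_of_set (cube n)) (\<psi> ` (U - Y))"
    proof -
      have "openin (subtopology M Q) (U - Y)"
        using opUY U by (auto intro: openin_subset_topspace_eq [THEN iffD1] simp: openin_subtopology)
      then show ?thesis
        using \<psi> homeomorphic_map_openness_eq by blast
    qed
    \<comment> \<open>\<open>Y\<close> contains no neighbourhood of \<open>y\<close>, so the chart
      has room outside \<open>Y\<close>; the puncture is taken there, off the faces.\<close>
    moreover have "U - Y \<noteq> {}"
      using fr [OF U(1,2)] by blast
    ultimately obtain v where "v \<in> \<psi> ` (U - Y)" "v \<notin> cube_boundary n"
      using open_cube_interior [of n "\<psi> ` (U - Y)"] by blast
    then obtain w where w: "w \<in> U - Y" "\<psi> w \<notin> cube_boundary n"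
      by blast
    \<comment> \<open>\<open>?L\<close> is the part of the cell over which values are already fixed:
      what is left of \<open>Y\<close> outside \<open>U\<close>, and \<open>A\<close>. The set
      \<open>K\<close> does not occur because \<open>Q\<close> avoids it.\<close>
    let ?C = "Y \<inter> Q" and ?L = "Y \<inter> Q \<inter> ((Y - U) \<union> A)"
    have sub: "{0,1} \<times> ?C \<union> {0..1} \<times> ?L \<subseteq> ?D' (Y - U)"
      using Y(2) by auto
    have \<Psi>': "continuous_map (subtopology ?P ({0,1} \<times> ?C \<union> {0..1} \<times> ?L)) (nsphere n) \<Psi>"
      by (rule continuous_map_from_subtopology_mono [OF \<Psi> sub])
    have cC: "closedin M ?C" "closedin M ?L"
      using Y Q cYU A by (auto intro!: closedin_Int closedin_Un)
    have "\<psi> ` ?L \<subseteq> cube_boundary n"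
      using bQ A(2) by blast
    with w U obtain \<Theta> where \<Theta>: "continuous_map (subtopology ?P ({0..1} \<times> ?C)) (nsphere n) \<Theta>"
      and \<Theta>\<Psi>: "\<And>z. z \<in> {0,1} \<times> ?C \<union> {0..1} \<times> ?L \<Longrightarrow> \<Theta> z = \<Psi> z"
      using prism_chart_extension [OF M(1) Q \<psi> cC(1) _ cC(2) _ _ _ _ _ \<Psi>', of w] by blast
    have agree: "\<Theta> z = \<Psi> z" if "z \<in> {0..1} \<times> ?C" "z \<in> ?D' (Y - U)" for z
    proof -
      have "z \<in> {0,1} \<times> ?C \<union> {0..1} \<times> ?L"
        using that QK by blast
      then show ?thesis by (rule \<Theta>\<Psi>)
    qed
    let ?\<Xi> = "\<lambda>z. if z \<in> {0..1} \<times> ?C then \<Theta> z else \<Psi> z"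
    have c\<Xi>: "continuous_map (subtopology ?P ({0..1} \<times> ?C \<union> ?D' (Y - U))) (nsphere n) ?\<Xi>"
      by (rule continuous_map_union_closed [OF closedP(1) [OF cC(1)] closedD' [OF cYU] \<Theta> \<Psi> agree])
    have "{0..1} \<times> ?C \<union> ?D' (Y - U) = ?D' Y"
      using U by blast
    with c\<Xi> have "continuous_map (subtopology ?P (?D' Y)) (nsphere n) ?\<Xi>"
      by (simp only:)
    moreover have "?\<Xi> z = \<Phi> z" if "z \<in> ?D" for z
      using agree [of z] \<Psi>\<Phi> [OF that] that by auto
    ultimately have "E Y"
      unfolding E_def by (intro exI [of _ ?\<Xi>] conjI ballI)
    with Y show False by blast
  qed
  then obtain \<Psi> where \<Psi>: "continuous_map (subtopology ?P (?D' X)) (nsphere n) \<Psi>" "\<And>z. z \<in> ?D \<Longrightarrow> \<Psi> z = \<Phi> z"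
    unfolding E_def by blast
  have "?D' X = {0..1} \<times> X"
    using X by auto
  with \<Psi>(1) have "continuous_map (subtopology ?P ({0..1} \<times> X)) (nsphere n) \<Psi>"
    by (simp only:)
  from that [OF this \<Psi>(2)] show thesis .
qed

section \<open>Charts at interior and boundary points\<close>

lemma Euclidean_space_eq: "Euclidean_space n = top_of_set {x. \<forall>i\<ge>n. x i = 0}"
  by (simp add: Euclidean_space_def euclidean_product_topology)

lemma continuous_map_Euclidean_space_coordinate:
  "continuous_map (Euclidean_space n) euclideanreal (\<lambda>x. x i)"
  by (simp add: Euclidean_space_eq continuous_on_coordinate)

lemma continuous_map_into_Euclidean_space_iff:
  "continuous_map X (Euclidean_space n) f \<longleftrightarrow>
   (\<forall>i<n. continuous_map X euclideanreal (\<lambda>x. f x i)) \<and> f \<in> topspace X \<rightarrow> topspace (Euclidean_space n)"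
proof -
  have "continuous_map X euclideanreal (\<lambda>x. f x i)"
    if "f \<in> topspace X \<rightarrow> topspace (Euclidean_space n)" "\<not> i < n" for i
    by (rule continuous_map_eq [of _ _ "\<lambda>x. 0"])
       (use that in \<open>force simp: topspace_Euclidean_space Pi_iff\<close>)+
  then show ?thesis
    by (auto simp: Euclidean_space_eq continuous_map_in_subtopology continuous_map_euclidean_fun_iff)
qed

lemma openin_Euclidean_box:
  "openin (Euclidean_space n) {u \<in> topspace (Euclidean_space n). \<forall>i<n. \<bar>u i - c i\<bar> < d}"
proof -
  have "open (\<Inter>i<n. {u::nat\<Rightarrow>real. \<bar>u i - c i\<bar> < d})"
    by (intro open_INT) (auto intro!: open_Collect_less continuous_intros continuous_on_coordinate)
  moreover have "{u \<in> topspace (Euclidean_space n). \<forall>i<n. \<bar>u i - c i\<bar> < d}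
      = topspace (Euclidean_space n) \<inter> (\<Inter>i<n. {u. \<bar>u i - c i\<bar> < d})"
    by auto
  ultimately show ?thesis
    by (auto simp: Euclidean_space_eq openin_open)
qed

lemma Euclidean_box_neighbourhood:
  assumes "openin (Euclidean_space n) V" "c \<in> V"
  obtains d where "d > 0"
    "\<And>u. \<lbrakk>u \<in> topspace (Euclidean_space n); \<And>i. i < n \<Longrightarrow> \<bar>u i - c i\<bar> \<le> d\<rbrakk> \<Longrightarrow> u \<in> V"
proof -
  obtain T where T: "openin (powertop_real UNIV) T" "V = T \<inter> {x. \<forall>i\<ge>n. x i = 0}"
    using assms(1) by (auto simp: Euclidean_space_def openin_subtopology)
  have "\<forall>x\<in>T. \<exists>U. finite {i. U i \<noteq> (UNIV :: real set)} \<and> (\<forall>i. open (U i)) \<and> x \<in> Pi\<^sub>E UNIV U \<and> Pi\<^sub>E UNIV U \<subseteq> T"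
    using T(1) by (auto simp: openin_product_topology_alt)
  moreover have "c \<in> T"
    using T(2) assms(2) by blast
  ultimately obtain U where U: "\<And>i. open (U i)" "c \<in> Pi\<^sub>E UNIV U" "Pi\<^sub>E UNIV U \<subseteq> T"
    by blast
  have c0: "c i = 0" if "i \<ge> n" for i
    using assms(2) T that by auto
  have "\<exists>e>0. \<forall>y. \<bar>y - c i\<bar> \<le> e \<longrightarrow> y \<in> U i" for i
  proof -
    have "c i \<in> U i"
      using U(2) by auto
    then obtain e where "e > 0" "cball (c i) e \<subseteq> U i"
      using U(1) open_contains_cball by blast
    then show ?thesis
      by (intro exI [of _ e]) (auto simp: dist_real_def subset_iff abs_minus_commute)
  qed
  then obtain e where e: "\<And>i. e i > 0" "\<And>i y. \<bar>y - c i\<bar> \<le> e i \<Longrightarrow> y \<in> U i"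
    by metis
  define d where "d = Min (insert 1 (e ` {..<n}))"
  have d: "d > 0" "\<And>i. i < n \<Longrightarrow> d \<le> e i"
    using e(1) by (auto simp: d_def)
  show thesis
  proof (rule that [OF d(1)])
    fix u assume u: "u \<in> topspace (Euclidean_space n)" "\<And>i. i < n \<Longrightarrow> \<bar>u i - c i\<bar> \<le> d"
    have "u i \<in> U i" for i
    proof (cases "i < n")
      case True
      then show ?thesis
        using e(2) u(2) d(2) by (meson order_trans)
    next
      case False
      then have "u i = c i"
        using u(1) c0 by (simp add: topspace_Euclidean_space)
      then show ?thesis
        using U(2) by auto
    qed
    then show "u \<in> V"
      using U(3) u(1) T(2) by (auto simp: topspace_Euclidean_space PiE_iff)
  qed
qed

text \<open>Invariance of domain: near \<open>x\<close> the change from the Euclidean to the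
  half-space chart is an injective continuous map into Euclidean space, so its image is open. But
  every neighbourhood of a point with last coordinate 0 contains points with negative last
  coordinate.\<close>

lemma not_euclidean_and_boundary_point:
  assumes "euclidean_point n M x" "boundary_point n M x"
  shows False
proof -
  obtain U where U: "openin M U" "x \<in> U" and hU: "subtopology M U homeomorphic_space Euclidean_space n"
    using assms(1) by (auto simp: euclidean_point_def)
  obtain V h where V: "openin M V" "x \<in> V" and h: "homeomorphic_map (subtopology M V) (half_space n) h"
    and hx: "h x (n - 1) = 0" and "0 < n"
    using assms(2) by (auto simp: boundary_point_def)
  obtain g g' where gg': "homeomorphic_maps (subtopology M U) (Euclidean_space n) g g'"
    using hU by (auto simp: homeomorphic_space_def)
  have UM: "U \<subseteq> topspace M" "V \<subseteq> topspace M"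
    using U V openin_subset by auto
  have g: "homeomorphic_map (subtopology M U) (Euclidean_space n) g"
    using gg' homeomorphic_maps_map by blast
  have cg': "continuous_map (Euclidean_space n) (subtopology M U) g'"
    and g'g: "\<And>y. y \<in> U \<Longrightarrow> g' (g y) = y"
    using gg' UM by (auto simp: homeomorphic_maps_def)
  let ?N = "U \<inter> V"
  have ch: "continuous_map (subtopology M V) (half_space n) h"
    by (rule homeomorphic_imp_continuous_map [OF h])
  have inj: "inj_on h V"
    using homeomorphic_imp_injective_map [OF h] UM by (simp add: Int_absorb1)
  have "openin (subtopology M U) ?N"
    using U V by (auto simp: openin_open_subtopology)
  then have gN: "openin (Euclidean_space n) (g ` ?N)"
    using g homeomorphic_map_openness_eq by blast
  have "continuous_map (subtopology (Euclidean_space n) (g ` ?N)) (subtopology M V) g'"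
    using cg' g'g by (auto simp: continuous_map_in_subtopology Pi_iff intro: continuous_map_from_subtopology)
  from continuous_map_compose [OF this ch]
  have hg: "continuous_map (subtopology (Euclidean_space n) (g ` ?N)) (Euclidean_space n) (h \<circ> g')"
    unfolding half_space_def by (rule continuous_map_into_fulltopology)
  moreover have "inj_on (h \<circ> g') (g ` ?N)"
    using inj g'g by (auto simp: inj_on_def)
  ultimately have "openin (Euclidean_space n) ((h \<circ> g') ` g ` ?N)"
    by (intro invariance_of_domain_Euclidean_space gN)
  moreover have "(h \<circ> g') ` g ` ?N = h ` ?N"
    using g'g by force
  ultimately have op: "openin (Euclidean_space n) (h ` ?N)" by simp
  have "h x \<in> h ` ?N"
    using U V by blast
  then obtain d where d: "d > 0"
    "\<And>u. \<lbrakk>u \<in> topspace (Euclidean_space n); \<And>i. i < n \<Longrightarrow> \<bar>u i - h x i\<bar> \<le> d\<rbrakk> \<Longrightarrow> u \<in> h ` ?N"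
    using Euclidean_box_neighbourhood [OF op] by blast
  let ?u = "(h x)(n - 1 := - d)"
  have "h x \<in> topspace (Euclidean_space n)"
    using op \<open>h x \<in> h ` ?N\<close> openin_subset by blast
  then have "?u \<in> topspace (Euclidean_space n)"
    using \<open>0 < n\<close> by (auto simp: topspace_Euclidean_space)
  then have "?u \<in> h ` ?N"
    using d hx by (auto intro: d(2))
  moreover have "h ` ?N \<subseteq> topspace (half_space n)"
    using ch UM by (auto simp: continuous_map_def Pi_iff)
  ultimately have "?u \<in> topspace (half_space n)"
    by blast
  then have "?u (n - 1) \<ge> 0"
    unfolding half_space_def topspace_subtopology by blast
  with d(1) show False by simp
qed

text \<open>The logarithm of the last coordinate makes the open half-space homeomorphic to the whole
  space. With \<open>not_euclidean_and_boundary_point\<close> this forces boundary points onto the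
  wall of every half-space chart.\<close>

lemma euclidean_point_half_space_interior:
  assumes U: "openin M U" "x \<in> U" and h: "homeomorphic_map (subtopology M U) (half_space n) h"
    and pos: "h x (n - 1) > 0" and "0 < n"
  shows "euclidean_point n M x"
proof -
  let ?T = "{y::nat\<Rightarrow>real. y (n - 1) > 0}"
  have UM: "U \<subseteq> topspace M"
    using U openin_subset by auto
  have ch: "continuous_map (subtopology M U) (half_space n) h"
    using h homeomorphic_imp_continuous_map by blast
  define U' where "U' = {u \<in> U. h u (n - 1) > 0}"
  have "continuous_map (half_space n) euclideanreal (\<lambda>y. y (n - 1))"
    unfolding half_space_def
    by (intro continuous_map_from_subtopology continuous_map_Euclidean_space_coordinate)
  from continuous_map_compose [OF ch this]
  have "continuous_map (subtopology M U) euclideanreal (\<lambda>u. h u (n - 1))"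
    by (simp add: o_def)
  from openin_continuous_map_preimage [OF this, of "{0<..}"]
  have "openin (subtopology M U) U'"
    using UM by (auto simp: U'_def inf_absorb2 Int_absorb1 conj_commute cong: conj_cong)
  then have opU': "openin M U'"
    using U by (simp add: openin_open_subtopology)
  have "h ` (topspace (subtopology M U) \<inter> U') = topspace (half_space n) \<inter> ?T"
    using homeomorphic_imp_surjective_map [OF h] UM by (auto simp: U'_def inf_absorb2 image_iff)
  from homeomorphic_map_subtopologies [OF h this]
  have "subtopology (subtopology M U) U' homeomorphic_space subtopology (half_space n) ?T"
    using homeomorphic_map_imp_homeomorphic_space by blast
  moreover have "subtopology (subtopology M U) U' = subtopology M U'"
    by (simp add: subtopology_subtopology U'_def Int_absorb1 Collect_mono_iff inf_absorb2 subset_iff)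
  moreover have "subtopology (half_space n) ?T = subtopology (Euclidean_space n) ?T"
  proof -
    have "{y::nat\<Rightarrow>real. y (n - 1) \<ge> 0} \<inter> ?T = ?T" by auto
    then show ?thesis
      by (simp add: half_space_def subtopology_subtopology)
  qed
  moreover have "subtopology (Euclidean_space n) ?T homeomorphic_space Euclidean_space n"
  proof -
    let ?l = "\<lambda>y::nat\<Rightarrow>real. y(n - 1 := ln (y (n - 1)))" and ?e = "\<lambda>y::nat\<Rightarrow>real. y(n - 1 := exp (y (n - 1)))"
    have coord: "continuous_map (subtopology (Euclidean_space n) ?T) euclideanreal (\<lambda>y. y i)" for i
      by (intro continuous_map_from_subtopology continuous_map_Euclidean_space_coordinate)
    have "continuous_map (subtopology (Euclidean_space n) ?T) euclideanreal (\<lambda>y. ln (y (n - 1)))"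
    proof -
      have "continuous_on ({x. \<forall>i\<ge>n. x i = 0} \<inter> ?T) (\<lambda>y. ln (y (n - 1)))"
        by (intro continuous_intros continuous_on_coordinate) auto
      then show ?thesis
        by (simp add: Euclidean_space_eq subtopology_subtopology)
    qed
    then have "continuous_map (subtopology (Euclidean_space n) ?T) euclideanreal (\<lambda>y. ?l y i)" for i
      using coord by (cases "i = n - 1") auto
    moreover have "continuous_map (Euclidean_space n) euclideanreal (\<lambda>y. exp (y (n - 1)))"
      using continuous_on_coordinate by (auto simp: Euclidean_space_eq intro!: continuous_intros)
    then have "continuous_map (Euclidean_space n) euclideanreal (\<lambda>y. ?e y i)" for i
      using continuous_map_Euclidean_space_coordinate by (cases "i = n - 1") auto
    ultimately have "homeomorphic_maps (subtopology (Euclidean_space n) ?T) (Euclidean_space n) ?l ?e"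
      using \<open>0 < n\<close>
      by (auto simp: homeomorphic_maps_def continuous_map_in_subtopology continuous_map_into_Euclidean_space_iff
          topspace_Euclidean_space)
    then show ?thesis
      using homeomorphic_space_def by blast
  qed
  ultimately have "subtopology M U' homeomorphic_space Euclidean_space n"
    by (metis homeomorphic_space_trans)
  then show ?thesis
    using opU' U(2) pos by (auto simp: euclidean_point_def U'_def)
qed

lemma box_homeomorphic_cube:
  fixes a l :: "nat \<Rightarrow> real"
  assumes "\<And>i. i < n \<Longrightarrow> l i > 0"
  shows "homeomorphic_map (subtopology (Euclidean_space n) {u. \<forall>i<n. a i \<le> u i \<and> u i \<le> a i + l i})
    (top_of_set (cube n)) (\<lambda>u i. if i < n then (u i - a i) / l i else 0)"
    (is "homeomorphic_map ?X _ ?f")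
proof -
  let ?g = "\<lambda>v i. if i < n then a i + l i * v i else 0"
  have coord: "continuous_map ?X euclideanreal (\<lambda>y. y i)" for i
    by (intro continuous_map_from_subtopology continuous_map_Euclidean_space_coordinate)
  have f: "continuous_map ?X euclideanreal (\<lambda>x. ?f x i)" for i
    using coord by (cases "i < n") (auto intro!: continuous_intros dest: assms)
  have f': "?f \<in> topspace ?X \<rightarrow> cube n"
    using assms by (fastforce simp: cube_def field_simps)
  have g: "continuous_map (top_of_set (cube n)) euclideanreal (\<lambda>x. ?g x i)" for i
    using continuous_on_coordinate by (cases "i < n") (auto intro!: continuous_intros)
  have g': "?g \<in> cube n \<rightarrow> topspace ?X"
  proof
    fix v assume v: "v \<in> cube n"
    have "0 \<le> l i * v i" "l i * v i \<le> l i * 1" if "i < n" for i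
      using v assms [OF that] that mult_left_mono [of "v i" 1 "l i"] by (auto simp: cube_def)
    then show "?g v \<in> topspace ?X"
      by (auto simp: topspace_Euclidean_space)
  qed
  have gf: "?g (?f u) = u" if "u \<in> topspace ?X" for u
  proof
    fix i show "?g (?f u) i = u i"
      using that assms [of i] by (auto simp: topspace_Euclidean_space)
  qed
  have fg: "?f (?g v) = v" if "v \<in> cube n" for v
  proof
    fix i show "?f (?g v) i = v i"
      using that assms [of i] by (auto simp: cube_def)
  qed
  have "continuous_map ?X (top_of_set (cube n)) ?f"
    unfolding continuous_map_in_subtopology continuous_map_euclidean_fun_iff using f f' by blast
  moreover have "continuous_map (top_of_set (cube n)) ?X ?g"
    unfolding continuous_map_in_subtopology continuous_map_into_Euclidean_space_iff
    by (intro conjI allI impI g) (use g' in auto)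
  ultimately have "homeomorphic_maps ?X (top_of_set (cube n)) ?f ?g"
    unfolding homeomorphic_maps_def using gf fg by simp
  then show ?thesis
    using homeomorphic_maps_map by blast
qed

text \<open>Common part of interior and boundary charts: \<open>H\<close> is the whole space or a
  half-space, and the box with corner \<open>a\<close> and edges \<open>l\<close> is rescaled to the
  unit cube. The cell \<open>Q\<close> is closed in \<open>M\<close> because the cube is compact and
  \<open>M\<close> is Hausdorff.\<close>

lemma cube_chart_of_box:
  fixes a l :: "nat \<Rightarrow> real"
  assumes M: "Hausdorff_space M" and W: "openin M W"
    and h: "homeomorphic_map (subtopology M W) (subtopology (Euclidean_space n) H) h"
    and l: "\<And>i. i < n \<Longrightarrow> l i > 0"
    and box: "\<And>u. \<lbrakk>u \<in> topspace (Euclidean_space n); \<And>i. i < n \<Longrightarrow> a i \<le> u i \<and> u i \<le> a i + l i\<rbrakk> \<Longrightarrow> u \<in> h ` (W \<inter> G)"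
    and V: "openin (subtopology (Euclidean_space n) H) V" "y \<in> W" "h y \<in> V"
      "\<And>u i. \<lbrakk>u \<in> V; i < n\<rbrakk> \<Longrightarrow> a i \<le> u i \<and> u i \<le> a i + l i"
      "\<And>u. \<lbrakk>u \<in> h ` W; \<And>i. i < n \<Longrightarrow> a i \<le> u i \<and> u i \<le> a i + l i; u \<notin> V\<rbrakk> \<Longrightarrow> \<exists>i<n. u i = a i \<or> u i = a i + l i"
    and B: "\<And>x. \<lbrakk>x \<in> W; x \<in> B\<rbrakk> \<Longrightarrow> \<exists>i<n. h x i = a i \<or> h x i = a i + l i"
  shows "\<exists>Q U \<psi>. Q \<subseteq> G \<and> cube_chart n M B y Q U \<psi>"
proof -
  let ?b = "{u. \<forall>i<n. a i \<le> u i \<and> u i \<le> a i + l i}"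
  let ?f = "\<lambda>u i. if i < n then (u i - a i) / l i else 0"
  define Q where "Q = {x \<in> W. h x \<in> ?b}"
  define U where "U = {x \<in> W. h x \<in> V}"
  have WM: "W \<subseteq> topspace M"
    using W openin_subset by auto
  have hW: "h ` W = topspace (Euclidean_space n) \<inter> H" and inj: "inj_on h W"
    using homeomorphic_imp_surjective_map [OF h] homeomorphic_imp_injective_map [OF h] WM
    by (auto simp: inf_absorb2)
  have QG: "Q \<subseteq> G"
  proof
    fix x assume "x \<in> Q"
    then have x: "x \<in> W" "h x \<in> topspace (Euclidean_space n)" "\<And>i. i < n \<Longrightarrow> a i \<le> h x i \<and> h x i \<le> a i + l i"
      using hW by (auto simp: Q_def)
    then obtain x' where "x' \<in> W" "x' \<in> G" "h x = h x'"
      using box by blast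
    with inj x(1) show "x \<in> G"
      by (auto simp: inj_on_def)
  qed
  have hQ: "h ` (topspace (subtopology M W) \<inter> Q) = topspace (subtopology (Euclidean_space n) H) \<inter> ?b"
  proof -
    have "h ` (topspace (subtopology M W) \<inter> Q) = h ` W \<inter> ?b"
      using WM by (auto simp: Q_def)
    then show ?thesis
      unfolding hW by simp
  qed
  have "topspace (Euclidean_space n) \<inter> ?b \<subseteq> H"
    using box hW by auto
  then have "subtopology (subtopology (Euclidean_space n) H) ?b = subtopology (Euclidean_space n) ?b"
    unfolding subtopology_subtopology by (metis (no_types, lifting) Int_commute inf.absorb_iff1 inf_assoc inf_left_commute subtopology_restrict)
  moreover have "subtopology (subtopology M W) Q = subtopology M Q"
    by (simp add: subtopology_subtopology Q_def Int_absorb1 inf_absorb2 subset_iff)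
  ultimately have "homeomorphic_map (subtopology M Q) (subtopology (Euclidean_space n) ?b) h"
    using homeomorphic_map_subtopologies [OF h hQ] by simp
  then have \<psi>: "homeomorphic_map (subtopology M Q) (top_of_set (cube n)) (?f \<circ> h)"
    using box_homeomorphic_cube [OF l] by (rule homeomorphic_map_compose)
  have "compact_space (subtopology M Q)"
    using homeomorphic_compact_space [OF homeomorphic_map_imp_homeomorphic_space [OF \<psi>]] compact_cube
    by (simp add: compact_space_subtopology)
  then have "compactin M Q"
    using WM by (auto simp: compactin_subspace Q_def)
  then have cQ: "closedin M Q"
    using M compactin_imp_closedin by blast
  have "openin (subtopology M W) U"
  proof -
    have "continuous_map (subtopology M W) (subtopology (Euclidean_space n) H) h"
      using h homeomorphic_imp_continuous_map by blast
    from openin_continuous_map_preimage [OF this V(1)] show ?thesis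
      using WM by (simp add: U_def inf_absorb2)
  qed
  then have opU: "openin M U"
    using W by (simp add: openin_open_subtopology)
  have UQ: "U \<subseteq> Q"
    using V(4) by (auto simp: U_def Q_def)
  have \<psi>c: "(?f \<circ> h) x \<in> cube n" if "x \<in> Q" for x
  proof -
    have "x \<in> topspace (subtopology M Q)"
      using that WM by (auto simp: Q_def)
    then show ?thesis
      using homeomorphic_imp_surjective_map [OF \<psi>] by auto
  qed
  have bd: "(?f \<circ> h) x \<in> cube_boundary n" if "x \<in> Q" "i < n" "h x i = a i \<or> h x i = a i + l i" for x i
    using \<psi>c [OF that(1)] that(2,3) l [OF that(2)] by (auto simp: cube_boundary_def intro!: exI [of _ i])
  have "(?f \<circ> h) x \<in> cube_boundary n" if x: "x \<in> Q - U" for x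
  proof -
    have "\<exists>i<n. h x i = a i \<or> h x i = a i + l i"
      by (rule V(5)) (use x in \<open>auto simp: Q_def U_def\<close>)
    then show ?thesis using bd x by blast
  qed
  moreover have "(?f \<circ> h) x \<in> cube_boundary n" if x: "x \<in> Q \<inter> B" for x
  proof -
    have "\<exists>i<n. h x i = a i \<or> h x i = a i + l i"
      by (rule B) (use x in \<open>auto simp: Q_def\<close>)
    then show ?thesis using bd x by blast
  qed
  moreover have "y \<in> U"
    using V by (simp add: U_def)
  ultimately have "cube_chart n M B y Q U (?f \<circ> h)"
    unfolding cube_chart_def using opU UQ cQ \<psi> by blast
  with QG show ?thesis by blast
qed

text \<open>The manifold boundary goes to faces for a different reason in each case: an interior
  chart contains no boundary points, and in a half-space chart they all lie on the wall, which is
  made a face of the box.\<close>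

lemma cube_chart_exists:
  assumes M: "manifold_with_boundary n M" and G: "openin M G" "y \<in> G"
  shows "\<exists>Q U \<psi>. Q \<subseteq> G \<and> cube_chart n M (manifold_boundary n M) y Q U \<psi>"
proof -
  have H: "Hausdorff_space M"
    using M by (simp add: manifold_with_boundary_def)
  have "y \<in> topspace M"
    using G openin_subset by blast
  then consider "euclidean_point n M y" | "boundary_point n M y"
    using M by (auto simp: manifold_with_boundary_def)
  then show ?thesis
  proof cases
    case 1
    then obtain W where W: "openin M W" "y \<in> W" "subtopology M W homeomorphic_space Euclidean_space n"
      by (auto simp: euclidean_point_def)
    then obtain h where h: "homeomorphic_map (subtopology M W) (Euclidean_space n) h"
      using homeomorphic_space by blast
    have "openin (subtopology M W) (W \<inter> G)"
      using W G by (auto simp: openin_open_subtopology)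
    then have op: "openin (Euclidean_space n) (h ` (W \<inter> G))"
      using h homeomorphic_map_openness_eq by blast
    then obtain d where d: "d > 0"
      "\<And>u. \<lbrakk>u \<in> topspace (Euclidean_space n); \<And>i. i < n \<Longrightarrow> \<bar>u i - h y i\<bar> \<le> d\<rbrakk> \<Longrightarrow> u \<in> h ` (W \<inter> G)"
      using Euclidean_box_neighbourhood [of n "h ` (W \<inter> G)" "h y"] W G by blast
    have hW: "h ` W = topspace (Euclidean_space n)"
      using homeomorphic_imp_surjective_map [OF h] openin_subset [OF W(1)] by (auto simp: inf_absorb2)
    show ?thesis
    proof (rule cube_chart_of_box [OF H W(1), where H = UNIV and h = h and a = "\<lambda>i. h y i - d" and l = "\<lambda>i. 2 * d"
          and V = "{u \<in> topspace (Euclidean_space n). \<forall>i<n. \<bar>u i - h y i\<bar> < d}"])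
      show "u \<in> h ` (W \<inter> G)"
        if "u \<in> topspace (Euclidean_space n)" "\<And>i. i < n \<Longrightarrow> h y i - d \<le> u i \<and> u i \<le> h y i - d + 2 * d" for u
        using that by (intro d(2)) (force simp: abs_le_iff)+
      show "\<exists>i<n. u i = h y i - d \<or> u i = h y i - d + 2 * d"
        if u: "u \<in> h ` W" "\<And>i. i < n \<Longrightarrow> h y i - d \<le> u i \<and> u i \<le> h y i - d + 2 * d"
          "u \<notin> {u \<in> topspace (Euclidean_space n). \<forall>i<n. \<bar>u i - h y i\<bar> < d}" for u
      proof -
        obtain i where i: "i < n" "\<not> \<bar>u i - h y i\<bar> < d"
          using u hW by auto
        with u(2) [OF i(1)] show ?thesis
          by (intro exI [of _ i]) auto
      qed
      show "\<exists>i<n. h x i = h y i - d \<or> h x i = h y i - d + 2 * d" if "x \<in> W" "x \<in> manifold_boundary n M" for x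
      proof -
        have "euclidean_point n M x"
          using W that(1) by (auto simp: euclidean_point_def)
        then show ?thesis
          using that(2) not_euclidean_and_boundary_point [of n M x] by (auto simp: manifold_boundary_def)
      qed
      show "openin (subtopology (Euclidean_space n) UNIV) {u \<in> topspace (Euclidean_space n). \<forall>i<n. \<bar>u i - h y i\<bar> < d}"
        by (simp add: openin_Euclidean_box)
      show "h y \<in> {u \<in> topspace (Euclidean_space n). \<forall>i<n. \<bar>u i - h y i\<bar> < d}"
        using hW W d(1) by auto
    qed (use d(1) W h in \<open>auto simp: openin_Euclidean_box abs_less_iff\<close>)
  next
    case 2
    then obtain W h where W: "openin M W" "y \<in> W" and h: "homeomorphic_map (subtopology M W) (half_space n) h"
      and hy: "h y (n - 1) = 0" and n: "0 < n"
      by (auto simp: boundary_point_def)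
    let ?H = "{u::nat\<Rightarrow>real. u (n - 1) \<ge> 0}"
    have "openin (subtopology M W) (W \<inter> G)"
      using W G by (auto simp: openin_open_subtopology)
    then have "openin (half_space n) (h ` (W \<inter> G))"
      using h homeomorphic_map_openness_eq by blast
    then obtain T where T: "openin (Euclidean_space n) T" "h ` (W \<inter> G) = T \<inter> ?H"
      by (auto simp: half_space_def openin_subtopology)
    then obtain d where d: "d > 0"
      "\<And>u. \<lbrakk>u \<in> topspace (Euclidean_space n); \<And>i. i < n \<Longrightarrow> \<bar>u i - h y i\<bar> \<le> d\<rbrakk> \<Longrightarrow> u \<in> T"
      using Euclidean_box_neighbourhood [of n T "h y"] W G by blast
    have hW: "h ` W = topspace (Euclidean_space n) \<inter> ?H"
      using homeomorphic_imp_surjective_map [OF h] openin_subset [OF W(1)] by (auto simp: inf_absorb2 half_space_def)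
    \<comment> \<open>The box stands on the wall: its last edge runs from 0 to \<open>d\<close>
      instead of from \<open>-d\<close> to \<open>d\<close>. The set \<open>?V\<close> includes
      points of the wall, yet is open relative to the half-space, so \<open>y\<close> may lie on a
      face.\<close>
    define a where "a = (\<lambda>i. if i = n - 1 then 0 else h y i - d)"
    define l where "l = (\<lambda>i. if i = n - 1 then d else 2 * d)"
    let ?V = "?H \<inter> {u \<in> topspace (Euclidean_space n). \<forall>i<n. \<bar>u i - h y i\<bar> < d}"
    show ?thesis
    proof (rule cube_chart_of_box [OF H W(1), where H = ?H and h = h and a = a and l = l and V = ?V])
      show "u \<in> h ` (W \<inter> G)"
        if u: "u \<in> topspace (Euclidean_space n)" "\<And>i. i < n \<Longrightarrow> a i \<le> u i \<and> u i \<le> a i + l i" for u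
      proof -
        have "\<bar>u i - h y i\<bar> \<le> d" if "i < n" for i
          using u(2) [OF that] hy d(1) by (auto simp: a_def l_def abs_le_iff split: if_splits)
        then have "u \<in> T"
          using d(2) u(1) by blast
        moreover have "0 \<le> u (n - 1)"
          using u(2) [of "n - 1"] n by (simp add: a_def)
        ultimately show ?thesis
          unfolding T(2) by auto
      qed
      show "\<exists>i<n. u i = a i \<or> u i = a i + l i"
        if u: "u \<in> h ` W" "\<And>i. i < n \<Longrightarrow> a i \<le> u i \<and> u i \<le> a i + l i" "u \<notin> ?V" for u
      proof -
        obtain i where i: "i < n" "\<not> \<bar>u i - h y i\<bar> < d"
          using u hW by auto
        with u(2) [OF i(1)] show ?thesis
          using hy d(1) by (intro exI [of _ i]) (auto simp: a_def l_def split: if_splits)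
      qed
      show "\<exists>i<n. h x i = a i \<or> h x i = a i + l i" if x: "x \<in> W" "x \<in> manifold_boundary n M" for x
      proof -
        have "h x (n - 1) \<ge> 0"
          using hW x(1) by blast
        moreover have "\<not> h x (n - 1) > 0"
          using euclidean_point_half_space_interior [OF W(1) x(1) h _ n] x(2) not_euclidean_and_boundary_point [of n M x]
          by (auto simp: manifold_boundary_def)
        ultimately show ?thesis
          using n by (intro exI [of _ "n - 1"]) (auto simp: a_def)
      qed
      show "openin (subtopology (Euclidean_space n) ?H) ?V"
        using openin_Euclidean_box by (auto simp: openin_subtopology)
      show "h y \<in> ?V"
        using hW W d(1) by auto
      show "a i \<le> u i \<and> u i \<le> a i + l i" if "u \<in> ?V" "i < n" for u i
      proof -
        have "\<bar>u i - h y i\<bar> < d" "u (n - 1) \<ge> 0"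
          using that by auto
        then show ?thesis
          using hy by (auto simp: a_def l_def)
      qed
    qed (use d(1) W h in \<open>auto simp: half_space_def l_def\<close>)
  qed
qed

section \<open>Maps on proper subspaces\<close>

lemma connected_space_cube: "connected_space (top_of_set (cube n))"
proof -
  have "cube n = (\<Pi>\<^sub>E i\<in>UNIV. if i < n then {0..1} else {0})"
    by (auto simp: cube_def PiE_iff split: if_splits)
  moreover have "connectedin (powertop_real UNIV) (\<Pi>\<^sub>E i\<in>UNIV. if i < n then {0..1} else {0})"
    by (auto simp: connectedin_PiE)
  ultimately show ?thesis
    by (metis connectedin_def euclidean_product_topology)
qed

lemma continuous_map_euclideanreal_ge:
  assumes "continuous_map X euclideanreal f"
  shows "closedin X {x \<in> topspace X. c \<le> f x}" "openin X {x \<in> topspace X. c < f x}"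
  using closedin_continuous_map_preimage [OF assms, of "{c..}"] openin_continuous_map_preimage [OF assms, of "{c<..}"]
  by auto

text \<open>\<open>fill Z C\<close> fills all holes of \<open>C\<close> that do not reach \<open>Z\<close>.\<close>

definition fill :: "'a topology \<Rightarrow> 'a set \<Rightarrow> 'a set \<Rightarrow> 'a set" where
  "fill M Z C = C \<union> \<Union>{T. openin M T \<and> T \<inter> Z = {} \<and> closedin M (T \<union> C)}"

lemma fill_mono:
  assumes "C \<subseteq> C'" "closedin M C'"
  shows "fill M Z C \<subseteq> fill M Z C'"
proof -
  have "closedin M (T \<union> C')" if "closedin M (T \<union> C)" for T
  proof -
    have "T \<union> C' = (T \<union> C) \<union> C'"
      using assms(1) by blast
    then show ?thesis
      using that assms(2) by (metis closedin_Un)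
  qed
  then show ?thesis
    unfolding fill_def using assms(1) by blast
qed

text \<open>Filling is idempotent: a hole of the filled set, together with all holes already filled,
  is a hole of \<open>C\<close> itself.\<close>

lemma fill_no_holes:
  assumes "openin M T" "T \<inter> Z = {}" "closedin M (T \<union> fill M Z C)"
  shows "T \<subseteq> fill M Z C"
proof -
  let ?T = "T \<union> \<Union>{T. openin M T \<and> T \<inter> Z = {} \<and> closedin M (T \<union> C)}"
  have "openin M ?T"
    using assms(1) by auto
  moreover have "?T \<inter> Z = {}"
    using assms(2) by blast
  moreover have "?T \<union> C = T \<union> fill M Z C"
    by (auto simp: fill_def)
  ultimately have "?T \<subseteq> fill M Z C"
    using assms(3) unfolding fill_def by (metis (mono_tags, lifting) Union_upper le_supI2 mem_Collect_eq)
  then show ?thesis by blast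
qed

text \<open>Local connectedness: a small cell that misses \<open>C\<close> meets a hole in a
  relatively clopen set, so it lies inside every hole that it meets. A point outside the filled set
  therefore has a neighbourhood outside it.\<close>

lemma closedin_fill:
  assumes charts: "\<And>y G. \<lbrakk>openin M G; y \<in> G\<rbrakk> \<Longrightarrow> \<exists>Q U \<psi>. Q \<subseteq> G \<and> cube_chart n M B y Q U \<psi>"
    and C: "closedin M C"
  shows "closedin M (fill M Z C)"
proof -
  have "openin M (topspace M - fill M Z C)"
  proof (subst openin_subopen, intro ballI)
    fix x assume x: "x \<in> topspace M - fill M Z C"
    have "openin M (topspace M - C)" "x \<in> topspace M - C"
      using C x by (auto simp: fill_def)
    from charts [OF this] obtain Q U \<psi> where Q: "Q \<subseteq> topspace M - C" and ch: "cube_chart n M B x Q U \<psi>"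
      by blast
    then have U: "openin M U" "x \<in> U" "U \<subseteq> Q"
      and hom: "homeomorphic_map (subtopology M Q) (top_of_set (cube n)) \<psi>"
      by (auto simp: cube_chart_def)
    have con: "connected_space (subtopology M Q)"
      using homeomorphic_connected_space [OF homeomorphic_map_imp_homeomorphic_space [OF hom]] connected_space_cube
      by blast
    have "v \<notin> fill M Z C" if "v \<in> U" for v
    proof
      assume "v \<in> fill M Z C"
      moreover have "v \<notin> C"
        using that U Q by blast
      ultimately obtain T where T: "openin M T" "T \<inter> Z = {}" "closedin M (T \<union> C)" "v \<in> T"
        unfolding fill_def by blast
      have "openin (subtopology M Q) (Q \<inter> T)"
        using T(1) openin_subtopology_Int2 by blast
      moreover have "closedin (subtopology M Q) (Q \<inter> (T \<union> C))"
        using T(3) closedin_subtopology_Int_closed by blast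
      moreover have "Q \<inter> (T \<union> C) = Q \<inter> T"
        using Q by blast
      ultimately have "Q \<inter> T = {} \<or> Q \<inter> T = topspace (subtopology M Q)"
        using con by (metis connected_space_clopen_in)
      then have "x \<in> T"
        using T(4) that U Q by auto
      then show False
        using T x by (auto simp: fill_def)
    qed
    then show "\<exists>T. openin M T \<and> x \<in> T \<and> T \<subseteq> topspace M - fill M Z C"
      using U openin_subset [OF U(1)] by blast
  qed
  moreover have "fill M Z C \<subseteq> topspace M"
    unfolding fill_def using closedin_subset [OF C] openin_subset by blast
  ultimately show ?thesis
    by (simp add: closedin_def)
qed

text \<open>The complement of the zeros is exhausted by closed sets, and
  \<open>prism_extension\<close> carries the null-homotopy from each to the next without changing
  earlier values, so the stages have a limit.\<close>

lemma nullhomotopic_off_zero_set: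
  fixes M :: "'a topology" and g :: "'a \<Rightarrow> nat \<Rightarrow> real"
  assumes M: "compact_space M" "Hausdorff_space M" "connected_space M"
    and charts: "\<And>y G. \<lbrakk>openin M G; y \<in> G\<rbrakk> \<Longrightarrow> \<exists>Q U \<psi>. Q \<subseteq> G \<and> cube_chart n M B y Q U \<psi>"
    and g: "\<And>i. i \<le> n \<Longrightarrow> continuous_map M euclideanreal (\<lambda>x. g x i)"
    and x0: "x0 \<in> topspace M" "(\<Sum>j\<le>n. (g x0 j)\<^sup>2) = 0"
    and A: "closedin M A" "A \<subseteq> B" and p: "p \<in> topspace (nsphere n)"
    and gA: "\<And>a. a \<in> A \<Longrightarrow> \<exists>c>0. \<forall>i\<le>n. g a i = c * p i"
  defines "U \<equiv> {x \<in> topspace M. (\<Sum>j\<le>n. (g x j)\<^sup>2) \<noteq> 0}"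
  obtains G where "continuous_map (prod_topology interval (subtopology M U)) (nsphere n) G"
    "\<And>x. x \<in> U \<Longrightarrow> G (0, x) = unit_vec n (g x)" "\<And>x. x \<in> U \<Longrightarrow> G (1, x) = p"
    "\<And>t a. \<lbrakk>t \<in> {0..1}; a \<in> A\<rbrakk> \<Longrightarrow> G (t, a) = p"
proof -
  let ?P = "prod_topology interval M"
  define s where "s = (\<lambda>x. \<Sum>j\<le>n. (g x j)\<^sup>2)"
  define f where "f = (\<lambda>x. unit_vec n (g x))"
  define Z where "Z = {x \<in> topspace M. s x = 0}"
  have s0: "s x \<ge> 0" for x
    by (simp add: s_def sum_nonneg)
  have cs: "continuous_map M euclideanreal s"
    unfolding s_def by (intro continuous_intros g) auto
  have U: "U = topspace M - Z"
    by (auto simp: U_def Z_def s_def)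
  have cf: "continuous_map (subtopology M U) (nsphere n) f"
    unfolding f_def U_def by (rule continuous_map_unit_vec) (auto intro: continuous_map_from_subtopology g)
  have fA: "f a = p" if "a \<in> A" for a
    using gA [OF that] unit_vec_scale [OF p] by (auto simp: f_def)
  have AU: "A \<subseteq> U"
  proof
    fix a assume a: "a \<in> A"
    obtain c where c: "c > 0" "\<And>i. i \<le> n \<Longrightarrow> g a i = c * p i"
      using gA [OF a] by blast
    have "(\<Sum>j\<le>n. (g a j)\<^sup>2) = c\<^sup>2 * (\<Sum>j\<le>n. (p j)\<^sup>2)"
      by (simp add: c(2) power_mult_distrib sum_distrib_left)
    then have "(\<Sum>j\<le>n. (g a j)\<^sup>2) \<noteq> 0"
      using p c(1) by (simp add: topspace_nsphere)
    then show "a \<in> U"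
      using a closedin_subset [OF A(1)] by (auto simp: U_def)
  qed
  \<comment> \<open>\<open>C i\<close> is where the squared norm is at least \<open>1 / i\<close>;
    the product form makes \<open>C 0\<close> empty.\<close>
  define C where "C = (\<lambda>i::nat. {x \<in> topspace M. 1 \<le> real i * s x})"
  define K where "K = (\<lambda>i. fill M Z (C i))"
  have cis: "continuous_map M euclideanreal (\<lambda>x. real i * s x)" for i
    by (intro continuous_intros cs)
  have cC: "closedin M (C i)" for i
    unfolding C_def by (rule continuous_map_euclideanreal_ge [OF cis])
  have cK: "closedin M (K i)" for i
    unfolding K_def by (rule closedin_fill [OF charts cC])
  have CZ: "C i \<inter> Z = {}" for i
    by (auto simp: C_def Z_def)
  have KU: "K i \<subseteq> U" for i
    using closedin_subset [OF cK, of i] CZ [of i] by (auto simp: K_def fill_def U)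
  have Kmono: "K i \<subseteq> K (Suc i)" for i
  proof -
    have "C i \<subseteq> C (Suc i)"
      using s0 by (auto simp: C_def algebra_simps intro: order_trans add_increasing)
    then show ?thesis
      unfolding K_def by (rule fill_mono [OF _ cC])
  qed
  \<comment> \<open>A hole of the empty set is clopen, hence empty or everything, and it misses the
    zero \<open>x0\<close>. So the recursion can start from the constant homotopy over
    \<open>A\<close>.\<close>
  have K0: "K 0 = {}"
  proof -
    have "T = {}" if "openin M T" "T \<inter> Z = {}" "closedin M T" for T
    proof -
      have "T = {} \<or> T = topspace M"
        using M(3) that connected_space_clopen_in by blast
      moreover have "x0 \<in> Z"
        using x0 by (simp add: Z_def s_def)
      ultimately show ?thesis
        using that x0 by blast
    qed
    moreover have "C 0 = {}"
      by (simp add: C_def)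
    ultimately show ?thesis
      by (auto simp: K_def fill_def)
  qed
  define R where "R = (\<lambda>i G. continuous_map (subtopology ?P ({0..1} \<times> (K i \<union> A))) (nsphere n) G \<and>
      (\<forall>x\<in>K i \<union> A. G (0, x) = f x \<and> G (1, x) = p) \<and> (\<forall>t\<in>{0..1}. \<forall>a\<in>A. G (t, a) = p))"
  have "\<exists>Gs. \<forall>i. R i (Gs i) \<and> (\<forall>t\<in>{0..1}. \<forall>x\<in>K i. Gs (Suc i) (t, x) = Gs i (t, x))"
  proof (rule dependent_nat_choice)
    show "\<exists>G. R 0 G"
      unfolding R_def using p fA K0 by (intro exI [of _ "\<lambda>z. p"]) auto
  next
    fix G i assume "R i G"
    then have cG: "continuous_map (subtopology ?P ({0..1} \<times> (K i \<union> A))) (nsphere n) G"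
      and G01: "\<And>x. x \<in> K i \<union> A \<Longrightarrow> G (0, x) = f x \<and> G (1, x) = p"
      and GA: "\<And>t a. \<lbrakk>t \<in> {0..1}; a \<in> A\<rbrakk> \<Longrightarrow> G (t, a) = p"
      by (auto simp: R_def)
    let ?X = "K (Suc i) \<union> A" and ?Y = "K i \<union> A"
    have cX: "closedin M ?X" and cY: "closedin M ?Y"
      using cK A by (auto simp: closedin_Un)
    have XU: "?X \<subseteq> U"
      using KU AU by blast
    have cl: "closedin ?P ({0} \<times> ?X)" "closedin ?P ({1} \<times> ?X)" "closedin ?P ({0..1} \<times> ?Y)"
      using cX cY by (simp_all add: closedin_prod_Times_iff closed_subset)
    have "continuous_map (subtopology ?P ({0} \<times> ?X)) (subtopology M U) snd"
      using XU by (auto simp: continuous_map_in_subtopology intro: continuous_map_from_subtopology continuous_map_snd)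
    from continuous_map_compose [OF this cf]
    have c0: "continuous_map (subtopology ?P ({0} \<times> ?X)) (nsphere n) (f \<circ> snd)" .
    have c1: "continuous_map (subtopology ?P ({1} \<times> ?X)) (nsphere n) (\<lambda>z. p)"
      using p by simp
    let ?k = "\<lambda>z. if z \<in> {0} \<times> ?X then (f \<circ> snd) z else p"
    have k: "continuous_map (subtopology ?P ({0} \<times> ?X \<union> {1} \<times> ?X)) (nsphere n) ?k"
      by (rule continuous_map_union_closed [OF cl(1,2) c0 c1]) auto
    \<comment> \<open>Data for the next prism: \<open>f\<close> at time 0, \<open>p\<close> at time
      1, and the previous homotopy over \<open>K i \<union> A\<close>.\<close>
    let ?\<Phi> = "\<lambda>z. if z \<in> {0..1} \<times> ?Y then G z else ?k z"
    have agree: "G z = ?k z" if "z \<in> {0..1} \<times> ?Y" "z \<in> {0} \<times> ?X \<union> {1} \<times> ?X" for z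
      using that G01 by auto
    have "continuous_map (subtopology ?P ({0..1} \<times> ?Y \<union> ({0} \<times> ?X \<union> {1} \<times> ?X))) (nsphere n) ?\<Phi>"
      by (rule continuous_map_union_closed [OF cl(3) closedin_Un [OF cl(1,2)] cG k agree])
    moreover have "{0..1} \<times> ?Y \<union> ({0} \<times> ?X \<union> {1} \<times> ?X) = {0,1::real} \<times> ?X \<union> {0..1} \<times> (K i \<union> A)"
      by blast
    ultimately have \<Phi>: "continuous_map (subtopology ?P ({0,1} \<times> ?X \<union> {0..1} \<times> (K i \<union> A))) (nsphere n) ?\<Phi>"
      by (simp only:)
    \<comment> \<open>\<open>?X\<close> avoids the zero set, so a hole of \<open>K i\<close> inside
      it is among those already filled.\<close>
    have hole: "T \<subseteq> K i" if "openin M T" "T \<subseteq> ?X" "closedin M (T \<union> K i)" for T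
      unfolding K_def
    proof (rule fill_no_holes [OF that(1)])
      show "T \<inter> Z = {}"
        using that(2) XU by (auto simp: U)
    qed (use that(3) in \<open>simp add: K_def\<close>)
    have "K i \<subseteq> ?X" "A \<subseteq> ?X"
      using Kmono by auto
    from prism_extension [OF M(1,2) charts A cK cX this hole \<Phi>]
    obtain \<Psi> where \<Psi>: "continuous_map (subtopology ?P ({0..1} \<times> ?X)) (nsphere n) \<Psi>"
      and \<Psi>\<Phi>: "\<And>z. z \<in> {0,1} \<times> ?X \<union> {0..1} \<times> (K i \<union> A) \<Longrightarrow> \<Psi> z = ?\<Phi> z"
      by blast
    have "\<Psi> (0, x) = f x \<and> \<Psi> (1, x) = p" if "x \<in> ?X" for x
      using \<Psi>\<Phi> [of "(0, x)"] \<Psi>\<Phi> [of "(1, x)"] that G01 [of x] by (cases "x \<in> K i \<union> A") auto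
    moreover have "\<Psi> (t, a) = p" if "t \<in> {0..1}" "a \<in> A" for t a
      using \<Psi>\<Phi> [of "(t, a)"] that GA by auto
    moreover have "\<Psi> (t, x) = G (t, x)" if "t \<in> {0..1}" "x \<in> K i" for t x
      using \<Psi>\<Phi> [of "(t, x)"] that by auto
    ultimately show "\<exists>G'. R (Suc i) G' \<and> (\<forall>t\<in>{0..1}. \<forall>x\<in>K i. G' (t, x) = G (t, x))"
      using \<Psi> unfolding R_def by (intro exI [of _ \<Psi>]) blast
  qed
  then obtain Gs where R: "\<And>i. R i (Gs i)"
    and Gstep: "\<And>i t x. \<lbrakk>t \<in> {0..1}; x \<in> K i\<rbrakk> \<Longrightarrow> Gs (Suc i) (t, x) = Gs i (t, x)"
    by blast
  have Kle: "K i \<subseteq> K j" if "i \<le> j" for i j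
    using lift_Suc_mono_le [of K, OF Kmono that] .
  have Gle: "Gs j (t, x) = Gs i (t, x)" if "i \<le> j" "t \<in> {0..1}" "x \<in> K i" for i j t x
    using that(1)
  proof (induction j rule: dec_induct)
    case base
    show ?case by simp
  next
    case (step j)
    have "x \<in> K j"
      using that(3) Kle [OF step(1)] by blast
    then show ?case
      using Gstep [OF that(2)] step(3) by simp
  qed
  have Geq: "Gs j (t, x) = Gs i (t, x)" if "t \<in> {0..1}" "x \<in> K i" "x \<in> K j" for i j t x
    using Gle [of i j] Gle [of j i] that by (metis nat_le_linear)
  \<comment> \<open>The strict inequality gives open sets inside the stages that still cover
    \<open>U\<close>; continuity of the limit is checked on them.\<close>
  define V where "V = (\<lambda>i. {x \<in> topspace M. 1 < real i * s x})"
  have opV: "openin M (V i)" for i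
    unfolding V_def by (rule continuous_map_euclideanreal_ge [OF cis])
  have VK: "V i \<subseteq> K i" for i
    by (auto simp: V_def K_def fill_def C_def)
  have UV: "\<exists>i. x \<in> V i" if "x \<in> U" for x
  proof -
    have "s x > 0"
      using that s0 [of x] by (auto simp: U Z_def less_le)
    then obtain i where "1 < real i * s x"
      using reals_Archimedean3 by blast
    then show ?thesis
      using that by (auto simp: V_def U)
  qed
  \<comment> \<open>\<open>LEAST\<close> only picks some stage containing \<open>x\<close>; by
    \<open>Geq\<close> all such stages give the same value.\<close>
  define G where "G = (\<lambda>(t, x). Gs (LEAST i. x \<in> K i) (t, x))"
  have G: "G (t, x) = Gs i (t, x)" if "t \<in> {0..1}" "x \<in> K i" for t x i
  proof -
    have "x \<in> K (LEAST i. x \<in> K i)"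
      using that(2) by (rule LeastI)
    from Geq [OF that(1,2) this] show ?thesis
      by (simp add: G_def)
  qed
  show thesis
  proof
    show "continuous_map (prod_topology interval (subtopology M U)) (nsphere n) G"
    proof (rule pasting_lemma [where I = UNIV and T = "\<lambda>i. {0..1} \<times> V i" and f = Gs])
      fix i
      show "openin (prod_topology interval (subtopology M U)) ({0..1} \<times> V i)"
      proof -
        have "V i \<inter> U = V i"
          using VK [of i] KU [of i] by blast
        then have "openin (subtopology M U) (V i)"
          using openin_subtopology_Int [OF opV [of i], of U] by simp
        then show ?thesis
          by (simp add: openin_prod_Times_iff)
      qed
      have sub: "subtopology (prod_topology interval (subtopology M U)) ({0..1} \<times> V i) = subtopology ?P ({0..1} \<times> V i)"
      proof -
        have "prod_topology interval (subtopology M U) = subtopology ?P ({0..1} \<times> U)"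
          using subtopology_Times [of interval M "{0..1}" U] by (simp add: subtopology_subtopology)
        moreover have "({0..1} \<times> U) \<inter> ({0..1} \<times> V i) = {0..1::real} \<times> V i"
          using VK [of i] KU [of i] by blast
        ultimately show ?thesis
          by (simp only: subtopology_subtopology)
      qed
      have "{0..1::real} \<times> V i \<subseteq> {0..1} \<times> (K i \<union> A)"
        using VK by blast
      then show "continuous_map (subtopology (prod_topology interval (subtopology M U)) ({0..1} \<times> V i)) (nsphere n) (Gs i)"
        unfolding sub using R [of i] continuous_map_from_subtopology_mono unfolding R_def by blast
    next
      fix i j z assume "z \<in> topspace (prod_topology interval (subtopology M U)) \<inter> {0..1} \<times> V i \<inter> {0..1} \<times> V j"
      then show "Gs i z = Gs j z"
        using VK Geq by (cases z) blast
    next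
      fix z assume "z \<in> topspace (prod_topology interval (subtopology M U))"
      then obtain t x where z: "z = (t, x)" "t \<in> {0..1}" "x \<in> U" by auto
      then obtain i where "x \<in> V i" using UV by blast
      then show "\<exists>j. j \<in> UNIV \<and> z \<in> {0..1} \<times> V j \<and> G z = Gs j z"
        using z G VK by blast
    qed
    fix x assume "x \<in> U"
    then obtain i where i: "x \<in> K i" using UV VK by blast
    show "G (0, x) = unit_vec n (g x)" "G (1, x) = p"
      using G [OF _ i, of 0] G [OF _ i, of 1] R [of i] i by (auto simp: R_def f_def)
  next
    fix t :: real and a assume t: "t \<in> {0..1}" and a: "a \<in> A"
    then obtain i where i: "a \<in> K i" using UV VK AU by blast
    show "G (t, a) = p"
      using G [OF t i] R [of i] t a by (auto simp: R_def)
  qed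
qed

text \<open>Finitely many charts cover \<open>M\<close>, and the part of \<open>X\<close> in a chart
  is a continuous image of a subset of the cube, where all subspaces are Lindelof.\<close>

lemma Lindelof_space_subset_manifold:
  assumes M: "compact_space M"
    and charts: "\<And>y G. \<lbrakk>openin M G; y \<in> G\<rbrakk> \<Longrightarrow> \<exists>Q U \<psi>. Q \<subseteq> G \<and> cube_chart n M B y Q U \<psi>"
    and X: "X \<subseteq> topspace M"
  shows "Lindelof_space (subtopology M X)"
proof -
  have Lin: "Lindelof_space (top_of_set T)" for T :: "(nat \<Rightarrow> real) set"
    unfolding Lindelof_space_def by (metis Lindelof_openin topspace_euclidean_subtopology)
  have "\<forall>y\<in>topspace M. \<exists>U. openin M U \<and> y \<in> U \<and> Lindelof_space (subtopology M (X \<inter> U))"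
  proof
    fix y assume "y \<in> topspace M"
    with charts [of "topspace M" y] obtain Q U \<psi> where ch: "cube_chart n M B y Q U \<psi>" by auto
    then have U: "openin M U" "y \<in> U" "U \<subseteq> Q" and QM: "Q \<subseteq> topspace M"
      and \<psi>: "homeomorphic_map (subtopology M Q) (top_of_set (cube n)) \<psi>"
      using closedin_subset by (auto simp: cube_chart_def)
    then obtain \<phi> where "homeomorphic_maps (subtopology M Q) (top_of_set (cube n)) \<psi> \<phi>"
      using homeomorphic_map_maps by blast
    then have c\<phi>: "continuous_map (top_of_set (cube n)) (subtopology M Q) \<phi>" and \<phi>\<psi>: "\<And>x. x \<in> Q \<Longrightarrow> \<phi> (\<psi> x) = x"
      and \<psi>c: "\<And>x. x \<in> Q \<Longrightarrow> \<psi> x \<in> cube n"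
      using QM by (auto simp: homeomorphic_maps_def continuous_map_def Pi_iff)
    have XU: "X \<inter> U \<subseteq> topspace M \<inter> Q"
      using U X by blast
    have im: "\<phi> ` \<psi> ` (X \<inter> U) = X \<inter> U"
      using \<phi>\<psi> U by force
    have "continuous_map (top_of_set (\<psi> ` (X \<inter> U))) M \<phi>"
      using continuous_map_into_fulltopology [OF c\<phi>] \<psi>c U by (auto intro: continuous_map_from_subtopology_mono)
    then have "continuous_map (top_of_set (\<psi> ` (X \<inter> U))) (subtopology M (X \<inter> U)) \<phi>"
      using im by (auto simp: continuous_map_in_subtopology)
    moreover have "\<phi> ` topspace (top_of_set (\<psi> ` (X \<inter> U))) = topspace (subtopology M (X \<inter> U))"
      using im XU by auto
    ultimately have "Lindelof_space (subtopology M (X \<inter> U))"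
      using Lindelof_space_continuous_map_image [OF Lin] by blast
    then show "\<exists>U. openin M U \<and> y \<in> U \<and> Lindelof_space (subtopology M (X \<inter> U))"
      using U by blast
  qed
  from bchoice [OF this] obtain U where U: "\<And>y. y \<in> topspace M \<Longrightarrow> openin M (U y) \<and> y \<in> U y \<and> Lindelof_space (subtopology M (X \<inter> U y))"
    by blast
  have "(\<forall>V\<in>U ` topspace M. openin M V) \<and> topspace M \<subseteq> \<Union>(U ` topspace M)"
    using U by blast
  with M have "\<exists>\<F>. finite \<F> \<and> \<F> \<subseteq> U ` topspace M \<and> topspace M \<subseteq> \<Union>\<F>"
    unfolding compact_space_alt by blast
  then obtain \<F> where \<F>: "finite \<F>" "\<F> \<subseteq> U ` topspace M" "topspace M \<subseteq> \<Union>\<F>" by blast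
  have "Lindelof_space (subtopology M (\<Union>((\<lambda>V. X \<inter> V) ` \<F>)))"
    using \<F> U by (intro Lindelof_space_Union) (auto simp: countable_finite)
  moreover have "\<Union>((\<lambda>V. X \<inter> V) ` \<F>) = X"
    using X \<F>(3) by blast
  ultimately show ?thesis by simp
qed

section \<open>Approximating maps given on arbitrary subspaces\<close>

lemma suminf_weighted_pos:
  fixes a :: "nat \<Rightarrow> real"
  assumes "\<And>k. 0 \<le> a k" "\<And>k. a k \<le> c" "\<exists>k. a k > 0"
  shows "(suminf (\<lambda>k. (1/2) ^ k * a k)) > 0"
proof -
  have "summable (\<lambda>k. (1/2) ^ k * a k)"
  proof (rule summable_comparison_test' [of "\<lambda>k. (1/2) ^ k * c"])
    show "norm ((1/2) ^ k * a k) \<le> (1/2) ^ k * c" for k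
      using assms(1,2) by (simp add: abs_mult mult_left_mono)
  qed (intro summable_mult2 summable_geometric, simp)
  moreover obtain k where "a k > 0" using assms(3) by blast
  ultimately show ?thesis
    using assms(1) by (intro suminf_pos2 [of _ k]) auto
qed

lemma continuous_map_weighted_suminf:
  fixes a :: "nat \<Rightarrow> 'a \<Rightarrow> real"
  assumes "\<And>k. continuous_map X euclideanreal (a k)" and bd: "\<And>k x. x \<in> topspace X \<Longrightarrow> \<bar>a k x\<bar> \<le> 1"
  shows "continuous_map X euclideanreal (\<lambda>x. suminf (\<lambda>k. (1/2) ^ k * a k x))"
proof -
  have sm: "summable (\<lambda>k. (1/2::real) ^ k)"
    by (rule summable_geometric) simp
  have "uniform_limit (topspace X) (\<lambda>n x. \<Sum>k<n. (1/2) ^ k * a k x) (\<lambda>x. suminf (\<lambda>k. (1/2) ^ k * a k x)) sequentially"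
    by (rule Weierstrass_m_test [OF _ sm]) (use bd in \<open>auto simp: abs_mult mult_left_le\<close>)
  then have "\<forall>\<^sub>F n in sequentially. \<forall>x\<in>topspace X. dist (\<Sum>k<n. (1/2) ^ k * a k x) (suminf (\<lambda>k. (1/2) ^ k * a k x)) < e"
    if "e > 0" for e
    using that by (simp add: uniform_limit_iff)
  moreover have "continuous_map X Met_TC.mtopology (\<lambda>x. \<Sum>k<n. (1/2) ^ k * a k x)" for n
    unfolding mtopology_is_euclidean by (intro continuous_intros assms) auto
  ultimately have "continuous_map X Met_TC.mtopology (\<lambda>x. suminf (\<lambda>k. (1/2) ^ k * a k x))"
    by (intro Met_TC.continuous_map_uniform_limit [where F = sequentially and f = "\<lambda>n x. \<Sum>k<n. (1/2) ^ k * a k x"]) auto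
  then show ?thesis
    by (simp add: mtopology_is_euclidean)
qed

text \<open>An arbitrary subspace \<open>X\<close> need not be open or closed, so \<open>f\<close> has no neighbourhood extension.
  A countable positive combination \<open>g\<close> of values of \<open>f\<close> is defined on all of \<open>M\<close> and is never
  antipodal to \<open>f\<close> on \<open>X\<close>.\<close>

lemma approximate_extension:
  assumes M: "compact_space M" "Hausdorff_space M"
    and L: "Lindelof_space (subtopology M X)"
    and X: "X \<subseteq> topspace M" "X \<noteq> {}" and x0: "x0 \<in> topspace M" "x0 \<notin> X"
    and f: "continuous_map (subtopology M X) (nsphere n) f"
    and A: "closedin M A" "A \<subseteq> X" "\<And>a. a \<in> A \<Longrightarrow> f a = p"
  obtains g where "\<And>i. i \<le> n \<Longrightarrow> continuous_map M euclideanreal (\<lambda>x. g x i)"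
    "\<And>i. i \<le> n \<Longrightarrow> g x0 i = 0" "\<And>x. x \<in> X \<Longrightarrow> (\<Sum>i\<le>n. f x i * g x i) > 0"
    "\<And>a. a \<in> A \<Longrightarrow> \<exists>c>0. \<forall>i\<le>n. g a i = c * p i"
proof -
  have nM: "normal_space M"
    using M by (simp add: compact_Hausdorff_or_regular_imp_normal_space)
  have cf: "continuous_map (subtopology M X) euclideanreal (\<lambda>y. f y i)" if "i \<le> n" for i
    using f that by (simp add: continuous_map_nsphere_iff)
  have fS: "f x \<in> topspace (nsphere n)" if "x \<in> X" for x
    using f that X by (auto simp: continuous_map_def Pi_iff)
  have f1: "\<bar>f x i\<bar> \<le> 1" if "x \<in> X" for x i
    using topspace_nsphere_1 [OF fS [OF that]] by (simp add: abs_square_le_1)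
  \<comment> \<open>\<open>\<phi>\<close> is a bump around \<open>x\<close>, supported within
    \<open>X\<close> where \<open>f\<close> stays in the open hemisphere around \<open>f x\<close>,
    and zero at \<open>x0\<close>. For \<open>x\<close> outside \<open>A\<close> it also vanishes on
    \<open>A\<close>, so over \<open>A\<close> only terms with value \<open>p\<close> survive and
    the sum is a multiple of \<open>p\<close>.\<close>
  define Q where "Q = (\<lambda>x \<phi>. continuous_map M interval \<phi> \<and> \<phi> x = 1 \<and> \<phi> x0 = 0 \<and>
     (\<forall>y\<in>X. \<phi> y \<noteq> 0 \<longrightarrow> (\<Sum>i\<le>n. f x i * f y i) > 0) \<and> (x \<notin> A \<longrightarrow> (\<forall>a\<in>A. \<phi> a = 0)))"
  have "\<forall>x\<in>X. \<exists>\<phi>. Q x \<phi>"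
  proof
    fix x assume x: "x \<in> X"
    have "continuous_map (subtopology M X) euclideanreal (\<lambda>y. \<Sum>i\<le>n. f x i * f y i)"
      by (intro continuous_intros cf) auto
    then have "openin (subtopology M X) {y \<in> topspace (subtopology M X). 0 < (\<Sum>i\<le>n. f x i * f y i)}"
      by (rule continuous_map_euclideanreal_ge)
    then obtain T where T: "openin M T" "{y \<in> topspace (subtopology M X). 0 < (\<Sum>i\<le>n. f x i * f y i)} = T \<inter> X"
      by (auto simp: openin_subtopology)
    let ?A = "if x \<in> A then {} else A"
    define V where "V = T - {x0} - ?A"
    have "openin M V"
      unfolding V_def using T(1) A(1) M(2) x0 by (auto intro!: openin_diff simp: closedin_Hausdorff_singleton)
    then have "closedin M (topspace M - V)" by auto
    moreover have "closedin M {x}"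
      using M(2) X x by (auto simp: closedin_Hausdorff_singleton)
    moreover have "(\<Sum>i\<le>n. f x i * f x i) = 1"
      using fS [OF x] by (simp add: topspace_nsphere power2_eq_square)
    then have "x \<in> {y \<in> topspace (subtopology M X). 0 < (\<Sum>i\<le>n. f x i * f y i)}"
      using x X by auto
    then have "x \<in> V"
      using x x0 unfolding T(2) V_def by auto
    then have "disjnt (topspace M - V) {x}"
      by (auto simp: disjnt_iff)
    ultimately obtain \<phi> where \<phi>: "continuous_map M interval \<phi>" "\<phi> ` (topspace M - V) \<subseteq> {0}" "\<phi> ` {x} \<subseteq> {1}"
      using Urysohn_lemma [OF nM, of "topspace M - V" "{x}" 0 1] by auto
    have 0: "\<phi> y = 0" if "y \<in> topspace M" "y \<notin> V" for y
      using \<phi>(2) that by blast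
    have "\<phi> x0 = 0"
      by (rule 0) (use x0 in \<open>auto simp: V_def\<close>)
    moreover have "(\<Sum>i\<le>n. f x i * f y i) > 0" if "y \<in> X" "\<phi> y \<noteq> 0" for y
    proof -
      have "y \<in> T \<inter> X"
        using 0 [of y] that X by (auto simp: V_def)
      then show ?thesis
        unfolding T(2) [symmetric] by simp
    qed
    moreover have "\<phi> a = 0" if "x \<notin> A" "a \<in> A" for a
      by (rule 0) (use that A X in \<open>auto simp: V_def\<close>)
    ultimately show "\<exists>\<phi>. Q x \<phi>"
      using \<phi> unfolding Q_def by (intro exI [of _ \<phi>]) auto
  qed
  from bchoice [OF this] obtain \<phi> where \<phi>: "\<And>x. x \<in> X \<Longrightarrow> Q x (\<phi> x)" by blast
  have c\<phi>: "continuous_map M euclideanreal (\<phi> x)" and \<phi>01: "\<And>y. y \<in> topspace M \<Longrightarrow> 0 \<le> \<phi> x y \<and> \<phi> x y \<le> 1" if "x \<in> X" for x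
    using \<phi> [OF that] by (auto simp: Q_def continuous_map_interval_iff Pi_iff)
  let ?W = "\<lambda>x. {y \<in> topspace M. 0 < \<phi> x y}"
  have opW: "\<forall>U\<in>?W ` X. openin M U"
    using c\<phi> continuous_map_euclideanreal_ge(2) by blast
  have "y \<in> ?W y" if "y \<in> X" for y
    using \<phi> [OF that] that X by (auto simp: Q_def)
  then have covW: "topspace M \<inter> X \<subseteq> \<Union>(?W ` X)"
    by blast
  \<comment> \<open>Countably many bumps cover \<open>X\<close>, which permits a convergent weighted
    sum.\<close>
  have "\<exists>\<V>. countable \<V> \<and> \<V> \<subseteq> ?W ` X \<and> topspace M \<inter> X \<subseteq> \<Union>\<V>"
    using L [unfolded Lindelof_space_subtopology, THEN spec, of "?W ` X", THEN mp, OF conjI [OF opW covW]] .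
  then obtain \<V> where \<V>: "countable \<V>" "\<V> \<subseteq> ?W ` X" "topspace M \<inter> X \<subseteq> \<Union>\<V>"
    by (elim exE conjE) (rule that)
  have "\<exists>N. countable N \<and> N \<subseteq> X \<and> \<V> = ?W ` N"
    by (rule iffD1 [OF countable_subset_image conjI [OF \<V>(1,2)]])
  then obtain N where N: "countable N" "N \<subseteq> X" "\<V> = ?W ` N"
    by (elim exE conjE) (rule that)
  have "N \<noteq> {}"
    using N(3) \<V>(3) X by auto
  define e where "e = from_nat_into N"
  have re: "range e = N"
    unfolding e_def using N(1) \<open>N \<noteq> {}\<close> by (rule range_from_nat_into [rotated])
  then have eX: "e k \<in> X" for k
    using N(2) by auto
  have cover: "\<exists>k. \<phi> (e k) y > 0" if "y \<in> X" for y
  proof -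
    have "y \<in> \<Union>(?W ` N)"
      using \<V>(3) N(3) X that by blast
    then show ?thesis
      using re by auto
  qed
  \<comment> \<open>The weights \<open>(1/2) ^ k\<close> make the series converge uniformly on all
    of \<open>M\<close>: the values of \<open>f\<close> enter as constants, only the bumps vary with
    \<open>y\<close>.\<close>
  define g where "g = (\<lambda>y i. suminf (\<lambda>k. (1/2) ^ k * (\<phi> (e k) y * f (e k) i)))"
  have bd: "\<bar>\<phi> (e k) y * f (e k) i\<bar> \<le> 1" if "y \<in> topspace M" for k y i
    using \<phi>01 [OF eX that, of k] f1 [OF eX, of k i] by (auto simp: abs_mult intro: mult_le_one)
  have smm: "summable (\<lambda>k. (1/2) ^ k * (\<phi> (e k) y * f (e k) i))" if "y \<in> topspace M" for y i
  proof (rule summable_comparison_test' [of "\<lambda>k. (1/2::real) ^ k"])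
    show "norm ((1/2) ^ k * (\<phi> (e k) y * f (e k) i)) \<le> (1/2) ^ k" for k
      using bd [OF that, of k i] by (simp add: abs_mult mult_left_le)
  qed (rule summable_geometric, simp)
  show thesis
  proof
    show "continuous_map M euclideanreal (\<lambda>y. g y i)" for i
      unfolding g_def
      by (rule continuous_map_weighted_suminf) (use bd in \<open>auto intro!: continuous_intros c\<phi> eX\<close>)
    show "g x0 i = 0" for i
      using \<phi> [OF eX] by (simp add: g_def Q_def)
    show "(\<Sum>i\<le>n. f y i * g y i) > 0" if y: "y \<in> X" for y
    proof -
      have yM: "y \<in> topspace M" using y X by blast
      have "(\<Sum>i\<le>n. f y i * g y i) = (\<Sum>i\<le>n. suminf (\<lambda>k. f y i * ((1/2) ^ k * (\<phi> (e k) y * f (e k) i))))"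
        unfolding g_def by (simp add: suminf_mult [OF smm [OF yM]])
      also have "\<dots> = (suminf (\<lambda>k. \<Sum>i\<le>n. f y i * ((1/2) ^ k * (\<phi> (e k) y * f (e k) i))))"
        by (rule suminf_sum [symmetric]) (intro summable_mult smm yM)
      also have "\<dots> = (suminf (\<lambda>k. (1/2) ^ k * (\<phi> (e k) y * (\<Sum>i\<le>n. f (e k) i * f y i))))"
        by (simp add: sum_distrib_left algebra_simps)
      also have "\<dots> > 0"
      proof (rule suminf_weighted_pos)
        have pos: "(\<Sum>i\<le>n. f (e k) i * f y i) > 0" if "\<phi> (e k) y \<noteq> 0" for k
          using \<phi> [OF eX, of k] y that by (auto simp: Q_def)
        show "0 \<le> \<phi> (e k) y * (\<Sum>i\<le>n. f (e k) i * f y i)" for k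
          using pos [of k] \<phi>01 [OF eX yM, of k] by (cases "\<phi> (e k) y = 0") auto
        show "\<exists>k. 0 < \<phi> (e k) y * (\<Sum>i\<le>n. f (e k) i * f y i)"
        proof -
          obtain k where "\<phi> (e k) y > 0" using cover [OF y] by blast
          then show ?thesis
            using pos [of k] by (intro exI [of _ k] mult_pos_pos) auto
        qed
        have le1: "(\<Sum>i\<le>n. f (e k) i * f y i) \<le> (\<Sum>i\<le>n. 1)" for k
        proof (rule sum_mono)
          fix i
          have "\<bar>f (e k) i * f y i\<bar> \<le> 1"
            using f1 [OF eX, of k i] f1 [OF y, of i] by (auto simp: abs_mult intro: mult_le_one)
          then show "f (e k) i * f y i \<le> 1" by linarith
        qed
        have le: "(\<Sum>i\<le>n. f (e k) i * f y i) \<le> real n + 1" for k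
          using le1 [of k] by simp
        show "\<phi> (e k) y * (\<Sum>i\<le>n. f (e k) i * f y i) \<le> real n + 1" for k
        proof (cases "\<phi> (e k) y = 0")
          case False
          have "\<phi> (e k) y * (\<Sum>i\<le>n. f (e k) i * f y i) \<le> 1 * (\<Sum>i\<le>n. f (e k) i * f y i)"
            using \<phi>01 [OF eX yM, of k] pos [OF False] by (intro mult_right_mono) auto
          then show ?thesis using le [of k] by linarith
        qed auto
      qed
      finally show ?thesis .
    qed
    show "\<exists>c>0. \<forall>i\<le>n. g a i = c * p i" if a: "a \<in> A" for a
    proof -
      have aM: "a \<in> topspace M" using a A X by blast
      let ?c = "suminf (\<lambda>k. (1/2) ^ k * \<phi> (e k) a)"
      have sc: "summable (\<lambda>k. (1/2) ^ k * \<phi> (e k) a)"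
      proof (rule summable_comparison_test' [of "\<lambda>k. (1/2::real) ^ k"])
        show "norm ((1/2) ^ k * \<phi> (e k) a) \<le> (1/2) ^ k" for k
          using \<phi>01 [OF eX aM, of k] by (simp add: abs_mult mult_left_le)
      qed (rule summable_geometric, simp)
      have "?c > 0"
        using \<phi>01 [OF eX aM] cover [of a] a A(2) by (intro suminf_weighted_pos [where c = 1]) auto
      moreover have "g a i = ?c * p i" for i
      proof -
        have eqk: "\<phi> (e k) a * f (e k) i = \<phi> (e k) a * p i" for k
          using \<phi> [OF eX, of k] a A(3) [of "e k"] by (cases "e k \<in> A") (auto simp: Q_def)
        have "g a i = (suminf (\<lambda>k. (1/2) ^ k * \<phi> (e k) a * p i))"
          unfolding g_def by (simp only: eqk mult.assoc)
        also have "\<dots> = ?c * p i"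
          by (rule suminf_mult2 [symmetric, OF sc])
        finally show ?thesis .
      qed
      ultimately show ?thesis by blast
    qed
  qed
qed

text \<open>On \<open>X\<close> the map is joined to the normalised approximation \<open>g\<close>
  by a linear homotopy, and that to \<open>p\<close>, because \<open>g\<close> vanishes at a point
  outside \<open>X\<close>. Both homotopies are stationary on \<open>A\<close>, where
  \<open>g\<close> is a positive multiple of \<open>p\<close>.\<close>

lemma proper_subspace_not_in_H:
  assumes p: "p \<in> topspace (nsphere n)" and M: "compact_space M" "connected_space M"
    and mf: "manifold_with_boundary n M"
    and X: "X \<subset> topspace M" and A: "A \<subseteq> manifold_boundary n M"
  shows "\<not> in_H n p (subtopology M X) A"
proof
  let ?X = "subtopology M X"
  assume "in_H n p ?X A"
  then obtain f where cA: "compactin ?X A" and f: "continuous_map ?X (nsphere n) f" and fA: "f ` A \<subseteq> {p}"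
    and ess: "\<not> homotopic_with (\<lambda>g. \<forall>a\<in>A. g a = p) ?X (nsphere n) f (\<lambda>x. p)"
    by (auto simp: in_H_def)
  have HM: "Hausdorff_space M"
    using mf by (simp add: manifold_with_boundary_def)
  have charts: "\<And>y G. \<lbrakk>openin M G; y \<in> G\<rbrakk> \<Longrightarrow> \<exists>Q U \<psi>. Q \<subseteq> G \<and> cube_chart n M (manifold_boundary n M) y Q U \<psi>"
    by (rule cube_chart_exists [OF mf])
  have XM: "X \<subseteq> topspace M" using X by blast
  have cAM: "compactin M A" and AX: "A \<subseteq> X"
    using cA by (auto simp: compactin_subtopology)
  \<comment> \<open>\<open>A\<close> is compact, hence closed in \<open>M\<close> although
    \<open>X\<close> need not be.\<close>
  have clA: "closedin M A"
    using HM cAM compactin_imp_closedin by blast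
  obtain x0 where x0: "x0 \<in> topspace M" "x0 \<notin> X"
    using X by blast
  let ?H = "\<lambda>g. \<forall>a\<in>A. g a = p"
  have Hcong: "?H h = ?H k" if "\<And>x. x \<in> topspace ?X \<Longrightarrow> h x = k x" for h k :: "'a \<Rightarrow> nat \<Rightarrow> real"
    using that AX XM by (metis (no_types, lifting) IntI subset_iff topspace_subtopology)
  show False
  proof (cases "X = {}")
    case True
    then have "homotopic_with ?H ?X (nsphere n) f (\<lambda>x. p)"
      using AX f by (intro homotopic_with_equal) auto
    with ess show False by blast
  next
    case False
    have fAp: "\<And>a. a \<in> A \<Longrightarrow> f a = p"
      using fA by auto
    obtain g where g: "\<And>i. i \<le> n \<Longrightarrow> continuous_map M euclideanreal (\<lambda>x. g x i)"
      and gx0: "\<And>i. i \<le> n \<Longrightarrow> g x0 i = 0" and pos: "\<And>x. x \<in> X \<Longrightarrow> (\<Sum>i\<le>n. f x i * g x i) > 0"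
      and gA: "\<And>a. a \<in> A \<Longrightarrow> \<exists>c>0. \<forall>i\<le>n. g a i = c * p i"
      using approximate_extension [OF M(1) HM Lindelof_space_subset_manifold [OF M(1) charts XM] XM False x0 f clA AX fAp]
      by blast
    have 0: "(\<Sum>j\<le>n. (g x0 j)\<^sup>2) = 0"
      by (simp add: gx0)
    let ?U = "{x \<in> topspace M. (\<Sum>j\<le>n. (g x j)\<^sup>2) \<noteq> 0}"
    from nullhomotopic_off_zero_set [OF M(1) HM M(2) charts g x0(1) 0 clA A p gA]
    obtain G where G: "continuous_map (prod_topology interval (subtopology M ?U)) (nsphere n) G"
      "\<And>x. x \<in> ?U \<Longrightarrow> G (0, x) = unit_vec n (g x)" "\<And>x. x \<in> ?U \<Longrightarrow> G (1, x) = p"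
      "\<And>t a. \<lbrakk>t \<in> {0..1}; a \<in> A\<rbrakk> \<Longrightarrow> G (t, a) = p"
      by blast
    have XU: "X \<subseteq> ?U"
    proof
      fix x assume x: "x \<in> X"
      have "g x j = 0" if "(\<Sum>j\<le>n. (g x j)\<^sup>2) = 0" "j \<le> n" for j
        using that by (simp add: sum_nonneg_eq_0_iff)
      then have "(\<Sum>j\<le>n. (g x j)\<^sup>2) \<noteq> 0"
        using pos [OF x] by auto
      then show "x \<in> ?U" using x XM by blast
    qed
    have cg: "continuous_map ?X euclideanreal (\<lambda>x. g x i)" if "i \<le> n" for i
      by (rule continuous_map_from_subtopology [OF g [OF that]])
    have pos': "(\<Sum>i\<le>n. f x i * g x i) > 0" if "x \<in> topspace ?X" for x
      using that pos by simp
    from linear_homotopy_unit_vec [OF f cg pos']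
    obtain h where h: "continuous_map (prod_topology interval ?X) (nsphere n) h"
      "\<And>x. x \<in> topspace ?X \<Longrightarrow> h (0, x) = f x"
      "\<And>x. x \<in> topspace ?X \<Longrightarrow> h (1, x) = unit_vec n (g x)"
      "\<And>t x c. \<lbrakk>t \<in> {0..1}; x \<in> topspace ?X; c > 0; \<And>i. i \<le> n \<Longrightarrow> g x i = c * f x i\<rbrakk> \<Longrightarrow> h (t, x) = f x"
      by blast
    have "homotopic_with ?H ?X (nsphere n) f (\<lambda>x. unit_vec n (g x))"
    proof (subst homotopic_with)
      show "\<exists>h. continuous_map (prod_topology interval ?X) (nsphere n) h \<and>
            (\<forall>x\<in>topspace ?X. h (0, x) = f x) \<and> (\<forall>x\<in>topspace ?X. h (1, x) = unit_vec n (g x)) \<and>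
            (\<forall>t\<in>{0..1}. \<forall>a\<in>A. h (t, a) = p)"
      proof (intro exI [of _ h] conjI ballI)
        fix t :: real and a assume t: "t \<in> {0..1}" and a: "a \<in> A"
        obtain c where "c > 0" "\<forall>i\<le>n. g a i = c * p i"
          using gA [OF a] by blast
        then have "h (t, a) = f a"
          using t a AX XM fAp [OF a] by (intro h(4) [of t a c]) auto
        then show "h (t, a) = p"
          using fAp [OF a] by simp
      qed (use h in auto)
    qed (rule Hcong)
    moreover have "homotopic_with ?H ?X (nsphere n) (\<lambda>x. unit_vec n (g x)) (\<lambda>x. p)"
    proof (subst homotopic_with)
      have "prod_topology interval ?X = subtopology (prod_topology interval (subtopology M ?U)) ({0..1} \<times> X)"
        using subtopology_Times [of interval "subtopology M ?U" "{0..1}" X] XU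
        by (simp add: subtopology_subtopology inf_absorb2 Int_absorb1)
      then have "continuous_map (prod_topology interval ?X) (nsphere n) G"
        using continuous_map_from_subtopology [OF G(1)] by simp
      then show "\<exists>h. continuous_map (prod_topology interval ?X) (nsphere n) h \<and>
            (\<forall>x\<in>topspace ?X. h (0, x) = unit_vec n (g x)) \<and> (\<forall>x\<in>topspace ?X. h (1, x) = p) \<and>
            (\<forall>t\<in>{0..1}. \<forall>a\<in>A. h (t, a) = p)"
        using G XU by (intro exI [of _ G]) auto
    qed (rule Hcong)
    ultimately show False
      using ess homotopic_with_trans by blast
  qed
qed

section \<open>Chains modulo 2\<close>

text \<open>\<open>mod2_chain p X S c\<close>: modulo 2, the chain \<open>c\<close> of \<open>X\<close> lies in \<open>S\<close>. \<open>mod2_null p X S c\<close>: modulo 2,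
  \<open>c\<close> is a boundary of \<open>X\<close> relative to \<open>S\<close>.\<close>

definition mod2_chain :: "nat \<Rightarrow> 'a topology \<Rightarrow> 'a set \<Rightarrow> 'a chain \<Rightarrow> bool" where
  "mod2_chain p X S c \<longleftrightarrow> (\<exists>s u. singular_chain p (subtopology X S) s \<and> singular_chain p X u \<and> c = s + (u + u))"

definition mod2_null :: "nat \<Rightarrow> 'a topology \<Rightarrow> 'a set \<Rightarrow> 'a chain \<Rightarrow> bool" where
  "mod2_null p X S c \<longleftrightarrow> (\<exists>e. singular_chain (Suc p) X e \<and> mod2_chain p X S (c - chain_boundary (Suc p) e))"

lemma singular_chain_subtopologyD: "singular_chain p (subtopology X S) c \<Longrightarrow> singular_chain p X c"
  by (simp add: singular_chain_subtopology)

lemma mod2_chainE: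
  assumes "mod2_chain p X S c"
  obtains s u where "singular_chain p (subtopology X S) s" "singular_chain p X u" "c = s + (u + u)"
  using assms unfolding mod2_chain_def by blast

text \<open>Only the parity of the coefficients matters. In this form closure properties, above all
  the one for \<open>S \<inter> T\<close>, become statements about single simplices.\<close>

lemma mod2_chain_iff:
  "mod2_chain p X S c \<longleftrightarrow> singular_chain p X c \<and>
     (\<forall>\<sigma>. odd (Poly_Mapping.lookup c \<sigma>) \<longrightarrow> \<sigma> ` standard_simplex p \<subseteq> S)"
proof
  assume "mod2_chain p X S c"
  then obtain s u where s: "singular_chain p (subtopology X S) s" and u: "singular_chain p X u" and c: "c = s + (u + u)"
    by (rule mod2_chainE)
  have "\<sigma> ` standard_simplex p \<subseteq> S" if "odd (Poly_Mapping.lookup c \<sigma>)" for \<sigma>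
  proof -
    have "Poly_Mapping.lookup s \<sigma> \<noteq> 0"
      using that by (auto simp: c lookup_add)
    then have "\<sigma> \<in> Poly_Mapping.keys s"
      by (simp add: in_keys_iff)
    then show ?thesis
      using s by (auto simp: singular_chain_def singular_simplex_subtopology subset_iff)
  qed
  moreover have "singular_chain p X c"
    unfolding c by (intro singular_chain_add u singular_chain_subtopologyD [OF s])
  ultimately show "singular_chain p X c \<and> (\<forall>\<sigma>. odd (Poly_Mapping.lookup c \<sigma>) \<longrightarrow> \<sigma> ` standard_simplex p \<subseteq> S)"
    by blast
next
  assume R: "singular_chain p X c \<and> (\<forall>\<sigma>. odd (Poly_Mapping.lookup c \<sigma>) \<longrightarrow> \<sigma> ` standard_simplex p \<subseteq> S)"
  let ?K = "Poly_Mapping.keys c" and ?l = "Poly_Mapping.lookup c"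
  \<comment> \<open>Coefficientwise division by 2: \<open>s\<close> collects the remainders and
    \<open>u\<close> the quotients.\<close>
  define s where "s = (\<Sum>\<sigma>\<in>?K. frag_cmul (?l \<sigma> mod 2) (frag_of \<sigma>))"
  define u where "u = (\<Sum>\<sigma>\<in>?K. frag_cmul (?l \<sigma> div 2) (frag_of \<sigma>))"
  have K: "singular_simplex p X \<sigma>" if "\<sigma> \<in> ?K" for \<sigma>
    using R that by (auto simp: singular_chain_def)
  have "singular_chain p (subtopology X S) s"
    unfolding s_def
  proof (rule singular_chain_sum)
    fix \<sigma> assume \<sigma>: "\<sigma> \<in> ?K"
    show "singular_chain p (subtopology X S) (frag_cmul (?l \<sigma> mod 2) (frag_of \<sigma>))"
    proof (cases "odd (?l \<sigma>)")
      case True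
      then show ?thesis
        using R K [OF \<sigma>] by (intro singular_chain_cmul) (simp add: singular_chain_of singular_simplex_subtopology)
    next
      case False
      then have "?l \<sigma> mod 2 = 0" by presburger
      then show ?thesis by simp
    qed
  qed
  moreover have "singular_chain p X u"
    unfolding u_def by (intro singular_chain_sum singular_chain_cmul) (simp add: singular_chain_of K)
  moreover have "c = s + (u + u)"
  proof (rule poly_mapping_eqI)
    fix \<sigma>
    have lk: "Poly_Mapping.lookup (\<Sum>\<sigma>\<in>?K. frag_cmul (a \<sigma>) (frag_of \<sigma>)) \<sigma> = (if \<sigma> \<in> ?K then a \<sigma> else 0)" for a
    proof -
      have "Poly_Mapping.lookup (\<Sum>\<sigma>\<in>?K. frag_cmul (a \<sigma>) (frag_of \<sigma>)) \<sigma> = (\<Sum>\<tau>\<in>?K. if \<tau> = \<sigma> then a \<tau> else 0)"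
        unfolding lookup_sum by (intro sum.cong) (auto simp: lookup_single when_def)
      then show ?thesis by simp
    qed
    show "?l \<sigma> = Poly_Mapping.lookup (s + (u + u)) \<sigma>"
      unfolding s_def u_def lookup_add lk by (auto simp: in_keys_iff)
  qed
  ultimately show "mod2_chain p X S c"
    unfolding mod2_chain_def by blast
qed

lemma mod2_chain_imp_chain: "mod2_chain p X S c \<Longrightarrow> singular_chain p X c"
  by (simp add: mod2_chain_iff)

lemma mod2_chain_0 [simp]: "mod2_chain p X S 0"
  by (simp add: mod2_chain_iff)

lemma mod2_chain_add: "\<lbrakk>mod2_chain p X S a; mod2_chain p X S b\<rbrakk> \<Longrightarrow> mod2_chain p X S (a + b)"
  by (auto simp: mod2_chain_iff singular_chain_add lookup_add)

lemma mod2_chain_diff: "\<lbrakk>mod2_chain p X S a; mod2_chain p X S b\<rbrakk> \<Longrightarrow> mod2_chain p X S (a - b)"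
  by (auto simp: mod2_chain_iff singular_chain_diff lookup_minus)

lemma mod2_chain_minus: "mod2_chain p X S a \<Longrightarrow> mod2_chain p X S (- a)"
  by (auto simp: mod2_chain_iff singular_chain_minus)

lemma mod2_chain_double: "singular_chain p X u \<Longrightarrow> mod2_chain p X S (u + u)"
  by (auto simp: mod2_chain_iff singular_chain_add lookup_add)

lemma mod2_chain_of: "singular_chain p (subtopology X S) c \<Longrightarrow> mod2_chain p X S c"
  unfolding mod2_chain_def by (intro exI [of _ c] exI [of _ 0]) auto

lemma mod2_chain_mono: "\<lbrakk>mod2_chain p X S c; S \<subseteq> T\<rbrakk> \<Longrightarrow> mod2_chain p X T c"
  by (fastforce simp: mod2_chain_iff)

lemma mod2_chain_Int: "\<lbrakk>mod2_chain p X S c; mod2_chain p X T c\<rbrakk> \<Longrightarrow> mod2_chain p X (S \<inter> T) c"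
  by (auto simp: mod2_chain_iff)

lemma mod2_chain_subtopology:
  "\<lbrakk>mod2_chain p X S c; singular_chain p (subtopology X U) c\<rbrakk> \<Longrightarrow> mod2_chain p (subtopology X U) S c"
  by (auto simp: mod2_chain_iff)

lemma mod2_chain_from_subtopology: "mod2_chain p (subtopology X U) S c \<Longrightarrow> mod2_chain p X S c"
  by (auto simp: mod2_chain_iff dest: singular_chain_subtopologyD)

lemma mod2_chain_boundary:
  assumes "mod2_chain p X S c"
  shows "mod2_chain (p - Suc 0) X S (chain_boundary p c)"
proof -
  obtain s u where s: "singular_chain p (subtopology X S) s" and u: "singular_chain p X u" and c: "c = s + (u + u)"
    using assms by (rule mod2_chainE)
  show ?thesis
    unfolding c chain_boundary_add
    by (intro mod2_chain_add [OF mod2_chain_of mod2_chain_double] singular_chain_boundary_alt s u)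
       (use s u in \<open>auto simp: singular_chain_boundary\<close>)
qed

lemma mod2_chain_chain_map:
  assumes c: "mod2_chain p X S c" and h: "continuous_map X Y h" "h \<in> topspace X \<inter> S \<rightarrow> T"
  shows "mod2_chain p Y T (chain_map p h c)"
proof -
  obtain s u where s: "singular_chain p (subtopology X S) s" and u: "singular_chain p X u" and c: "c = s + (u + u)"
    using c by (rule mod2_chainE)
  have "continuous_map (subtopology X S) (subtopology Y T) h"
    using h by (auto simp: continuous_map_in_subtopology continuous_map_from_subtopology)
  then show ?thesis
    unfolding c chain_map_add
    by (intro mod2_chain_add [OF mod2_chain_of mod2_chain_double] singular_chain_chain_map [OF s]
        singular_chain_chain_map [OF u] h)
qed

lemma mod2_nullI: "mod2_chain p X S c \<Longrightarrow> mod2_null p X S c"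
  unfolding mod2_null_def by (intro exI [of _ 0]) auto

lemma mod2_null_boundary: "singular_chain (Suc p) X e \<Longrightarrow> mod2_null p X S (chain_boundary (Suc p) e)"
  unfolding mod2_null_def by (intro exI [of _ e]) auto

lemma mod2_null_add:
  assumes "mod2_null p X S a" "mod2_null p X S b" shows "mod2_null p X S (a + b)"
proof -
  obtain d e where "singular_chain (Suc p) X d" "mod2_chain p X S (a - chain_boundary (Suc p) d)"
    "singular_chain (Suc p) X e" "mod2_chain p X S (b - chain_boundary (Suc p) e)"
    using assms unfolding mod2_null_def by blast
  then have "singular_chain (Suc p) X (d + e)"
    "mod2_chain p X S ((a - chain_boundary (Suc p) d) + (b - chain_boundary (Suc p) e))"
    by (auto intro: singular_chain_add mod2_chain_add)
  then show ?thesis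
    unfolding mod2_null_def by (intro exI [of _ "d + e"]) (simp add: chain_boundary_add algebra_simps)
qed

lemma mod2_null_minus:
  assumes "mod2_null p X S a" shows "mod2_null p X S (- a)"
proof -
  obtain d where d: "singular_chain (Suc p) X d" "mod2_chain p X S (a - chain_boundary (Suc p) d)"
    using assms unfolding mod2_null_def by blast
  from mod2_chain_minus [OF d(2)] d(1) show ?thesis
    unfolding mod2_null_def by (intro exI [of _ "- d"]) (simp add: chain_boundary_minus singular_chain_minus)
qed

lemma mod2_null_diff: "\<lbrakk>mod2_null p X S a; mod2_null p X S b\<rbrakk> \<Longrightarrow> mod2_null p X S (a - b)"
  using mod2_null_add [of p X S a "- b"] mod2_null_minus by auto

lemma mod2_null_mono: "\<lbrakk>mod2_null p X S c; S \<subseteq> T\<rbrakk> \<Longrightarrow> mod2_null p X T c"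
  unfolding mod2_null_def using mod2_chain_mono by blast

lemma mod2_null_from_subtopology: "mod2_null p (subtopology X U) S c \<Longrightarrow> mod2_null p X S c"
  unfolding mod2_null_def using mod2_chain_from_subtopology singular_chain_subtopologyD by blast

lemma mod2_null_chain_map:
  assumes c: "mod2_null p X S c" and h: "continuous_map X Y h" "h \<in> topspace X \<inter> S \<rightarrow> T"
  shows "mod2_null p Y T (chain_map p h c)"
proof -
  obtain e where e: "singular_chain (Suc p) X e" "mod2_chain p X S (c - chain_boundary (Suc p) e)"
    using c unfolding mod2_null_def by blast
  have "chain_boundary (Suc p) (chain_map (Suc p) h e) = chain_map p h (chain_boundary (Suc p) e)"
    using chain_boundary_chain_map [OF e(1), of h] by simp
  then show ?thesis
    using mod2_chain_chain_map [OF e(2) h] singular_chain_chain_map [OF e(1) h(1)]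
    unfolding mod2_null_def by (intro exI [of _ "chain_map (Suc p) h e"]) (simp add: chain_map_diff)
qed

section \<open>Subdivision, Mayer-Vietoris and excision modulo 2\<close>

lemma singular_chain_double_iff: "singular_chain p X (u + u) \<longleftrightarrow> singular_chain p X u"
proof -
  have "Poly_Mapping.keys (u + u) = Poly_Mapping.keys u"
    by (auto simp: in_keys_iff lookup_add)
  then show ?thesis
    by (simp add: singular_chain_def)
qed

text \<open>Subdividing a chain of \<open>S \<union> T\<close> splits it; the chain homotopy \<open>h\<close> respects all subspaces.\<close>

lemma split_chain:
  fixes X :: "'a topology"
  assumes S: "openin X S" and T: "openin X T" and c: "singular_chain p (subtopology X (S \<union> T)) c"
  obtains a b h where "singular_chain p (subtopology X S) a" "singular_chain p (subtopology X T) b"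
    "\<And>q. h q 0 = 0" "\<And>q c1 c2. h q (c1 - c2) = h q c1 - h q c2"
    "\<And>q (Y :: 'a topology) d. singular_chain q Y d \<Longrightarrow> singular_chain (Suc q) Y (h q d)"
    "c = a + b - chain_boundary (Suc p) (h p c) - h (p - Suc 0) (chain_boundary p c)"
proof -
  let ?Y = "subtopology X (S \<union> T)"
  let ?U = "topspace ?Y - S"
  have ST: "S \<subseteq> topspace X" "T \<subseteq> topspace X"
    using S T openin_subset by auto
  have "openin ?Y S" "openin ?Y T"
    using openin_subtopology_Int [OF S, of "S \<union> T"] openin_subtopology_Int [OF T, of "S \<union> T"]
    by (simp_all add: Int_absorb2)
  then have "?Y closure_of ?U = ?U" "?Y interior_of T = T"
    using closure_of_closedin [OF closedin_diff [OF closedin_topspace]] interior_of_openin by blast+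
  then have "?Y closure_of ?U \<subseteq> ?Y interior_of T"
    using ST by auto
  moreover have "T \<subseteq> topspace ?Y"
    using ST by auto
  moreover have "singular_chain p (subtopology ?Y (topspace ?Y)) c"
    using c by (simp only: subtopology_topspace)
  ultimately obtain n d e where d: "singular_chain p (subtopology ?Y (topspace ?Y - ?U)) d"
    and e: "singular_chain p (subtopology ?Y T) e" and de: "(singular_subdivision p ^^ n) c = d + e"
    by (rule excised_chain_exists)
  obtain h where h: "\<And>p. h p 0 = (0 :: 'a chain)" "\<And>p c1 c2. h p (c1-c2) = h p c1 - h p c2"
        "\<And>p X c. singular_chain p X c \<Longrightarrow> singular_chain (Suc p) X (h p c)"
        "\<And>p X c. singular_chain p X c
           \<Longrightarrow> chain_boundary (Suc p) (h p c) + h (p - Suc 0) (chain_boundary p c) = (singular_subdivision p ^^ n) c - c"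
    by (rule chain_homotopic_iterated_singular_subdivision) blast
  show thesis
  proof (rule that [of d e h])
    have "topspace ?Y - ?U = S"
      using ST by auto
    then have "subtopology ?Y (topspace ?Y - ?U) = subtopology X S"
      by (simp add: subtopology_subtopology Int_absorb1)
    then show "singular_chain p (subtopology X S) d"
      using d by simp
    have "subtopology ?Y T = subtopology X T"
      by (simp add: subtopology_subtopology Int_absorb1)
    then show "singular_chain p (subtopology X T) e"
      using e by simp
    show "c = d + e - chain_boundary (Suc p) (h p c) - h (p - Suc 0) (chain_boundary p c)"
      using h(4) [OF c] unfolding de by (simp add: algebra_simps)
  qed (use h in auto)
qed

text \<open>\<open>h\<close> stands for the chain homotopy of iterated subdivision. Being additive
  and acting within every subspace, it respects the decomposition
  \<open>s + (u + u)\<close>.\<close>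

lemma mod2_chain_operator:
  fixes X :: "'a topology" and h :: "nat \<Rightarrow> 'a chain \<Rightarrow> 'a chain"
  assumes h0: "\<And>q. h q 0 = 0" and hd: "\<And>q c1 c2. h q (c1 - c2) = h q c1 - h q c2"
    and hs: "\<And>q (Y :: 'a topology) d. singular_chain q Y d \<Longrightarrow> singular_chain (Suc q) Y (h q d)"
    and c: "mod2_chain p X S c"
  shows "mod2_chain (Suc p) X S (h p c)"
proof -
  obtain s u where s: "singular_chain p (subtopology X S) s" and u: "singular_chain p X u" and c: "c = s + (u + u)"
    using c by (rule mod2_chainE)
  have ha: "h p (a + b) = h p a + h p b" for a b
    using hd [of p a "0 - b"] hd [of p 0 b] h0 by simp
  show ?thesis
    unfolding c ha by (intro mod2_chain_add [OF mod2_chain_of mod2_chain_double] hs s u)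
qed

lemma mod2_chain_operator_boundary:
  fixes X :: "'a topology" and h :: "nat \<Rightarrow> 'a chain \<Rightarrow> 'a chain"
  assumes h0: "\<And>q. h q 0 = 0" and hd: "\<And>q c1 c2. h q (c1 - c2) = h q c1 - h q c2"
    and hs: "\<And>q (Y :: 'a topology) d. singular_chain q Y d \<Longrightarrow> singular_chain (Suc q) Y (h q d)"
    and c: "mod2_chain (p - Suc 0) X S (chain_boundary p c)"
  shows "mod2_chain p X S (h (p - Suc 0) (chain_boundary p c))"
proof (cases p)
  case 0
  then show ?thesis by (simp add: chain_boundary_def h0)
next
  case (Suc q)
  then show ?thesis
    using mod2_chain_operator [of h q X S, OF h0 hd hs] c by simp
qed

text \<open>Injectivity in Mayer-Vietoris: chains \<open>e1\<close> and \<open>e2\<close> that bound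
  \<open>c\<close> relative to \<open>S\<close> and to \<open>T\<close> differ by a cycle relative
  to \<open>S \<union> T\<close>, which is null by \<open>van\<close>. Splitting what remains into
  parts in \<open>S\<close> and in \<open>T\<close> lets \<open>e1\<close> and \<open>e2\<close> be
  corrected to a common chain.\<close>

lemma mod2_null_Int:
  assumes S: "openin X S" and T: "openin X T" and nS: "mod2_null p X S c" and nT: "mod2_null p X T c"
    and van: "\<And>d. \<lbrakk>singular_chain (Suc p) X d; mod2_chain p X (S \<union> T) (chain_boundary (Suc p) d)\<rbrakk> \<Longrightarrow> mod2_null (Suc p) X (S \<union> T) d"
  shows "mod2_null p X (S \<inter> T) c"
proof -
  let ?D = chain_boundary
  obtain e1 where e1: "singular_chain (Suc p) X e1" and s1: "mod2_chain p X S (c - ?D (Suc p) e1)"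
    using nS unfolding mod2_null_def by blast
  obtain e2 where e2: "singular_chain (Suc p) X e2" and s2: "mod2_chain p X T (c - ?D (Suc p) e2)"
    using nT unfolding mod2_null_def by blast
  define s1' where "s1' = c - ?D (Suc p) e1"
  define s2' where "s2' = c - ?D (Suc p) e2"
  have s1': "mod2_chain p X S s1'" and s2': "mod2_chain p X T s2'"
    unfolding s1'_def s2'_def by (rule s1, rule s2)
  have De: "?D (Suc p) (e1 - e2) = s2' - s1'"
    by (simp add: s1'_def s2'_def chain_boundary_diff)
  have "mod2_chain p X (S \<union> T) (s2' - s1')"
    by (rule mod2_chain_diff) (use s1 s2 in \<open>auto simp: s1'_def s2'_def intro: mod2_chain_mono\<close>)
  then obtain w where w: "singular_chain (Suc (Suc p)) X w"
    and t: "mod2_chain (Suc p) X (S \<union> T) (e1 - e2 - ?D (Suc (Suc p)) w)"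
    using van [of "e1 - e2"] e1 e2 De unfolding mod2_null_def by (auto intro: singular_chain_diff)
  obtain t0 u where t0: "singular_chain (Suc p) (subtopology X (S \<union> T)) t0" and u: "singular_chain (Suc p) X u"
    and teq: "e1 - e2 - ?D (Suc (Suc p)) w = t0 + (u + u)"
    using t by (rule mod2_chainE)
  obtain a b h where a: "singular_chain (Suc p) (subtopology X S) a" and b: "singular_chain (Suc p) (subtopology X T) b"
    and h0: "\<And>q. h q 0 = 0" and hd: "\<And>q c1 c2. h q (c1 - c2) = h q c1 - h q c2"
    and hs: "\<And>q (Y :: 'a topology) d. singular_chain q Y d \<Longrightarrow> singular_chain (Suc q) Y (h q d)"
    and t0eq: "t0 = a + b - ?D (Suc (Suc p)) (h (Suc p) t0) - h (Suc p - Suc 0) (?D (Suc p) t0)"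
    by (rule split_chain [OF S T t0]) blast
  have ww: "?D (Suc p) (?D (Suc (Suc p)) w) = 0"
    using chain_boundary_boundary [OF w] by simp
  have "?D (Suc p) (t0 + (u + u)) = s2' - s1'"
    unfolding teq [symmetric] using De by (simp add: chain_boundary_diff ww)
  then have Dt0: "?D (Suc p) t0 = (s2' - s1') - (?D (Suc p) u - (0 - ?D (Suc p) u))"
    by (simp add: chain_boundary_add algebra_simps)
  define v where "v = h p (?D (Suc p) u)"
  have hDt0: "h p (?D (Suc p) t0) = (h p s2' - h p s1') - (v + v)"
    unfolding Dt0 hd h0 v_def by simp
  \<comment> \<open>The corrected chain seen from \<open>S\<close>; \<open>e_alt\<close> expresses
    it from the side of \<open>T\<close>. Together they place \<open>c - ?D (Suc p) e\<close> modulo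
    2 in both sets, hence in the intersection.\<close>
  define e where "e = e1 - a - h p s1'"
  have chs1: "mod2_chain (Suc p) X S (h p s1')"
    by (rule mod2_chain_operator [OF h0 hd hs s1'])
  have chs2: "mod2_chain (Suc p) X T (h p s2')"
    by (rule mod2_chain_operator [OF h0 hd hs s2'])
  have cu: "singular_chain p X (?D (Suc p) u)"
    using singular_chain_boundary [OF u] by simp
  have v: "singular_chain (Suc p) X v"
    unfolding v_def by (rule hs [OF cu])
  have ht: "singular_chain (Suc (Suc p)) X (h (Suc p) t0)"
    by (rule hs [OF singular_chain_subtopologyD [OF t0]])
  have "e1 - e2 - ?D (Suc (Suc p)) w = a + b - ?D (Suc (Suc p)) (h (Suc p) t0) - ((h p s2' - h p s1') - (v + v)) + (u + u)"
    using teq t0eq hDt0 by simp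
  then have e_alt: "e = e2 + ?D (Suc (Suc p)) (w - h (Suc p) t0) + b - h p s2' + ((u + v) + (u + v))"
    by (simp add: e_def chain_boundary_diff algebra_simps)
  have ce: "singular_chain (Suc p) X e"
    unfolding e_def by (intro singular_chain_diff e1 singular_chain_subtopologyD [OF a] mod2_chain_imp_chain [OF chs1])
  have bS: "mod2_chain p X S (?D (Suc p) x)" if "mod2_chain (Suc p) X S x" for x S
    using mod2_chain_boundary [OF that] by simp
  have "c - ?D (Suc p) e = s1' + ?D (Suc p) a + ?D (Suc p) (h p s1')"
    by (simp add: e_def s1'_def chain_boundary_diff chain_boundary_add algebra_simps)
  moreover have "mod2_chain p X S (s1' + ?D (Suc p) a + ?D (Suc p) (h p s1'))"
    by (intro mod2_chain_add s1' bS chs1 mod2_chain_of a)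
  moreover have "?D (Suc p) (?D (Suc (Suc p)) (w - h (Suc p) t0)) = 0"
    using chain_boundary_boundary [OF singular_chain_diff [OF w ht]] by simp
  then have "c - ?D (Suc p) e = s2' - ?D (Suc p) b + ?D (Suc p) (h p s2') - ?D (Suc p) ((u + v) + (u + v))"
    unfolding e_alt by (simp only: chain_boundary_add chain_boundary_diff) (simp add: s2'_def algebra_simps)
  moreover have "mod2_chain p X T (s2' - ?D (Suc p) b + ?D (Suc p) (h p s2') - ?D (Suc p) ((u + v) + (u + v)))"
    by (intro mod2_chain_add mod2_chain_diff s2' bS chs2 mod2_chain_of b mod2_chain_double singular_chain_add u v)
  ultimately have "mod2_chain p X (S \<inter> T) (c - ?D (Suc p) e)"
    using mod2_chain_Int by metis
  with ce show ?thesis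
    unfolding mod2_null_def by blast
qed

text \<open>The gluing half of Mayer-Vietoris: the discrepancy of \<open>c1\<close> and
  \<open>c2\<close> splits into \<open>a\<close> in \<open>S\<close> and \<open>b\<close> in
  \<open>T\<close>, and moving one part to each side yields a common representative.\<close>

lemma mod2_glue:
  assumes S: "openin X S" and T: "openin X T"
    and c1: "singular_chain p X c1" "mod2_chain (p - Suc 0) X S (chain_boundary p c1)"
    and c2: "singular_chain p X c2" "mod2_chain (p - Suc 0) X T (chain_boundary p c2)"
    and eq: "mod2_null p X (S \<union> T) (c1 - c2)"
  obtains c where "singular_chain p X c" "mod2_chain (p - Suc 0) X (S \<inter> T) (chain_boundary p c)"
    "mod2_null p X S (c - c1)" "mod2_null p X T (c - c2)"
proof -
  let ?D = chain_boundary
  obtain e where e: "singular_chain (Suc p) X e" and t: "mod2_chain p X (S \<union> T) (c1 - c2 - ?D (Suc p) e)"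
    using eq unfolding mod2_null_def by blast
  obtain t0 u where t0: "singular_chain p (subtopology X (S \<union> T)) t0" and u: "singular_chain p X u"
    and teq: "c1 - c2 - ?D (Suc p) e = t0 + (u + u)"
    using t by (rule mod2_chainE)
  obtain a b h where a: "singular_chain p (subtopology X S) a" and b: "singular_chain p (subtopology X T) b"
    and h0: "\<And>q. h q 0 = 0" and hd: "\<And>q c1 c2. h q (c1 - c2) = h q c1 - h q c2"
    and hs: "\<And>q (Y :: 'a topology) d. singular_chain q Y d \<Longrightarrow> singular_chain (Suc q) Y (h q d)"
    and t0eq: "t0 = a + b - ?D (Suc p) (h p t0) - h (p - Suc 0) (?D p t0)"
    by (rule split_chain [OF S T t0]) blast
  let ?H = "\<lambda>x. h (p - Suc 0) (?D p x)"
  have ee: "?D p (?D (Suc p) x) = 0" if "singular_chain (Suc p) X x" for x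
    using chain_boundary_boundary [OF that] by simp
  have "?D p (c1 - c2 - ?D (Suc p) e) = ?D p c1 - ?D p c2"
    by (simp add: chain_boundary_diff ee [OF e])
  then have Dt0: "?D p t0 = (?D p c1 - ?D p c2) - (?D p u - (0 - ?D p u))"
    unfolding teq by (simp add: chain_boundary_add algebra_simps)
  have Ht0: "?H t0 = (?H c1 - ?H c2) - (?H u + ?H u)"
    unfolding Dt0 hd h0 by simp
  \<comment> \<open>Up to doubles, the term that the subdivision homotopy contributes on the
    boundary of \<open>t0\<close> splits into \<open>?H c1\<close> in \<open>S\<close> and
    \<open>?H c2\<close> in \<open>T\<close>; each goes to its own side.\<close>
  define c where "c = c1 - a + ?H c1"
  have h1: "mod2_chain p X S (?H c1)"
    by (rule mod2_chain_operator_boundary [OF h0 hd hs c1(2)])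
  have h2: "mod2_chain p X T (?H c2)"
    by (rule mod2_chain_operator_boundary [OF h0 hd hs c2(2)])
  have hu: "singular_chain p X (?H u)"
  proof -
    have "mod2_chain (p - Suc 0) X (topspace X) (?D p u)"
      using singular_chain_boundary [OF u] by (simp add: mod2_chain_of)
    from mod2_chain_imp_chain [OF mod2_chain_operator_boundary [OF h0 hd hs this]] show ?thesis .
  qed
  have "c1 - c2 - ?D (Suc p) e = a + b - ?D (Suc p) (h p t0) - ((?H c1 - ?H c2) - (?H u + ?H u)) + (u + u)"
    using teq t0eq Ht0 by simp
  then have c_alt: "c = c2 + ?D (Suc p) (e - h p t0) + b + ?H c2 + ((u + ?H u) + (u + ?H u))"
    by (simp add: c_def chain_boundary_diff algebra_simps)
  have w: "singular_chain (Suc p) X (e - h p t0)"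
    by (intro singular_chain_diff e hs singular_chain_subtopologyD [OF t0])
  show thesis
  proof
    show "singular_chain p X c"
      unfolding c_def by (intro singular_chain_add singular_chain_diff c1 singular_chain_subtopologyD [OF a] mod2_chain_imp_chain [OF h1])
    have "?D p c = ?D p c1 - ?D p a + ?D p (?H c1)"
      by (simp add: c_def chain_boundary_add chain_boundary_diff)
    moreover have "mod2_chain (p - Suc 0) X S (?D p c1 - ?D p a + ?D p (?H c1))"
      by (intro mod2_chain_add mod2_chain_diff c1 mod2_chain_boundary h1 mod2_chain_of a)
    moreover have "?D p c = ?D p c2 + ?D p b + ?D p (?H c2) + ?D p ((u + ?H u) + (u + ?H u))"
      unfolding c_alt by (simp only: chain_boundary_add ee [OF w] add_0_right)
    moreover have "mod2_chain (p - Suc 0) X T (?D p c2 + ?D p b + ?D p (?H c2) + ?D p ((u + ?H u) + (u + ?H u)))"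
      by (intro mod2_chain_add c2 mod2_chain_boundary h2 mod2_chain_of b mod2_chain_double singular_chain_add u hu)
    ultimately show "mod2_chain (p - Suc 0) X (S \<inter> T) (?D p c)"
      using mod2_chain_Int by metis
    have "c - c1 = ?H c1 - a"
      by (simp add: c_def)
    then show "mod2_null p X S (c - c1)"
      using mod2_chain_diff [OF h1 mod2_chain_of [OF a]] by (simp add: mod2_nullI)
    have "c - c2 = ?D (Suc p) (e - h p t0) + (b + ?H c2 + ((u + ?H u) + (u + ?H u)))"
      by (simp add: c_alt algebra_simps)
    moreover have "mod2_chain p X T (b + ?H c2 + ((u + ?H u) + (u + ?H u)))"
      by (intro mod2_chain_add mod2_chain_of b h2 mod2_chain_double singular_chain_add u hu)
    ultimately show "mod2_null p X T (c - c2)"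
      using mod2_null_add [OF mod2_null_boundary [OF w] mod2_nullI] by simp
  qed
qed

text \<open>The injective half of excision: the bounding chain \<open>e\<close> splits along
  \<open>U\<close> and \<open>S\<close>, and its part in \<open>U\<close>, corrected by
  \<open>h p c\<close>, still bounds \<open>c\<close> up to chains in \<open>S\<close>.\<close>

lemma mod2_null_excise:
  assumes U: "openin X U" and S: "openin X S" and US: "topspace X \<subseteq> U \<union> S"
    and c: "singular_chain p (subtopology X U) c" and nS: "mod2_null p X S c"
  shows "mod2_null p (subtopology X U) S c"
proof -
  let ?D = chain_boundary
  obtain e where e: "singular_chain (Suc p) X e" and s: "mod2_chain p X S (c - ?D (Suc p) e)"
    using nS unfolding mod2_null_def by blast
  have "singular_chain (Suc p) (subtopology X (U \<union> S)) e"
    using e US by (simp add: subtopology_superset)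
  then obtain a b h where a: "singular_chain (Suc p) (subtopology X U) a" and b: "singular_chain (Suc p) (subtopology X S) b"
    and h0: "\<And>q. h q 0 = 0" and hd: "\<And>q c1 c2. h q (c1 - c2) = h q c1 - h q c2"
    and hs: "\<And>q (Y :: 'a topology) d. singular_chain q Y d \<Longrightarrow> singular_chain (Suc q) Y (h q d)"
    and eeq: "e = a + b - ?D (Suc (Suc p)) (h (Suc p) e) - h (Suc p - Suc 0) (?D (Suc p) e)"
    by (rule split_chain [OF U S]) blast
  define s' where "s' = c - ?D (Suc p) e"
  have s': "mod2_chain p X S s'"
    unfolding s'_def by (rule s)
  have hDe: "h p (?D (Suc p) e) = h p c - h p s'"
    unfolding s'_def by (simp add: hd)
  have "?D (Suc p) e = ?D (Suc p) (a + b - ?D (Suc (Suc p)) (h (Suc p) e) - (h p c - h p s'))"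
    using eeq hDe by simp
  moreover have "?D (Suc p) (?D (Suc (Suc p)) (h (Suc p) e)) = 0"
    using chain_boundary_boundary [OF hs [OF e]] by simp
  ultimately have "c - ?D (Suc p) (a - h p c) = s' + ?D (Suc p) b + ?D (Suc p) (h p s')"
    by (simp add: s'_def chain_boundary_add chain_boundary_diff algebra_simps)
  moreover have "mod2_chain p X S (s' + ?D (Suc p) b + ?D (Suc p) (h p s'))"
  proof -
    have hs': "mod2_chain (Suc p) X S (h p s')"
      by (rule mod2_chain_operator [OF h0 hd hs s'])
    show ?thesis
      using mod2_chain_boundary [OF hs'] mod2_chain_boundary [OF mod2_chain_of [OF b]]
      by (auto intro!: mod2_chain_add s')
  qed
  moreover have ac: "singular_chain (Suc p) (subtopology X U) (a - h p c)"
    by (intro singular_chain_diff a hs c)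
  moreover have "singular_chain p (subtopology X U) (c - ?D (Suc p) (a - h p c))"
    using singular_chain_boundary [OF ac] by (auto intro: singular_chain_diff c)
  ultimately show ?thesis
    unfolding mod2_null_def using mod2_chain_subtopology by metis
qed

text \<open>The surjective half of excision: after subdivision, the part in \<open>U\<close>
  represents the class, and the rest lies in \<open>S\<close>.\<close>

lemma mod2_excise_cycle:
  assumes U: "openin X U" and S: "openin X S" and US: "topspace X \<subseteq> U \<union> S"
    and c: "singular_chain p X c" "mod2_chain (p - Suc 0) X S (chain_boundary p c)"
  obtains a where "singular_chain p (subtopology X U) a" "mod2_chain (p - Suc 0) (subtopology X U) S (chain_boundary p a)"
    "mod2_null p X S (c - a)"
proof -
  let ?D = chain_boundary
  have "singular_chain p (subtopology X (U \<union> S)) c"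
    using c US by (simp add: subtopology_superset)
  then obtain a b h where a: "singular_chain p (subtopology X U) a" and b: "singular_chain p (subtopology X S) b"
    and h0: "\<And>q. h q 0 = 0" and hd: "\<And>q c1 c2. h q (c1 - c2) = h q c1 - h q c2"
    and hs: "\<And>q (Y :: 'a topology) d. singular_chain q Y d \<Longrightarrow> singular_chain (Suc q) Y (h q d)"
    and ceq: "c = a + b - ?D (Suc p) (h p c) - h (p - Suc 0) (?D p c)"
    by (rule split_chain [OF U S]) blast
  let ?H = "h (p - Suc 0) (?D p c)"
  have H: "mod2_chain p X S ?H"
    by (rule mod2_chain_operator_boundary [OF h0 hd hs c(2)])
  have hc: "singular_chain (Suc p) X (0 - h p c)"
    by (intro singular_chain_diff hs c) simp
  show thesis
  proof
    show "singular_chain p (subtopology X U) a" by (rule a)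
    have "c - a = ?D (Suc p) (0 - h p c) + (b - ?H)"
      using ceq by (simp add: chain_boundary_minus algebra_simps)
    then show "mod2_null p X S (c - a)"
      using mod2_null_add [OF mod2_null_boundary [OF hc] mod2_nullI [OF mod2_chain_diff [OF mod2_chain_of [OF b] H]]] by simp
    have "?D p (?D (Suc p) (h p c)) = 0"
      using chain_boundary_boundary [OF hs [OF c(1)]] by simp
    then have "?D p c = ?D p a + ?D p b - ?D p ?H"
      using arg_cong [OF ceq, of "?D p"] by (simp add: chain_boundary_add chain_boundary_diff)
    then have "?D p a = ?D p c - ?D p b + ?D p ?H"
      by (simp add: algebra_simps)
    moreover have "mod2_chain (p - Suc 0) X S (?D p c - ?D p b + ?D p ?H)"
      by (intro mod2_chain_add mod2_chain_diff c mod2_chain_boundary H mod2_chain_of b)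
    moreover have "singular_chain (p - Suc 0) (subtopology X U) (?D p a)"
      by (rule singular_chain_boundary [OF a])
    ultimately show "mod2_chain (p - Suc 0) (subtopology X U) S (?D p a)"
      using mod2_chain_subtopology by metis
  qed
qed

lemma singular_chain_compact_support:
  assumes "singular_chain p (subtopology X S) c"
  obtains N where "compactin X N" "N \<subseteq> S" "singular_chain p (subtopology X N) c"
proof
  let ?N = "\<Union>\<sigma>\<in>Poly_Mapping.keys c. \<sigma> ` standard_simplex p"
  have \<sigma>: "singular_simplex p X \<sigma>" "\<sigma> ` standard_simplex p \<subseteq> S" if "\<sigma> \<in> Poly_Mapping.keys c" for \<sigma>
    using assms that by (auto simp: singular_chain_def singular_simplex_subtopology subset_iff)
  have "compactin X (\<sigma> ` standard_simplex p)" if "\<sigma> \<in> Poly_Mapping.keys c" for \<sigma>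
  proof -
    have "continuous_map (subtopology (powertop_real UNIV) (standard_simplex p)) X \<sigma>"
      using \<sigma>(1) [OF that] by (simp add: singular_simplex_def)
    moreover have "compactin (subtopology (powertop_real UNIV) (standard_simplex p)) (standard_simplex p)"
      using compactin_standard_simplex by (simp add: compactin_subtopology)
    ultimately show ?thesis
      using image_compactin by blast
  qed
  then show "compactin X ?N"
    by (intro compactin_Union) auto
  show "?N \<subseteq> S"
    using \<sigma> by blast
  show "singular_chain p (subtopology X ?N) c"
    using \<sigma>(1) unfolding singular_chain_def subset_iff mem_Collect_eq singular_simplex_subtopology by blast
qed

text \<open>Universal coefficients: without 2-torsion one degree below, every cycle modulo 2 is the reduction of an
  integral cycle.\<close>

lemma mod2_cycle_lift:
  assumes c: "singular_chain p X c" "mod2_chain (p - Suc 0) X S (chain_boundary p c)"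
    and notor: "\<And>u. \<lbrakk>0 < p; singular_relcycle (p - Suc 0) X S u; singular_relboundary (p - Suc 0) X S (u + u)\<rbrakk>
        \<Longrightarrow> singular_relboundary (p - Suc 0) X S u"
  obtains z v where "singular_relcycle p X S z" "singular_chain p X v" "c = z + (v + v)"
proof (cases p)
  case 0
  show thesis
    by (rule that [of c 0]) (use c 0 in \<open>auto simp: singular_relcycle chain_boundary_def\<close>)
next
  case (Suc q)
  let ?D = chain_boundary
  obtain s u where s: "singular_chain q (subtopology X S) s" and u: "singular_chain q X u" and Dc: "?D p c = s + (u + u)"
    using c(2) Suc by (auto elim: mod2_chainE)
  have "?D q (?D (Suc q) c) = 0"
    using c(1) Suc chain_boundary_boundary [of "Suc q" X c] by simp
  then have "?D q u + ?D q u = - ?D q s"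
    using Dc Suc by (simp add: chain_boundary_add add_eq_0_iff)
  \<comment> \<open>Doubling does not change the support of a chain, so \<open>?D q u\<close> lies
    in \<open>S\<close> because its double does.\<close>
  then have "singular_chain (q - Suc 0) (subtopology X S) (?D q u)"
    using singular_chain_boundary [OF s] singular_chain_double_iff singular_chain_minus by metis
  then have "singular_relcycle q X S u"
    using u by (simp add: singular_relcycle)
  \<comment> \<open>\<open>c\<close> itself is the witness, its boundary being
    \<open>s + (u + u)\<close>.\<close>
  moreover have "singular_relboundary q X S (u + u)"
    unfolding singular_relboundary_alt
    by (rule exI [of _ c], rule exI [of _ s]) (use c Suc s Dc in auto)
  ultimately have "singular_relboundary q X S u"
    using notor Suc by simp
  then obtain v s' where v: "singular_chain (Suc q) X v" and s': "singular_chain q (subtopology X S) s'"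
    and ueq: "?D (Suc q) v = u + s'"
    unfolding singular_relboundary_alt by blast
  show thesis
  proof (rule that [of "c - (v + v)" v])
    have "?D p (c - (v + v)) = s - (s' + s')"
      using Dc ueq Suc by (simp add: chain_boundary_add chain_boundary_diff)
    then show "singular_relcycle p X S (c - (v + v))"
      using c(1) v s s' Suc by (auto simp: singular_relcycle intro!: singular_chain_diff singular_chain_add)
  qed (use v Suc in auto)
qed

section \<open>Homotopy invariance\<close>

abbreviation simplex_space :: "nat \<Rightarrow> (nat \<Rightarrow> real) topology" where
  "simplex_space p \<equiv> subtopology (powertop_real UNIV) (standard_simplex p)"

abbreviation simplex_id :: "nat \<Rightarrow> (nat \<Rightarrow> real) chain" where
  "simplex_id p \<equiv> frag_of (restrict id (standard_simplex p))"

text \<open>The identity is homotopic to a constant map, so \<open>c\<close> is homologous to a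
  cycle in a one-point space, where cycles of positive degree bound.\<close>

lemma contractible_cycle_is_boundary:
  assumes X: "contractible_space X" and c: "singular_relcycle p X {} c" and p: "0 < p"
  shows "singular_relboundary p X {} c"
proof (cases "topspace X = {}")
  case True
  then have "c = 0"
    using c by (simp add: singular_relcycle singular_chain_empty)
  then show ?thesis by simp
next
  case False
  obtain a where a: "homotopic_with (\<lambda>x. True) X X id (\<lambda>x. a)"
    using X by (auto simp: contractible_space_def)
  then have aX: "a \<in> topspace X"
    using False homotopic_with_imp_continuous_maps [OF a] by (auto simp: continuous_map_def)
  let ?b = "chain_map p (\<lambda>x. a) c"
  have "homotopic_with (\<lambda>h. h \<in> {} \<rightarrow> {}) X X id (\<lambda>x. a)"
    using a by simp
  from homotopic_imp_homologous_rel_chain_maps [OF this c]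
  have "singular_relboundary p X {} (chain_map p id c - ?b)"
    by (simp add: homologous_rel_def)
  moreover have "chain_map p id c = c"
    using c chain_map_ident unfolding singular_relcycle by blast
  ultimately have "singular_relboundary p X {} (c - ?b)"
    by simp
  moreover have "singular_relboundary p X {} ?b"
  proof -
    have "singular_relcycle p (subtopology X {a}) {} ?b"
      using c aX by (intro singular_relcycle_chain_map [of p X "{}"]) auto
    moreover have "topspace (subtopology X {a}) = {a}"
      using aX by auto
    ultimately have "singular_relboundary p (subtopology X {a}) {} ?b"
      using p singular_boundary_eq_cycle_singleton [of "subtopology X {a}" a p] by simp
    then show ?thesis
      unfolding singular_boundary using singular_chain_subtopologyD by blast
  qed
  ultimately have "singular_relboundary p X {} ((c - ?b) + ?b)"
    by (rule singular_relboundary_add)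
  then show ?thesis by simp
qed

lemma contractible_simplex_space: "contractible_space (simplex_space p)"
proof -
  let ?e = "\<lambda>i::nat. if i = 0 then 1 else (0::real)"
  let ?h = "\<lambda>(t, x). \<lambda>i. (1 - t) * x i + t * ?e i"
  have e: "?e \<in> standard_simplex p"
    using basis_in_standard_simplex [of 0 p] by (simp add: eq_commute)
  have h: "(\<lambda>i. (1 - t) * x i + t * ?e i) \<in> standard_simplex p" if "x \<in> standard_simplex p" "0 \<le> t" "t \<le> 1" for t x
    using convex_standard_simplex that e by blast
  have "continuous_map (prod_topology interval (simplex_space p)) euclideanreal (\<lambda>z. (1 - fst z) * snd z i + fst z * ?e i)" for i
  proof -
    have "continuous_map (prod_topology interval (simplex_space p)) euclideanreal fst"
      using continuous_map_fst [of interval "simplex_space p"] continuous_map_into_fulltopology by blast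
    moreover have "continuous_map (prod_topology interval (simplex_space p)) euclideanreal (\<lambda>z. snd z i)"
    proof -
      have "continuous_map (simplex_space p) euclideanreal (\<lambda>x. x i)"
        by (intro continuous_map_from_subtopology continuous_map_product_projection) auto
      from continuous_map_compose [OF continuous_map_snd this] show ?thesis
        by (simp add: o_def)
    qed
    ultimately show ?thesis
      by (intro continuous_intros) auto
  qed
  then have "continuous_map (prod_topology interval (simplex_space p)) (simplex_space p) ?h"
    using h by (auto simp: continuous_map_in_subtopology continuous_map_componentwise_UNIV case_prod_unfold)
  then have "homotopic_with (\<lambda>x. True) (simplex_space p) (simplex_space p) id (\<lambda>x. ?e)"
    unfolding homotopic_with_def by (intro exI [of _ ?h]) auto
  then show ?thesis
    unfolding contractible_space_def by blast
qed

text \<open>\<open>P\<close> is a model prism over the standard simplex, to be transported along the simplices of a chain.\<close>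

definition prism_op :: "(real \<times> 'a \<Rightarrow> 'b) \<Rightarrow> nat \<Rightarrow> (real \<times> (nat \<Rightarrow> real)) chain \<Rightarrow> 'a chain \<Rightarrow> 'b chain" where
  "prism_op h p P = frag_extend (\<lambda>\<sigma>. chain_map (Suc p) (\<lambda>(t, x). h (t, \<sigma> x)) P)"

lemma prism_op_0 [simp]: "prism_op h p P 0 = 0"
  by (simp add: prism_op_def)

lemma prism_op_diff: "prism_op h p P (a - b) = prism_op h p P a - prism_op h p P b"
  by (simp add: prism_op_def frag_extend_diff)

lemma prism_op_add: "prism_op h p P (a + b) = prism_op h p P a + prism_op h p P b"
  by (simp add: prism_op_def frag_extend_add)

lemma singular_chain_prism_op:
  assumes h: "continuous_map (prod_topology interval X) Y h"
    and P: "singular_chain (Suc p) (prod_topology interval (simplex_space p)) P"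
    and c: "singular_chain p X c"
  shows "singular_chain (Suc p) Y (prism_op h p P c)"
  unfolding prism_op_def
proof (rule singular_chain_extend)
  fix \<sigma> assume "\<sigma> \<in> Poly_Mapping.keys c"
  then have \<sigma>: "continuous_map (simplex_space p) X \<sigma>"
    using c by (auto simp: singular_chain_def singular_simplex_def)
  have "continuous_map (prod_topology interval (simplex_space p)) (prod_topology interval X) (\<lambda>(t, x). (t, \<sigma> x))"
    unfolding case_prod_unfold continuous_map_pairwise o_def fst_conv snd_conv
    using continuous_map_fst continuous_map_compose [OF continuous_map_snd \<sigma>] by (auto simp: o_def)
  from continuous_map_compose [OF this h]
  have "continuous_map (prod_topology interval (simplex_space p)) Y (\<lambda>(t, x). h (t, \<sigma> x))"
    by (simp add: o_def case_prod_unfold)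
  then show "singular_chain (Suc p) Y (chain_map (Suc p) (\<lambda>(t, x). h (t, \<sigma> x)) P)"
    by (rule singular_chain_chain_map [OF P])
qed

text \<open>Naturality: prisms over \<open>\<tau>\<close> carried along \<open>\<sigma>\<close> are
  prisms over the composite. It reduces identities for arbitrary simplices to the standard
  one.\<close>

lemma prism_op_chain_map:
  assumes P: "singular_chain (Suc q) (prod_topology interval (simplex_space q)) P"
    and d: "singular_chain q (simplex_space p) d"
  shows "chain_map (Suc q) (\<lambda>(t, x). h (t, \<sigma> x)) (prism_op id q P d) = prism_op h q P (chain_map q \<sigma> d)"
  using d unfolding singular_chain_def
proof (induction d rule: frag_induction)
  case zero
  then show ?case by simp
next
  case (one \<tau>)
  let ?g = "\<lambda>(t, x). h (t, \<sigma> x)" and ?f = "\<lambda>(t, x). id (t, \<tau> x)"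
  have "chain_map (Suc q) ?g (prism_op id q P (frag_of \<tau>)) = chain_map (Suc q) (?g \<circ> ?f) P"
    by (simp add: prism_op_def chain_map_compose)
  also have "\<dots> = chain_map (Suc q) (\<lambda>(t, x). h (t, simplex_map q \<sigma> \<tau> x)) P"
    by (rule chain_map_eq [OF P]) (auto simp: simplex_map_def)
  also have "\<dots> = prism_op h q P (chain_map q \<sigma> (frag_of \<tau>))"
    by (simp add: prism_op_def)
  finally show ?case .
next
  case (diff a b)
  then show ?case
    by (simp add: prism_op_diff chain_map_diff)
qed

text \<open>Top minus bottom minus sides, where the sides are copies of the lower model
  \<open>P'\<close> over the faces of the simplex.\<close>

definition prism_formula :: "nat \<Rightarrow> (real \<times> (nat \<Rightarrow> real)) chain \<Rightarrow> (real \<times> (nat \<Rightarrow> real)) chain \<Rightarrow> bool" where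
  "prism_formula p P P' \<longleftrightarrow> singular_chain (Suc p) (prod_topology interval (simplex_space p)) P \<and>
     (0 < p \<longrightarrow> singular_chain p (prod_topology interval (simplex_space (p - Suc 0))) P') \<and>
     chain_boundary (Suc p) P = chain_map p (Pair 1) (simplex_id p) - chain_map p (Pair 0) (simplex_id p)
        - prism_op id (p - Suc 0) P' (chain_boundary p (simplex_id p))"

lemma singular_chain_simplex_id: "singular_chain p (simplex_space p) (simplex_id p)"
  by (auto simp: singular_chain_of singular_simplex_def intro: continuous_map_eq [of _ _ id])

text \<open>By naturality it is enough to know the identity for the identity simplex, where it is
  \<open>prism_formula\<close>. It has to hold for all chains, because a cycle modulo 2 may have a
  boundary that is twice a chain.\<close>

lemma chain_boundary_prism_op:
  assumes PP: "prism_formula p P P'" and c: "singular_chain p X c"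
  shows "chain_boundary (Suc p) (prism_op h p P c) + prism_op h (p - Suc 0) P' (chain_boundary p c)
       = chain_map p (\<lambda>x. h (1, x)) c - chain_map p (\<lambda>x. h (0, x)) c"
  using c unfolding singular_chain_def
proof (induction c rule: frag_induction)
  case zero
  then show ?case by simp
next
  case (one \<sigma>)
  then have \<sigma>: "singular_simplex p X \<sigma>" by simp
  have P: "singular_chain (Suc p) (prod_topology interval (simplex_space p)) P"
    and P': "0 < p \<Longrightarrow> singular_chain p (prod_topology interval (simplex_space (p - Suc 0))) P'"
    and DP: "chain_boundary (Suc p) P = chain_map p (Pair 1) (simplex_id p) - chain_map p (Pair 0) (simplex_id p)
        - prism_op id (p - Suc 0) P' (chain_boundary p (simplex_id p))"
    using PP by (auto simp: prism_formula_def)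
  let ?g = "\<lambda>(t, x). h (t, \<sigma> x)"
  have \<sigma>ext: "restrict \<sigma> (standard_simplex p) = \<sigma>"
    using \<sigma> by (simp add: singular_simplex_def extensional_restrict)
  have ends: "chain_map p ?g (chain_map p (Pair t) (simplex_id p)) = chain_map p (\<lambda>x. h (t, x)) (frag_of \<sigma>)" for t
  proof -
    have "simplex_map p ?g (simplex_map p (Pair t) (restrict id (standard_simplex p))) = simplex_map p (\<lambda>x. h (t, x)) \<sigma>"
      by (auto simp: simplex_map_def)
    then show ?thesis by simp
  qed
  have "chain_map p \<sigma> (simplex_id p) = frag_of \<sigma>"
    using \<sigma>ext by (simp add: simplex_map_def restrict_def o_def cong: if_cong)
  then have D\<sigma>: "chain_map (p - Suc 0) \<sigma> (chain_boundary p (simplex_id p)) = chain_boundary p (frag_of \<sigma>)"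
    using chain_boundary_chain_map [OF singular_chain_simplex_id, of p \<sigma>] by simp
  have face: "chain_map p ?g (prism_op id (p - Suc 0) P' (chain_boundary p (simplex_id p)))
      = prism_op h (p - Suc 0) P' (chain_boundary p (frag_of \<sigma>))"
  proof (cases p)
    case 0
    then show ?thesis by (simp add: chain_boundary_def)
  next
    case (Suc q)
    then show ?thesis
      using prism_op_chain_map [of q P' p "chain_boundary p (simplex_id p)" h \<sigma>] P' D\<sigma>
        singular_chain_boundary [OF singular_chain_simplex_id [of p]] by simp
  qed
  have "chain_boundary (Suc p) (prism_op h p P (frag_of \<sigma>)) = chain_boundary (Suc p) (chain_map (Suc p) ?g P)"
    by (simp add: prism_op_def)
  also have "\<dots> = chain_map p ?g (chain_boundary (Suc p) P)"
    using chain_boundary_chain_map [OF P, of ?g] by simp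
  also have "\<dots> = chain_map p (\<lambda>x. h (1, x)) (frag_of \<sigma>) - chain_map p (\<lambda>x. h (0, x)) (frag_of \<sigma>)
      - prism_op h (p - Suc 0) P' (chain_boundary p (frag_of \<sigma>))"
    unfolding DP chain_map_diff face ends ..
  finally show ?case by simp
next
  case (diff a b)
  let ?L = "\<lambda>c. chain_boundary (Suc p) (prism_op h p P c) + prism_op h (p - Suc 0) P' (chain_boundary p c)"
  have "?L (a - b) = ?L a - ?L b"
    by (simp add: prism_op_diff chain_boundary_diff)
  with diff show ?case
    by (simp add: chain_map_diff)
qed

text \<open>Acyclic models: the prescribed boundary of the next prism is a cycle, by the formula one
  dimension lower, and it bounds since the prism over a simplex is contractible. In dimension 0 path
  connectedness supplies the segment.\<close>

lemma prism_models_exist: "\<exists>P. \<forall>p. prism_formula p (P p) (P (p - Suc 0))"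
proof -
  \<comment> \<open>The invariant remembers that each model satisfies the formula with some lower
    model; that is what makes the next prescribed boundary a cycle.\<close>
  have "\<exists>P. \<forall>p. (\<exists>P'. prism_formula p (P p) P') \<and> prism_formula (Suc p) (P (Suc p)) (P p)"
  proof (rule dependent_nat_choice)
    let ?X = "prod_topology interval (simplex_space 0)"
    let ?s = "\<lambda>t. simplex_map 0 (Pair t) (restrict id (standard_simplex 0))"
    have "contractible_space ?X"
      by (simp add: contractible_space_prod_topology contractible_simplex_space convex_imp_contractible)
    then have "path_connected_space ?X"
      by (rule contractible_imp_path_connected_space)
    moreover have "singular_simplex 0 ?X (?s t)" if "t \<in> {0..1}" for t
    proof -
      have "continuous_map (simplex_space 0) ?X (Pair t)"
        using that unfolding continuous_map_pairwise o_def fst_conv snd_conv by auto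
      then show ?thesis
        using singular_chain_simplex_id [of 0] by (intro singular_simplex_simplex_map) (auto simp: singular_chain_of)
    qed
    ultimately have "homologous_rel 0 ?X {} (frag_of (?s 1)) (frag_of (?s 0))"
      by (intro iso_integer_zeroth_homology_group_aux) auto
    then obtain P where "singular_chain (Suc 0) ?X P" "chain_boundary (Suc 0) P = frag_of (?s 1) - frag_of (?s 0)"
      unfolding homologous_rel_def singular_boundary by blast
    then show "\<exists>P. \<exists>P'. prism_formula 0 P P'"
      unfolding prism_formula_def by (intro exI [of _ P]) (simp add: chain_boundary_def)
  next
    fix P p assume "\<exists>P'. prism_formula p P P'"
    then obtain P' where PP: "prism_formula p P P'" by blast
    let ?X = "prod_topology interval (simplex_space (Suc p))" and ?i = "simplex_id (Suc p)"
    let ?d = "chain_boundary (Suc p) ?i"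
    have d: "singular_chain p (simplex_space (Suc p)) ?d"
      using singular_chain_boundary [OF singular_chain_simplex_id [of "Suc p"]] by simp
    have P: "singular_chain (Suc p) (prod_topology interval (simplex_space p)) P"
      using PP by (simp add: prism_formula_def)
    define z where "z = chain_map (Suc p) (Pair 1) ?i - chain_map (Suc p) (Pair 0) ?i - prism_op id p P ?d"
    have cp: "continuous_map (simplex_space (Suc p)) ?X (Pair t)" if "t \<in> {0..1}" for t
      using that unfolding continuous_map_pairwise o_def fst_conv snd_conv by auto
    have zc: "singular_chain (Suc p) ?X z"
      unfolding z_def
      by (intro singular_chain_diff singular_chain_chain_map [OF singular_chain_simplex_id] cp
          singular_chain_prism_op [OF _ P d]) auto
    have "chain_boundary p ?d = 0"
      using chain_boundary_boundary [OF singular_chain_simplex_id [of "Suc p"]] by simp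
    then have "chain_boundary (Suc p) (prism_op id p P ?d) = chain_map p (Pair 1) ?d - chain_map p (Pair 0) ?d"
      using chain_boundary_prism_op [OF PP d, of id] by simp
    moreover have "chain_boundary (Suc p) (chain_map (Suc p) (Pair t) ?i) = chain_map p (Pair t) ?d" for t :: real
      using chain_boundary_chain_map [OF singular_chain_simplex_id [of "Suc p"], of "Pair t"]
      by (simp del: chain_map_of)
    ultimately have "chain_boundary (Suc p) z = 0"
      unfolding z_def chain_boundary_diff by (simp del: chain_map_of)
    then have "singular_relcycle (Suc p) ?X {} z"
      using zc by (simp add: singular_cycle)
    moreover have "contractible_space ?X"
      by (simp add: contractible_space_prod_topology contractible_simplex_space convex_imp_contractible)
    ultimately have "singular_relboundary (Suc p) ?X {} z"
      by (intro contractible_cycle_is_boundary) auto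
    then obtain Q where Q: "singular_chain (Suc (Suc p)) ?X Q" "chain_boundary (Suc (Suc p)) Q = z"
      unfolding singular_boundary by blast
    then have "prism_formula (Suc p) Q P"
      unfolding prism_formula_def using P by (simp add: z_def)
    then show "\<exists>Q. (\<exists>P'. prism_formula (Suc p) Q P') \<and> prism_formula (Suc p) Q P"
      by blast
  qed
  then obtain P where P: "\<And>p. \<exists>P'. prism_formula p (P p) P'" "\<And>p. prism_formula (Suc p) (P (Suc p)) (P p)"
    by blast
  have "prism_formula p (P p) (P (p - Suc 0))" for p
  proof (cases p)
    case 0
    then show ?thesis
      using P(1) [of 0] by (auto simp: prism_formula_def chain_boundary_def)
  next
    case (Suc q)
    then show ?thesis using P(2) by simp
  qed
  then show ?thesis by blast
qed

text \<open>The chain homotopy writes the difference as a boundary plus the prism over the boundary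
  of \<open>c\<close>; the latter lies in \<open>T\<close> modulo 2, since \<open>h\<close> keeps
  \<open>S\<close> in \<open>T\<close> at all times.\<close>

lemma mod2_null_homotopy:
  assumes h: "continuous_map (prod_topology interval X) Y h"
    and hT: "\<And>t x. \<lbrakk>t \<in> {0..1}; x \<in> topspace X; x \<in> S\<rbrakk> \<Longrightarrow> h (t, x) \<in> T"
    and c: "singular_chain p X c" "mod2_chain (p - Suc 0) X S (chain_boundary p c)"
  shows "mod2_null p Y T (chain_map p (\<lambda>x. h (1, x)) c - chain_map p (\<lambda>x. h (0, x)) c)"
proof -
  obtain P where P: "\<And>p. prism_formula p (P p) (P (p - Suc 0))"
    using prism_models_exist by blast
  have Pc: "singular_chain (Suc p) (prod_topology interval (simplex_space p)) (P p)" for p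
    using P [of p] by (simp add: prism_formula_def)
  have hS: "continuous_map (prod_topology interval (subtopology X S)) (subtopology Y T) h"
  proof -
    have "prod_topology interval (subtopology X S) = subtopology (prod_topology interval X) ({0..1} \<times> S)"
      using subtopology_Times [of interval X "{0..1}" S] by (simp add: subtopology_subtopology)
    moreover have "continuous_map (subtopology (prod_topology interval X) ({0..1} \<times> S)) Y h"
      by (rule continuous_map_from_subtopology [OF h])
    ultimately show ?thesis
      using hT by (auto simp: continuous_map_in_subtopology)
  qed
  let ?d = "chain_boundary p c"
  have "mod2_chain p Y T (prism_op h (p - Suc 0) (P (p - Suc 0)) ?d)"
  proof (cases p)
    case 0
    then show ?thesis by (simp add: chain_boundary_def)
  next
    case (Suc q)
    obtain s u where s: "singular_chain q (subtopology X S) s" and u: "singular_chain q X u" and d: "?d = s + (u + u)"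
      using c(2) Suc by (auto elim: mod2_chainE)
    have "mod2_chain (Suc q) Y T (prism_op h q (P q) s + (prism_op h q (P q) u + prism_op h q (P q) u))"
      by (intro mod2_chain_add [OF mod2_chain_of mod2_chain_double] singular_chain_prism_op [OF hS Pc s]
          singular_chain_prism_op [OF h Pc u])
    then show ?thesis
      using Suc unfolding d prism_op_add by simp
  qed
  then have "mod2_null p Y T (chain_boundary (Suc p) (prism_op h p (P p) c) + prism_op h (p - Suc 0) (P (p - Suc 0)) ?d)"
    by (intro mod2_null_add mod2_nullI mod2_null_boundary singular_chain_prism_op [OF h Pc c(1)])
  then show ?thesis
    unfolding chain_boundary_prism_op [OF P c(1)] .
qed

section \<open>Local homology modulo 2\<close>

definition north :: "nat \<Rightarrow> nat \<Rightarrow> real" where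
  "north n = (\<lambda>i. if i = n then 1 else 0)"

lemma north_in_nsphere: "north n \<in> topspace (nsphere n)"
  by (simp add: topspace_nsphere north_def if_distrib [of "\<lambda>x. x\<^sup>2"] cong: if_cong)

lemma nsphere_sum_eq: "v \<in> topspace (nsphere n) \<longleftrightarrow> (\<Sum>i<n. (v i)\<^sup>2) + (v n)\<^sup>2 = 1 \<and> (\<forall>i>n. v i = 0)"
  by (simp add: topspace_nsphere flip: lessThan_Suc_atMost)

lemma nsphere_eq_north:
  assumes "v \<in> topspace (nsphere n)" "v n = 1"
  shows "v = north n"
proof -
  have "(\<Sum>i<n. (v i)\<^sup>2) = 0"
    using assms by (simp add: nsphere_sum_eq)
  then have "v i = 0" if "i < n" for i
    using that by (simp add: sum_nonneg_eq_0_iff)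
  then show ?thesis
    using assms by (auto simp: north_def fun_eq_iff nsphere_sum_eq) (metis linorder_neqE_nat)
qed

text \<open>\<open>f\<close> is inverse stereographic projection from \<open>north n\<close>, with
  \<open>s u\<close> the squared norm of \<open>u\<close>; \<open>g\<close> is the projection,
  dividing by the height \<open>1 - v n\<close> below the pole.\<close>

lemma stereographic_projection:
  "Euclidean_space n homeomorphic_space subtopology (nsphere n) (topspace (nsphere n) - {north n})"
proof -
  let ?X = "Euclidean_space n" and ?Y = "subtopology (nsphere n) (topspace (nsphere n) - {north n})"
  define s where "s = (\<lambda>u::nat\<Rightarrow>real. \<Sum>i<n. (u i)\<^sup>2)"
  define f where "f = (\<lambda>u i. if i < n then 2 * u i / (1 + s u) else if i = n then (s u - 1) / (1 + s u) else 0)"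
  define g where "g = (\<lambda>v i. if i < n then v i / (1 - v n) else (0::real))"
  have s0: "s u \<ge> 0" for u
    by (simp add: s_def sum_nonneg)
  then have s1: "1 + s u \<noteq> 0" for u
    by (metis add_nonneg_pos less_irrefl zero_less_one add.commute)
  have fs: "(\<Sum>i<n. (f u i)\<^sup>2) = 4 * s u / (1 + s u)\<^sup>2" for u
    by (simp add: f_def s_def power_divide power_mult_distrib sum_distrib_left flip: sum_divide_distrib)
  have fS: "f u \<in> topspace (nsphere n)" for u
  proof -
    have "4 * s u / (1 + s u)\<^sup>2 + ((s u - 1) / (1 + s u))\<^sup>2 = 1"
      using s1 [of u] by (simp add: power_divide divide_simps) (simp add: power2_eq_square algebra_simps)
    then have "(\<Sum>i<n. (f u i)\<^sup>2) + (f u n)\<^sup>2 = 1"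
      unfolding fs by (simp add: f_def)
    then show ?thesis
      unfolding nsphere_sum_eq by (simp add: f_def)
  qed
  have fN: "f u \<noteq> north n" for u
  proof
    assume "f u = north n"
    then have "(s u - 1) / (1 + s u) = 1"
      by (metis f_def less_irrefl north_def)
    then show False
      using s1 [of u] by (simp add: divide_simps)
  qed
  have vn: "v n \<noteq> 1" if "v \<in> topspace ?Y" for v
    using that nsphere_eq_north by auto
  have cs: "continuous_map ?X euclideanreal s"
    unfolding s_def by (intro continuous_intros continuous_map_Euclidean_space_coordinate) auto
  have "continuous_map ?X euclideanreal (\<lambda>u. f u i)" for i
    using s1 by (cases "i < n"; cases "i = n")
      (auto simp: f_def intro!: continuous_intros cs continuous_map_Euclidean_space_coordinate)
  then have cf: "continuous_map ?X ?Y f"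
    using fS fN by (auto simp: continuous_map_in_subtopology continuous_map_nsphere_iff)
  have coord: "continuous_map ?Y euclideanreal (\<lambda>v. v i)" for i
    by (intro continuous_map_from_subtopology continuous_map_nsphere_projection)
  have cgi: "continuous_map ?Y euclideanreal (\<lambda>v. g v i)" if "i < n" for i
    using vn that by (auto simp: g_def intro!: continuous_intros coord)
  have cg: "continuous_map ?Y ?X g"
    unfolding continuous_map_into_Euclidean_space_iff
  proof (intro conjI allI impI)
    show "g \<in> topspace ?Y \<rightarrow> topspace ?X"
      by (auto simp: topspace_Euclidean_space g_def)
  qed (rule cgi)
  have gf: "g (f u) = u" if "u \<in> topspace ?X" for u
  proof
    fix i
    have "1 - (s u - 1) / (1 + s u) = 2 / (1 + s u)"
      using s1 [of u] by (simp add: field_simps)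
    then show "g (f u) i = u i"
      using that s1 [of u] by (auto simp: g_def f_def topspace_Euclidean_space)
  qed
  have fg: "f (g v) = v" if v: "v \<in> topspace ?Y" for v
  proof
    fix i
    have sv: "(\<Sum>i<n. (v i)\<^sup>2) = 1 - (v n)\<^sup>2"
      using v by (simp add: nsphere_sum_eq)
    have n1: "1 - v n \<noteq> 0"
      using vn [OF v] by simp
    have "s (g v) = (\<Sum>i<n. (v i)\<^sup>2) / (1 - v n)\<^sup>2"
      by (simp add: s_def g_def power_divide flip: sum_divide_distrib)
    also have "\<dots> = (1 + v n) / (1 - v n)"
      unfolding sv using n1 by (simp add: divide_simps power2_eq_square) (simp add: algebra_simps)
    finally have sg: "s (g v) = (1 + v n) / (1 - v n)" .
    have "1 + s (g v) = 2 / (1 - v n)" "s (g v) - 1 = 2 * v n / (1 - v n)"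
      unfolding sg using n1 by (simp_all add: field_simps)
    then show "f (g v) i = v i"
      using n1 v by (auto simp: f_def nsphere_sum_eq) (auto simp: g_def)
  qed
  have "homeomorphic_maps ?X ?Y f g"
    unfolding homeomorphic_maps_def using cf cg gf fg by blast
  then show ?thesis
    unfolding homeomorphic_space_def by blast
qed

text \<open>For \<open>p\<close> other than the pole, \<open>r\<close> is the reflection in the
  hyperplane orthogonal to \<open>p - north n\<close>, a linear isometric involution that exchanges
  the two points. So the choice of puncture is immaterial.\<close>

lemma nsphere_reflection_to_north:
  assumes p: "p \<in> topspace (nsphere n)"
  obtains r where "homeomorphic_maps (nsphere n) (nsphere n) r r" "r (north n) = p"
proof (cases "p = north n")
  case True
  then show thesis
    using that [of id] homeomorphic_maps_id by auto
next
  case False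
  define w where "w = (\<lambda>i. p i - north n i)"
  define ip where "ip = (\<lambda>u v::nat\<Rightarrow>real. \<Sum>i\<le>n. u i * v i)"
  define r where "r = (\<lambda>v i. v i - 2 * ip v w / ip w w * w i)"
  have r_app: "r v = (\<lambda>i. v i - 2 * ip v w / ip w w * w i)" for v
    by (simp add: r_def)
  have pn: "p n \<noteq> 1"
    using nsphere_eq_north [OF p] False by blast
  have ipN: "ip v (north n) = v n" for v
    by (simp add: ip_def north_def if_distrib cong: if_cong)
  have lin: "ip (\<lambda>i. a i - c * b i) d = ip a d - c * ip b d" for a b c d
    by (simp add: ip_def left_diff_distrib sum_subtractf sum_distrib_left mult.assoc)
  have sym: "ip a b = ip b a" for a b
    by (simp add: ip_def mult.commute)
  have ipp: "ip p p = 1" and ipNN: "ip (north n) (north n) = 1"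
    using p north_in_nsphere [of n] by (simp_all add: topspace_nsphere ip_def power2_eq_square)
  have ipw: "ip w d = ip p d - ip (north n) d" for d
    using lin [of p 1 "north n" d] by (simp add: w_def)
  have wN: "ip (north n) w = p n - 1"
    unfolding sym [of "north n" w] ipN by (simp add: w_def north_def)
  have "ip p w = 1 - p n"
    unfolding sym [of p w] ipw ipp sym [of "north n" p] ipN ..
  then have ww: "ip w w = 2 - 2 * p n"
    unfolding ipw [of w] wN by simp
  have ww0: "ip w w \<noteq> 0"
    using ww pn by simp
  have rw: "ip (r v) w = - ip v w" for v
    unfolding r_app [of v] lin using ww0 by simp
  have rr: "r (r v) = v" for v
  proof
    fix i
    show "r (r v) i = v i"
      unfolding r_app [of "r v"] rw by (simp add: r_app)
  qed
  have rip: "ip (r v) (r v) = ip v v" for v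
  proof -
    have "ip (r v) (r v) = ip v (r v) - 2 * ip v w / ip w w * ip w (r v)"
      unfolding r_app [of v] lin by simp
    also have "ip v (r v) = ip v v - 2 * ip v w / ip w w * ip v w"
      unfolding sym [of v "r v"] unfolding r_app [of v] lin by (simp add: sym)
    also have "ip w (r v) = - ip v w"
      using rw sym by metis
    finally show ?thesis by simp
  qed
  have cr: "continuous_map (nsphere n) (nsphere n) r"
    unfolding continuous_map_nsphere_iff
  proof (intro conjI allI impI)
    show "continuous_map (nsphere n) euclideanreal (\<lambda>v. r v i)" for i
      unfolding r_def ip_def using ww0 unfolding ip_def
      by (intro continuous_intros continuous_map_nsphere_projection) auto
    show "r \<in> topspace (nsphere n) \<rightarrow> topspace (nsphere n)"
    proof
      fix v assume v: "v \<in> topspace (nsphere n)"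
      then have "ip v v = 1"
        by (simp add: topspace_nsphere ip_def power2_eq_square)
      then have "ip (r v) (r v) = 1"
        using rip by simp
      moreover have "r v i = 0" if "i > n" for i
        using v p that by (simp add: r_def w_def north_def topspace_nsphere)
      ultimately show "r v \<in> topspace (nsphere n)"
        by (simp add: topspace_nsphere ip_def power2_eq_square)
    qed
  qed
  have "r (north n) = p"
  proof
    fix i
    have "2 * (p n - 1) / (2 - 2 * p n) = -1"
      using pn by (simp add: field_simps)
    then show "r (north n) i = p i"
      unfolding r_app wN ww by (simp only:) (simp add: w_def)
  qed
  moreover have "homeomorphic_maps (nsphere n) (nsphere n) r r"
    unfolding homeomorphic_maps_def using cr rr by blast
  ultimately show thesis using that by blast
qed

lemma nsphere_punctured_homeomorphic:
  assumes p: "p \<in> topspace (nsphere n)"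
  shows "Euclidean_space n homeomorphic_space subtopology (nsphere n) (topspace (nsphere n) - {p})"
proof -
  obtain r where r: "homeomorphic_maps (nsphere n) (nsphere n) r r" "r (north n) = p"
    by (rule nsphere_reflection_to_north [OF p])
  have rr: "r (r v) = v" "r v \<in> topspace (nsphere n)" if "v \<in> topspace (nsphere n)" for v
    using r(1) that by (auto simp: homeomorphic_maps_def continuous_map_def)
  have h: "homeomorphic_map (nsphere n) (nsphere n) r"
    using r homeomorphic_maps_map by blast
  have "r ` (topspace (nsphere n) \<inter> (topspace (nsphere n) - {north n})) = topspace (nsphere n) \<inter> (topspace (nsphere n) - {p})"
  proof (intro equalityI subsetI)
    fix y assume y: "y \<in> topspace (nsphere n) \<inter> (topspace (nsphere n) - {p})"
    then have "r y \<noteq> north n"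
      using r(2) rr by force
    then show "y \<in> r ` (topspace (nsphere n) \<inter> (topspace (nsphere n) - {north n}))"
      using y rr by (intro image_eqI [of _ _ "r y"]) auto
  next
    fix y assume "y \<in> r ` (topspace (nsphere n) \<inter> (topspace (nsphere n) - {north n}))"
    then obtain v where v: "v \<in> topspace (nsphere n)" "v \<noteq> north n" "y = r v" by auto
    then have "y \<noteq> p"
      using r(2) rr(1) [OF v(1)] rr(1) [OF north_in_nsphere] by metis
    then show "y \<in> topspace (nsphere n) \<inter> (topspace (nsphere n) - {p})"
      using v rr by auto
  qed
  from homeomorphic_map_subtopologies [OF h this]
  show ?thesis
    using stereographic_projection homeomorphic_space_trans homeomorphic_map_imp_homeomorphic_space by blast
qed

section \<open>Invariance of local homology under homeomorphisms and open restriction\<close>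

definition mod2_cycle :: "nat \<Rightarrow> 'a topology \<Rightarrow> 'a set \<Rightarrow> 'a chain \<Rightarrow> bool" where
  "mod2_cycle p X S c \<longleftrightarrow> singular_chain p X c \<and> mod2_chain (p - Suc 0) X S (chain_boundary p c)"

text \<open>The local homology of \<open>X\<close> at \<open>x\<close> modulo 2 is that of an \<open>n\<close>-manifold.\<close>

definition local_Z2 :: "nat \<Rightarrow> 'a topology \<Rightarrow> 'a \<Rightarrow> bool" where
  "local_Z2 n X x \<longleftrightarrow>
     (\<forall>p>n. \<forall>c. mod2_cycle p X (- {x}) c \<longrightarrow> mod2_null p X (- {x}) c) \<and>
     (\<exists>c. mod2_cycle n X (- {x}) c \<and> \<not> mod2_null n X (- {x}) c) \<and>
     (\<forall>c d. mod2_cycle n X (- {x}) c \<and> \<not> mod2_null n X (- {x}) c \<and>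
        mod2_cycle n X (- {x}) d \<and> \<not> mod2_null n X (- {x}) d \<longrightarrow> mod2_null n X (- {x}) (c - d))"

lemma local_Z2_diff:
  assumes "local_Z2 n X x" "mod2_cycle n X (- {x}) c" "\<not> mod2_null n X (- {x}) c"
    "mod2_cycle n X (- {x}) d" "\<not> mod2_null n X (- {x}) d"
  shows "mod2_null n X (- {x}) (c - d)"
  using assms by (simp add: local_Z2_def)

lemma mod2_chain_restrict: "mod2_chain p X (topspace X \<inter> S) c \<longleftrightarrow> mod2_chain p X S c"
proof -
  have "subtopology X (topspace X \<inter> S) = subtopology X S"
    by (metis subtopology_subtopology subtopology_topspace)
  then show ?thesis
    by (simp add: mod2_chain_def)
qed

lemma mod2_restrict_Diff:
  "mod2_chain p X (topspace X - K) c \<longleftrightarrow> mod2_chain p X (- K) c"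
  "mod2_null p X (topspace X - K) c \<longleftrightarrow> mod2_null p X (- K) c"
  "mod2_cycle p X (topspace X - K) c \<longleftrightarrow> mod2_cycle p X (- K) c"
  using mod2_chain_restrict [of _ X "- K"] by (simp_all add: Diff_eq mod2_null_def mod2_cycle_def)

lemma mod2_cycle_mono: "\<lbrakk>mod2_cycle p X S c; S \<subseteq> T\<rbrakk> \<Longrightarrow> mod2_cycle p X T c"
  unfolding mod2_cycle_def using mod2_chain_mono by blast

lemma mod2_cycle_diff: "\<lbrakk>mod2_cycle p X S c; mod2_cycle p X S d\<rbrakk> \<Longrightarrow> mod2_cycle p X S (c - d)"
  unfolding mod2_cycle_def by (simp add: chain_boundary_diff mod2_chain_diff singular_chain_diff)

lemma mod2_cycle_chain_map:
  assumes c: "mod2_cycle p X S c" and h: "continuous_map X Y h" "h \<in> topspace X \<inter> S \<rightarrow> T"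
  shows "mod2_cycle p Y T (chain_map p h c)"
  using c mod2_chain_chain_map [of "p - Suc 0" X S "chain_boundary p c" Y h T, OF _ h] singular_chain_chain_map [OF _ h(1)]
  unfolding mod2_cycle_def by (auto simp: chain_boundary_chain_map)

lemma mod2_cycle_from_subtopology: "mod2_cycle p (subtopology X U) S c \<Longrightarrow> mod2_cycle p X S c"
  unfolding mod2_cycle_def using mod2_chain_from_subtopology singular_chain_subtopologyD by blast

lemma chain_map_inverse:
  assumes "homeomorphic_maps X Y f g" "singular_chain p X c"
  shows "chain_map p g (chain_map p f c) = c"
proof -
  have "chain_map p g (chain_map p f c) = chain_map p (g \<circ> f) c"
    by (simp add: chain_map_compose)
  also have "\<dots> = c"
    using assms by (intro chain_map_id_gen [of p X]) (auto simp: homeomorphic_maps_def)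
  finally show ?thesis .
qed

lemma local_Z2_homeomorphic:
  assumes h: "homeomorphic_maps X Y f g" and x: "x \<in> topspace X" and L: "local_Z2 n X x"
  shows "local_Z2 n Y (f x)"
proof -
  have h': "homeomorphic_maps Y X g f"
    using h by (rule homeomorphic_maps_sym [THEN iffD1])
  have cf: "continuous_map X Y f" and cg: "continuous_map Y X g"
    using h by (auto simp: homeomorphic_maps_def)
  have fS: "f \<in> topspace X \<inter> - {x} \<rightarrow> - {f x}"
  proof
    fix y assume y: "y \<in> topspace X \<inter> - {x}"
    then have "g (f y) = y" "g (f x) = x"
      using h x by (auto simp: homeomorphic_maps_def)
    then show "f y \<in> - {f x}"
      using y by auto
  qed
  have gS: "g \<in> topspace Y \<inter> - {f x} \<rightarrow> - {x}"
  proof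
    fix y assume y: "y \<in> topspace Y \<inter> - {f x}"
    then have "f (g y) = y"
      using h by (auto simp: homeomorphic_maps_def)
    then show "g y \<in> - {x}"
      using y by auto
  qed
  have cycg: "mod2_cycle p X (- {x}) (chain_map p g c)" if "mod2_cycle p Y (- {f x}) c" for p c
    by (rule mod2_cycle_chain_map [OF that cg gS])
  have nulf: "mod2_null p Y (- {f x}) c" if "mod2_null p X (- {x}) (chain_map p g c)" "singular_chain p Y c" for p c
    using mod2_null_chain_map [OF that(1) cf fS] chain_map_inverse [OF h' that(2)] by simp
  have nulg: "mod2_null p X (- {x}) c" if "mod2_null p Y (- {f x}) (chain_map p f c)" "singular_chain p X c" for p c
    using mod2_null_chain_map [OF that(1) cg gS] chain_map_inverse [OF h that(2)] by simp
  show ?thesis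
    unfolding local_Z2_def
  proof (intro conjI allI impI)
    fix p c assume "n < p" and c: "mod2_cycle p Y (- {f x}) c"
    then have "mod2_null p X (- {x}) (chain_map p g c)"
      using L cycg unfolding local_Z2_def by blast
    then show "mod2_null p Y (- {f x}) c"
      using nulf c unfolding mod2_cycle_def by blast
  next
    obtain c where c: "mod2_cycle n X (- {x}) c" "\<not> mod2_null n X (- {x}) c"
      using L unfolding local_Z2_def by blast
    then show "\<exists>c. mod2_cycle n Y (- {f x}) c \<and> \<not> mod2_null n Y (- {f x}) c"
      using mod2_cycle_chain_map [OF c(1) cf fS] nulg unfolding mod2_cycle_def by blast
  next
    fix c d assume cd: "mod2_cycle n Y (- {f x}) c \<and> \<not> mod2_null n Y (- {f x}) c \<and>
       mod2_cycle n Y (- {f x}) d \<and> \<not> mod2_null n Y (- {f x}) d"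
    then have s: "singular_chain n Y c" "singular_chain n Y d"
      by (auto simp: mod2_cycle_def)
    have "mod2_null n X (- {x}) (chain_map n g c - chain_map n g d)"
      using cd nulf s by (intro local_Z2_diff [OF L] cycg) auto
    then show "mod2_null n Y (- {f x}) (c - d)"
      using nulf s by (simp add: chain_map_diff singular_chain_diff)
  qed
qed

lemma mod2_null_excise_point:
  assumes U: "openin X U" "x \<in> U" and x: "closedin X {x}"
    and c: "singular_chain p (subtopology X U) c" and n: "mod2_null p X (- {x}) c"
  shows "mod2_null p (subtopology X U) (- {x}) c"
proof -
  have "mod2_null p X (topspace X - {x}) c"
    using n by (simp add: mod2_restrict_Diff)
  then have "mod2_null p (subtopology X U) (topspace X - {x}) c"
    using U x c by (intro mod2_null_excise) auto
  then show ?thesis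
    by (rule mod2_null_mono) auto
qed

text \<open>Excision of the complement of \<open>U\<close>: relative cycles of \<open>X\<close> at
  \<open>x\<close> have representatives in \<open>U\<close>, and a cycle in \<open>U\<close> that is
  null in \<open>X\<close> is already null in \<open>U\<close>.\<close>

lemma local_Z2_open:
  assumes U: "openin X U" "x \<in> U" and x: "closedin X {x}"
  shows "local_Z2 n (subtopology X U) x \<longleftrightarrow> local_Z2 n X x"
proof -
  let ?Y = "subtopology X U" and ?S = "- {x}"
  have nulY: "mod2_null p ?Y ?S c \<longleftrightarrow> mod2_null p X ?S c" if "singular_chain p ?Y c" for p c
    using mod2_null_excise_point [OF U x that] mod2_null_from_subtopology by blast
  have ex: "\<exists>a. mod2_cycle p ?Y ?S a \<and> mod2_null p X ?S (c - a)" if "mod2_cycle p X ?S c" for p c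
  proof -
    have "mod2_cycle p X (topspace X - {x}) c"
      using that by (simp add: mod2_restrict_Diff)
    then obtain a where "singular_chain p ?Y a" "mod2_chain (p - Suc 0) ?Y (topspace X - {x}) (chain_boundary p a)"
      "mod2_null p X (topspace X - {x}) (c - a)"
      using mod2_excise_cycle [OF U(1), of "topspace X - {x}" p c] x U unfolding mod2_cycle_def by blast
    then show ?thesis
      unfolding mod2_cycle_def mod2_restrict_Diff by (metis Diff_eq Int_lower2 mod2_chain_mono)
  qed
  have cyc: "mod2_cycle p X ?S c" if "mod2_cycle p ?Y ?S c" for p c
    using that by (rule mod2_cycle_from_subtopology)
  have sc: "singular_chain p ?Y c" if "mod2_cycle p ?Y ?S c" for p c
    using that by (simp add: mod2_cycle_def)
  have shift: "mod2_null p X ?S c \<longleftrightarrow> mod2_null p X ?S a" if "mod2_null p X ?S (c - a)" for p c a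
    using mod2_null_diff [OF _ that, of c] mod2_null_add [OF that, of a] by auto
  show ?thesis
  proof
    assume L: "local_Z2 n ?Y x"
    show "local_Z2 n X x"
      unfolding local_Z2_def
    proof (intro conjI allI impI)
      fix p c assume p: "n < p" and c: "mod2_cycle p X ?S c"
      obtain a where a: "mod2_cycle p ?Y ?S a" "mod2_null p X ?S (c - a)"
        using ex [OF c] by blast
      have "mod2_null p ?Y ?S a"
        using L p a(1) unfolding local_Z2_def by blast
      then show "mod2_null p X ?S c"
        using shift [OF a(2)] nulY [OF sc [OF a(1)]] by blast
    next
      show "\<exists>c. mod2_cycle n X ?S c \<and> \<not> mod2_null n X ?S c"
        using L cyc sc nulY unfolding local_Z2_def by blast
    next
      fix c d assume cd: "mod2_cycle n X ?S c \<and> \<not> mod2_null n X ?S c \<and> mod2_cycle n X ?S d \<and> \<not> mod2_null n X ?S d"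
      obtain a where a: "mod2_cycle n ?Y ?S a" "mod2_null n X ?S (c - a)"
        using ex cd by blast
      obtain b where b: "mod2_cycle n ?Y ?S b" "mod2_null n X ?S (d - b)"
        using ex cd by blast
      have "mod2_null n ?Y ?S (a - b)"
        using cd shift [OF a(2)] shift [OF b(2)] nulY [OF sc [OF a(1)]] nulY [OF sc [OF b(1)]]
        by (intro local_Z2_diff [OF L a(1) _ b(1)]) auto
      then have "mod2_null n X ?S (a - b)"
        by (rule mod2_null_from_subtopology)
      then have "mod2_null n X ?S ((a - b) + ((c - a) - (d - b)))"
        using mod2_null_add mod2_null_diff [OF a(2) b(2)] by blast
      then show "mod2_null n X ?S (c - d)"
        by (simp add: algebra_simps)
    qed
  next
    assume L: "local_Z2 n X x"
    show "local_Z2 n ?Y x"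
      unfolding local_Z2_def
    proof (intro conjI allI impI)
      fix p c assume p: "n < p" and c: "mod2_cycle p ?Y ?S c"
      then show "mod2_null p ?Y ?S c"
        using L nulY [OF sc [OF c]] cyc [OF c] unfolding local_Z2_def by blast
    next
      obtain c where c: "mod2_cycle n X ?S c" "\<not> mod2_null n X ?S c"
        using L unfolding local_Z2_def by blast
      obtain a where a: "mod2_cycle n ?Y ?S a" "mod2_null n X ?S (c - a)"
        using ex [OF c(1)] by blast
      then show "\<exists>c. mod2_cycle n ?Y ?S c \<and> \<not> mod2_null n ?Y ?S c"
        using c(2) shift [OF a(2)] nulY [OF sc [OF a(1)]] by blast
    next
      fix c d assume cd: "mod2_cycle n ?Y ?S c \<and> \<not> mod2_null n ?Y ?S c \<and> mod2_cycle n ?Y ?S d \<and> \<not> mod2_null n ?Y ?S d"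
      then have "mod2_null n X ?S (c - d)"
        using nulY [OF sc, of n c] nulY [OF sc, of n d] by (intro local_Z2_diff [OF L] cyc) auto
      then show "mod2_null n ?Y ?S (c - d)"
        using nulY [OF singular_chain_diff [OF sc sc]] cd by blast
    qed
  qed
qed

section \<open>Local homology of spheres, Euclidean spaces and manifolds\<close>

lemma trivial_relative_homology_groupD:
  assumes "trivial_group (relative_homology_group (int p) X S)" "singular_relcycle p X S c"
  shows "singular_relboundary p X S c"
proof -
  have "homologous_rel_set p X S c \<in> carrier (relative_homology_group (int p) X S)"
    using assms(2) by (auto simp: carrier_relative_homology_group)
  then have "homologous_rel_set p X S c = singular_relboundary_set p X S"
    using assms(1) by (simp add: trivial_group_def)
  then show ?thesis
    by (simp add: homologous_rel_set_eq_relboundary)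
qed

text \<open>Exchanges an isomorphism on cosets for a degree \<open>\<nu>\<close> on relative cycles
  themselves, which combines directly with chains modulo 2.\<close>

lemma infinite_cyclic_relative_homology_groupD:
  assumes "relative_homology_group (int p) X S \<cong> integer_group"
  obtains \<nu> :: "'a chain \<Rightarrow> int" where
    "\<And>a b. \<lbrakk>singular_relcycle p X S a; singular_relcycle p X S b\<rbrakk> \<Longrightarrow> \<nu> (a + b) = \<nu> a + \<nu> b"
    "\<And>a. singular_relcycle p X S a \<Longrightarrow> \<nu> a = 0 \<longleftrightarrow> singular_relboundary p X S a"
    "\<And>k. \<exists>a. singular_relcycle p X S a \<and> \<nu> a = k"
proof -
  let ?G = "relative_homology_group (int p) X S"
  obtain \<phi> where \<phi>: "\<phi> \<in> iso ?G integer_group"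
    using assms by (auto simp: is_iso_def)
  let ?\<nu> = "\<lambda>c. \<phi> (homologous_rel_set p X S c)"
  have cl: "homologous_rel_set p X S c \<in> carrier ?G" if "singular_relcycle p X S c" for c
    using that by (auto simp: carrier_relative_homology_group)
  have hom: "\<phi> \<in> hom ?G integer_group" and bij: "bij_betw \<phi> (carrier ?G) UNIV"
    using \<phi> by (auto simp: iso_def)
  show thesis
  proof
    fix a b assume ab: "singular_relcycle p X S a" "singular_relcycle p X S b"
    have "homologous_rel_set p X S (a + b) = homologous_rel_set p X S a \<otimes>\<^bsub>?G\<^esub> homologous_rel_set p X S b"
    proof -
      have "(\<Union>r\<in>homologous_rel_set p X S a. \<Union>s\<in>homologous_rel_set p X S b. {r + s}) = homologous_rel_set p X S (a + b)"
      proof (intro equalityI subsetI)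
        fix t assume "t \<in> (\<Union>r\<in>homologous_rel_set p X S a. \<Union>s\<in>homologous_rel_set p X S b. {r + s})"
        then show "t \<in> homologous_rel_set p X S (a + b)"
          by (auto intro: homologous_rel_add)
      next
        fix t assume "t \<in> homologous_rel_set p X S (a + b)"
        then have "homologous_rel p X S a (t - b)"
          by (simp add: homologous_rel_def algebra_simps)
        then show "t \<in> (\<Union>r\<in>homologous_rel_set p X S a. \<Union>s\<in>homologous_rel_set p X S b. {r + s})"
          using homologous_rel_refl [of p X S b] diff_add_cancel [of t b] by blast
      qed
      then show ?thesis
        by (simp add: mult_relative_homology_group)
    qed
    then show "?\<nu> (a + b) = ?\<nu> a + ?\<nu> b"
      using hom_mult [OF hom cl [OF ab(1)] cl [OF ab(2)]] by simp
  next
    fix a assume a: "singular_relcycle p X S a"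
    have one: "\<phi> \<one>\<^bsub>?G\<^esub> = 0"
      using hom_one [OF hom] by simp
    have "\<one>\<^bsub>?G\<^esub> \<in> carrier ?G"
      by (intro monoid.one_closed group.is_monoid group_relative_homology_group)
    then have "?\<nu> a = 0 \<longleftrightarrow> homologous_rel_set p X S a = \<one>\<^bsub>?G\<^esub>"
      using bij cl [OF a] one unfolding bij_betw_def inj_on_def by metis
    then show "?\<nu> a = 0 \<longleftrightarrow> singular_relboundary p X S a"
      by (simp add: homologous_rel_set_eq_relboundary)
  next
    fix k
    have "k \<in> \<phi> ` carrier ?G"
      using bij by (simp add: bij_betw_def)
    then show "\<exists>a. singular_relcycle p X S a \<and> ?\<nu> a = k"
      by (auto simp: carrier_relative_homology_group)
  qed
qed

text \<open>The complement of \<open>q\<close> is contractible, so homology relative to it is the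
  reduced homology of the sphere: infinite cyclic in degree \<open>n\<close>, zero otherwise. There
  is no torsion, so cycles modulo 2 lift to integral ones, and in degree \<open>n\<close> the parity
  of \<open>\<nu>\<close> decides the class modulo 2.\<close>

lemma local_Z2_nsphere:
  assumes q: "q \<in> topspace (nsphere n)"
  shows "local_Z2 n (nsphere n) q"
proof -
  let ?X = "nsphere n" and ?S = "- {q}"
  have eqS: "subtopology ?X ?S = subtopology ?X (topspace ?X - {q})"
    by (metis Diff_eq subtopology_restrict)
  have hom: "Euclidean_space n homeomorphic_space subtopology ?X ?S"
    using nsphere_punctured_homeomorphic [OF q] eqS by simp
  then have con: "contractible_space (subtopology ?X ?S)"
    using homeomorphic_space_contractibility contractible_Euclidean_space by blast
  have "topspace ?X \<inter> ?S \<noteq> {}"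
    using homeomorphic_empty_space [OF hom] nontrivial_Euclidean_space [of n] by (metis topspace_subtopology null_topspace_iff_trivial)
  with con have iso: "hom_induced p ?X {} ?X ?S id \<in> iso (reduced_homology_group p ?X) (relative_homology_group p ?X ?S)" for p
    by (rule iso_reduced_homology_by_contractible)
  have triv: "singular_relboundary p ?X ?S c" if "p \<noteq> n" "singular_relcycle p ?X ?S c" for p c
  proof -
    have "trivial_group (relative_homology_group (int p) ?X ?S)"
      using iso [of "int p"] reduced_homology_group_nsphere(2) [of "int p" n] that(1)
      by (metis group_reduced_homology_group group_relative_homology_group is_isoI isomorphic_group_triviality of_nat_eq_iff)
    then show ?thesis
      using that(2) by (rule trivial_relative_homology_groupD)
  qed
  have "relative_homology_group (int n) ?X ?S \<cong> integer_group"
    using iso [of "int n"] reduced_homology_group_nsphere(1) [of n]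
    by (meson group.iso_sym group_reduced_homology_group is_isoI iso_trans)
  then obtain \<nu> where \<nu>add: "\<And>a b. \<lbrakk>singular_relcycle n ?X ?S a; singular_relcycle n ?X ?S b\<rbrakk> \<Longrightarrow> \<nu> (a + b) = (\<nu> a + \<nu> b :: int)"
    and \<nu>0: "\<And>a. singular_relcycle n ?X ?S a \<Longrightarrow> \<nu> a = 0 \<longleftrightarrow> singular_relboundary n ?X ?S a"
    and \<nu>sur: "\<And>k. \<exists>a. singular_relcycle n ?X ?S a \<and> \<nu> a = k"
    by (rule infinite_cyclic_relative_homology_groupD) blast
  have notor: "singular_relboundary p ?X ?S u"
    if "singular_relcycle p ?X ?S u" "singular_relboundary p ?X ?S (u + u)" for p u
  proof (cases "p = n")
    case True
    then have "\<nu> (u + u) = 0"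
      using that \<nu>0 singular_relcycle_add by blast
    then show ?thesis
      using that \<nu>0 \<nu>add True by auto
  qed (use triv that in blast)
  have null_boundary: "mod2_null p ?X ?S z" if z: "singular_relboundary p ?X ?S z" for p z
  proof -
    obtain d e where "singular_chain (Suc p) ?X d" "singular_chain p (subtopology ?X ?S) e" "chain_boundary (Suc p) d + e = z"
      using z unfolding singular_relboundary by blast
    then show ?thesis
      using mod2_null_add [OF mod2_null_boundary mod2_nullI [OF mod2_chain_of]] by blast
  qed
  have null_double: "mod2_null p ?X ?S (v + v)" if "singular_chain p ?X v" for p v
    by (intro mod2_nullI mod2_chain_double that)
  have even: "mod2_null n ?X ?S z" if z: "singular_relcycle n ?X ?S z" and ev: "even (\<nu> z)" for z
  proof -
    obtain k where k: "\<nu> z = k + k"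
      using ev by (metis evenE mult_2)
    obtain u where u: "singular_relcycle n ?X ?S u" "\<nu> u = k"
      using \<nu>sur by blast
    have w: "singular_relcycle n ?X ?S (z - (u + u))"
      by (intro singular_relcycle_diff singular_relcycle_add z u)
    have "\<nu> z = \<nu> (z - (u + u)) + (\<nu> u + \<nu> u)"
      using \<nu>add [OF w singular_relcycle_add [OF u(1) u(1)]] \<nu>add [OF u(1) u(1)] by simp
    then have "singular_relboundary n ?X ?S (z - (u + u))"
      using \<nu>0 [OF w] k u(2) by simp
    moreover have "singular_chain n ?X u"
      using u(1) by (simp add: singular_relcycle)
    ultimately have "mod2_null n ?X ?S ((z - (u + u)) + (u + u))"
      using mod2_null_add [OF null_boundary null_double] by blast
    then show ?thesis by simp
  qed
  \<comment> \<open>A null cycle is a double \<open>u + u\<close> up to a relative boundary. The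
    boundary of the equation shows that \<open>u\<close> is itself a relative cycle, so the degree
    of \<open>z\<close> is \<open>\<nu> u + \<nu> u\<close>.\<close>
  have odd: "even (\<nu> z)" if z: "singular_relcycle n ?X ?S z" and nl: "mod2_null n ?X ?S z" for z
  proof -
    obtain e s u where e: "singular_chain (Suc n) ?X e" and s: "singular_chain n (subtopology ?X ?S) s"
      and u: "singular_chain n ?X u" and eq: "z - chain_boundary (Suc n) e = s + (u + u)"
      using nl unfolding mod2_null_def by (auto elim: mod2_chainE)
    have "chain_boundary n (chain_boundary (Suc n) e) = 0"
      using chain_boundary_boundary [OF e] by simp
    then have "chain_boundary n z - chain_boundary n s = chain_boundary n u + chain_boundary n u"
      using arg_cong [OF eq, of "chain_boundary n"] by (simp add: chain_boundary_diff chain_boundary_add)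
    moreover have "singular_chain (n - Suc 0) (subtopology ?X ?S) (chain_boundary n z - chain_boundary n s)"
      using z singular_chain_boundary [OF s] by (auto simp: singular_relcycle intro: singular_chain_diff)
    ultimately have "singular_relcycle n ?X ?S u"
      using u by (simp add: singular_relcycle singular_chain_double_iff)
    then have uu: "singular_relcycle n ?X ?S (u + u)" and \<nu>uu: "\<nu> (u + u) = \<nu> u + \<nu> u"
      using singular_relcycle_add \<nu>add by auto
    have "z - (u + u) = chain_boundary (Suc n) e + s"
      using eq by (simp add: algebra_simps)
    then have "singular_relboundary n ?X ?S (z - (u + u))"
      unfolding singular_relboundary using e s by metis
    then have "\<nu> (z - (u + u)) = 0"
      using \<nu>0 [OF singular_relcycle_diff [OF z uu]] by simp
    then have "\<nu> z = \<nu> u + \<nu> u"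
      using \<nu>add [OF singular_relcycle_diff [OF z uu] uu] \<nu>uu by simp
    then show ?thesis by simp
  qed
  have lift: "\<exists>z. singular_relcycle p ?X ?S z \<and> mod2_null p ?X ?S (c - z)" if "mod2_cycle p ?X ?S c" for p c
  proof -
    have c: "singular_chain p ?X c" "mod2_chain (p - Suc 0) ?X ?S (chain_boundary p c)"
      using that by (auto simp: mod2_cycle_def)
    show ?thesis
    proof (rule mod2_cycle_lift [OF c])
      fix u assume "singular_relcycle (p - Suc 0) ?X ?S u" "singular_relboundary (p - Suc 0) ?X ?S (u + u)"
      then show "singular_relboundary (p - Suc 0) ?X ?S u"
        by (rule notor)
    next
      fix z v assume "singular_relcycle p ?X ?S z" "singular_chain p ?X v" "c = z + (v + v)"
      then show ?thesis
        using null_double by (intro exI [of _ z]) auto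
    qed
  qed
  have shift: "mod2_null p ?X ?S c \<longleftrightarrow> mod2_null p ?X ?S a" if "mod2_null p ?X ?S (c - a)" for p c a
    using mod2_null_diff [OF _ that, of c] mod2_null_add [OF that, of a] by auto
  show ?thesis
    unfolding local_Z2_def
  proof (intro conjI allI impI)
    fix p c assume "n < p" "mod2_cycle p ?X ?S c"
    then show "mod2_null p ?X ?S c"
      using lift shift triv null_boundary by (metis less_irrefl)
  next
    obtain z where z: "singular_relcycle n ?X ?S z" "\<nu> z = 1"
      using \<nu>sur by blast
    then have "mod2_cycle n ?X ?S z"
      unfolding mod2_cycle_def by (auto simp: singular_relcycle mod2_chain_of)
    then show "\<exists>c. mod2_cycle n ?X ?S c \<and> \<not> mod2_null n ?X ?S c"
      using odd z by (metis odd_one)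
  next
    fix c d assume cd: "mod2_cycle n ?X ?S c \<and> \<not> mod2_null n ?X ?S c \<and> mod2_cycle n ?X ?S d \<and> \<not> mod2_null n ?X ?S d"
    obtain y where y: "singular_relcycle n ?X ?S y" "mod2_null n ?X ?S (c - y)"
      using lift cd by blast
    obtain z where z: "singular_relcycle n ?X ?S z" "mod2_null n ?X ?S (d - z)"
      using lift cd by blast
    \<comment> \<open>Both degrees are odd, so \<open>y + z\<close> is null; subtracting
      \<open>z + z\<close> turns the sum into the difference.\<close>
    have "odd (\<nu> y)" "odd (\<nu> z)"
      using even shift y z cd by blast+
    then have "mod2_null n ?X ?S (y + z)"
      using \<nu>add [OF y(1) z(1)] by (intro even singular_relcycle_add y z) simp
    moreover have "mod2_null n ?X ?S (z + z)"
      using z(1) by (intro null_double) (simp add: singular_relcycle)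
    ultimately have "mod2_null n ?X ?S (((y + z) - (z + z)) + ((c - y) - (d - z)))"
      using mod2_null_add [OF mod2_null_diff mod2_null_diff [OF y(2) z(2)]] by blast
    then show "mod2_null n ?X ?S (c - d)"
      by (simp add: algebra_simps)
  qed
qed

lemma closedin_nsphere_singleton: "closedin (nsphere n) {q}" if "q \<in> topspace (nsphere n)"
  using that closedin_Hausdorff_singleton [of "nsphere n" q]
  by (simp add: nsphere Hausdorff_space_subtopology Hausdorff_space_product_topology)

text \<open>Euclidean space is a punctured sphere, hence open in a sphere, and the condition is
  unaffected by passing to open subsets.\<close>

lemma local_Z2_Euclidean_space:
  assumes x: "x \<in> topspace (Euclidean_space n)"
  shows "local_Z2 n (Euclidean_space n) x"
proof -
  let ?p = "north n" and ?X = "nsphere n"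
  let ?U = "topspace ?X - {?p}"
  obtain f g where fg: "homeomorphic_maps (Euclidean_space n) (subtopology ?X ?U) f g"
    using stereographic_projection homeomorphic_space_def by blast
  then have fx: "f x \<in> ?U" and gfx: "g (f x) = x"
    using x by (auto simp: homeomorphic_maps_def continuous_map_def)
  have "openin ?X ?U"
    using closedin_nsphere_singleton [OF north_in_nsphere] by blast
  then have "local_Z2 n (subtopology ?X ?U) (f x)"
    using local_Z2_nsphere [of "f x" n] fx closedin_nsphere_singleton [of "f x" n] by (subst local_Z2_open) auto
  moreover have "f x \<in> topspace (subtopology ?X ?U)"
    using fx by auto
  ultimately have "local_Z2 n (Euclidean_space n) (g (f x))"
    using local_Z2_homeomorphic [OF homeomorphic_maps_sym [THEN iffD1, OF fg]] by blast
  then show ?thesis by (simp add: gfx)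
qed

lemma local_Z2_euclidean_point:
  assumes M: "Hausdorff_space M" and x: "euclidean_point n M x"
  shows "local_Z2 n M x"
proof -
  obtain U where U: "openin M U" "x \<in> U" "subtopology M U homeomorphic_space Euclidean_space n"
    using x by (auto simp: euclidean_point_def)
  then obtain f g where fg: "homeomorphic_maps (subtopology M U) (Euclidean_space n) f g"
    unfolding homeomorphic_space_def by blast
  have xM: "x \<in> topspace M"
    using U openin_subset by blast
  then have fx: "f x \<in> topspace (Euclidean_space n)" and gfx: "g (f x) = x"
    using fg U by (auto simp: homeomorphic_maps_def continuous_map_def)
  have "local_Z2 n (subtopology M U) (g (f x))"
    by (rule local_Z2_homeomorphic [OF homeomorphic_maps_sym [THEN iffD1, OF fg] fx local_Z2_Euclidean_space [OF fx]])
  then show ?thesis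
    unfolding gfx using local_Z2_open [OF U(1,2)] xM M by (auto simp: closedin_Hausdorff_singleton)
qed

section \<open>Fundamental classes on compact sets\<close>

definition coord_box :: "nat \<Rightarrow> (nat \<Rightarrow> real) \<Rightarrow> (nat \<Rightarrow> real) \<Rightarrow> (nat \<Rightarrow> real) set" where
  "coord_box n a b = {u \<in> topspace (Euclidean_space n). \<forall>i<n. a i \<le> u i \<and> u i \<le> b i}"

lemma closedin_coord_box: "closedin (Euclidean_space n) (coord_box n a b)"
proof -
  have "closed (\<Inter>i<n. {u::nat\<Rightarrow>real. a i \<le> u i} \<inter> {u. u i \<le> b i})"
    by (intro closed_INT ballI closed_Int closed_Collect_le continuous_on_coordinate continuous_on_const)
  moreover have "coord_box n a b = topspace (Euclidean_space n) \<inter> (\<Inter>i<n. {u. a i \<le> u i} \<inter> {u. u i \<le> b i})"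
    by (auto simp: coord_box_def)
  ultimately show ?thesis
    by (auto simp: Euclidean_space_eq closedin_closed)
qed

lemma compactin_coord_box: "compactin (Euclidean_space n) (coord_box n a b)"
proof -
  have "compactin (powertop_real UNIV) (\<Pi>\<^sub>E i\<in>UNIV. if i < n then {a i..b i} else {0})"
    by (auto simp: compactin_PiE)
  moreover have "coord_box n a b = (\<Pi>\<^sub>E i\<in>UNIV. if i < n then {a i..b i} else {0})"
    by (auto simp: coord_box_def topspace_Euclidean_space PiE_iff split: if_splits)
  ultimately show ?thesis
    by (auto simp: Euclidean_space_def compactin_subtopology PiE_iff split: if_splits)
qed

text \<open>Bounds with \<open>a i > b i\<close> are allowed and give the empty box, so boxes are
  closed under intersection. The Mayer-Vietoris inductions over unions of boxes rest on
  this.\<close>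

lemma coord_box_Int: "coord_box n a b \<inter> coord_box n a' b' = coord_box n (\<lambda>i. max (a i) (a' i)) (\<lambda>i. min (b i) (b' i))"
  by (auto simp: coord_box_def)

lemma coord_box_Int_ex:
  assumes "\<exists>a b. B = coord_box n a b" "\<exists>a b. L = coord_box n a b"
  shows "\<exists>a b. B \<inter> L = coord_box n a b"
  using assms by (elim exE) (simp only: coord_box_Int, intro exI, rule refl)

lemma closedin_Union_coord_boxes:
  assumes "finite F" "\<And>L. L \<in> F \<Longrightarrow> \<exists>a b. L = coord_box n a b"
  shows "closedin (Euclidean_space n) (\<Union>F)"
proof (rule closedin_Union [OF assms(1)])
  fix L assume "L \<in> F"
  from assms(2) [OF this] show "closedin (Euclidean_space n) L"
    by (elim exE) (simp add: closedin_coord_box)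
qed

lemma mod2_null_UNIV: "singular_chain p X c \<Longrightarrow> mod2_null p X UNIV c"
  by (intro mod2_nullI mod2_chain_of) simp

text \<open>Radial dilation from \<open>x\<close> pushes the complement of \<open>x\<close> off the box, through the complement of the box.\<close>

lemma mod2_null_box:
  assumes c: "mod2_cycle p (Euclidean_space n) (- coord_box n a b) c" and x: "x \<in> coord_box n a b"
    and nx: "mod2_null p (Euclidean_space n) (- {x}) c"
  shows "mod2_null p (Euclidean_space n) (- coord_box n a b) c"
proof -
  let ?E = "Euclidean_space n" and ?L = "coord_box n a b"
  let ?Y = "subtopology ?E (- {x})"
  obtain e where e: "singular_chain (Suc p) ?E e" and m: "mod2_chain p ?E (- {x}) (c - chain_boundary (Suc p) e)"
    using nx unfolding mod2_null_def by blast
  \<comment> \<open>Nullness at \<open>x\<close> replaces \<open>c\<close> by a chain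
    \<open>s\<close> avoiding \<open>x\<close>, on which the dilation is defined.\<close>
  obtain s u where s: "singular_chain p ?Y s" and u: "singular_chain p ?E u" and eq: "c - chain_boundary (Suc p) e = s + (u + u)"
    using m by (rule mod2_chainE)
  have "chain_boundary p (chain_boundary (Suc p) e) = 0"
    using chain_boundary_boundary [OF e] by simp
  then have "chain_boundary p c = chain_boundary p s + (chain_boundary p u + chain_boundary p u)"
    using arg_cong [OF eq, of "chain_boundary p"] by (simp add: chain_boundary_add chain_boundary_diff)
  then have "chain_boundary p s = chain_boundary p c - (chain_boundary p u + chain_boundary p u)"
    by simp
  moreover have "mod2_chain (p - Suc 0) ?E (- ?L) (chain_boundary p c - (chain_boundary p u + chain_boundary p u))"
    using c singular_chain_boundary [OF u] by (auto simp: mod2_cycle_def intro: mod2_chain_diff mod2_chain_double)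
  ultimately have Ds: "mod2_chain (p - Suc 0) ?Y (- ?L) (chain_boundary p s)"
    using singular_chain_boundary [OF s] by (simp add: mod2_chain_subtopology)
  define d where "d = (\<lambda>y::nat\<Rightarrow>real. \<Sum>i<n. \<bar>y i - x i\<bar>)"
  \<comment> \<open>The sum of the edges bounds the distance \<open>d\<close> from \<open>x\<close>
    to any point of the box.\<close>
  define R where "R = (\<Sum>i<n. b i - a i)"
  have xE: "x \<in> topspace ?E" and xab: "\<And>i. i < n \<Longrightarrow> a i \<le> x i \<and> x i \<le> b i"
    using x by (auto simp: coord_box_def)
  have dL: "d y \<le> R" if "y \<in> ?L" for y
    unfolding d_def R_def
  proof (rule sum_mono)
    fix i assume "i \<in> {..<n}"
    then have "a i \<le> y i \<and> y i \<le> b i" "a i \<le> x i \<and> x i \<le> b i"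
      using that xab by (auto simp: coord_box_def)
    then show "\<bar>y i - x i\<bar> \<le> b i - a i" by linarith
  qed
  have R0: "R \<ge> 0"
    unfolding R_def using xab by (intro sum_nonneg) (metis diff_ge_0_iff_ge lessThan_iff order_trans)
  have dpos: "d y > 0" if "y \<in> topspace ?Y" for y
  proof -
    have "y \<noteq> x" using that by auto
    then obtain i where "y i \<noteq> x i" by blast
    moreover have "i < n"
    proof (rule ccontr)
      assume "\<not> i < n"
      then have "y i = 0" "x i = 0"
        using that xE by (auto simp: topspace_Euclidean_space)
      then show False using \<open>y i \<noteq> x i\<close> by simp
    qed
    ultimately show ?thesis
      unfolding d_def by (intro sum_pos2 [of _ i]) auto
  qed
  \<comment> \<open>At time 1 every point has moved outward by the distance \<open>R\<close>, so it
    ends farther than \<open>R\<close> from \<open>x\<close> and hence outside the box.\<close>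
  define h where "h = (\<lambda>(t, y) i. if i < n then y i + t * (R / d y) * (y i - x i) else 0)"
  let ?P = "prod_topology interval ?Y"
  have ch: "continuous_map ?P ?E h"
    unfolding continuous_map_into_Euclidean_space_iff
  proof (intro conjI allI impI)
    fix i assume "i < n"
    have fst: "continuous_map ?P euclideanreal fst"
      using continuous_map_fst [of interval ?Y] continuous_map_into_fulltopology by blast
    have coord: "continuous_map ?P euclideanreal (\<lambda>z. snd z j)" for j
    proof -
      have "continuous_map ?Y euclideanreal (\<lambda>y. y j)"
        by (intro continuous_map_from_subtopology continuous_map_Euclidean_space_coordinate)
      from continuous_map_compose [OF continuous_map_snd this] show ?thesis
        by (simp add: o_def)
    qed
    have "continuous_map ?P euclideanreal (\<lambda>z. d (snd z))"
      unfolding d_def by (intro continuous_intros coord) auto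
    then have "continuous_map ?P euclideanreal (\<lambda>z. snd z i + fst z * (R / d (snd z)) * (snd z i - x i))"
      using dpos by (intro continuous_intros fst coord) force+
    then show "continuous_map ?P euclideanreal (\<lambda>z. h z i)"
      using \<open>i < n\<close> by (simp add: h_def case_prod_unfold)
  qed (auto simp: h_def topspace_Euclidean_space)
  have hL: "h (t, y) \<in> - ?L" if t: "t \<in> {0..1}" and y: "y \<in> topspace ?Y" "y \<in> - ?L" for t y
  proof
    assume hy: "h (t, y) \<in> ?L"
    \<comment> \<open>At time \<open>t\<close> the point \<open>y\<close> is dilated from
      \<open>x\<close> by \<open>k\<close>, which is at least 1; the box being convex,
      \<open>y\<close> would lie in it if its image did.\<close>
    define k where "k = 1 + t * (R / d y)"
    have k: "k \<ge> 1"
      using t R0 dpos [OF y(1)] by (simp add: k_def)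
    have "a i \<le> y i \<and> y i \<le> b i" if i: "i < n" for i
    proof -
      define m where "m = k * (y i - x i)"
      have "h (t, y) i = x i + m"
        using i by (simp add: h_def k_def m_def algebra_simps)
      then have z: "a i \<le> x i + m" "x i + m \<le> b i"
        using hy i by (auto simp: coord_box_def)
      show ?thesis
      proof (cases "y i \<ge> x i")
        case True
        then have "y i - x i \<le> m"
          using mult_right_mono [OF k, of "y i - x i"] by (simp add: m_def)
        then show ?thesis using z xab [OF i] True by (intro conjI) linarith+
      next
        case False
        then have "m \<le> y i - x i"
          using mult_right_mono_neg [OF k, of "y i - x i"] by (simp add: m_def)
        then show ?thesis using z xab [OF i] False by (intro conjI) linarith+
      qed
    qed
    then show False
      using y by (auto simp: coord_box_def)
  qed
  have h1: "h (1, y) \<in> - ?L" if y: "y \<in> topspace ?Y" for y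
  proof
    assume "h (1, y) \<in> ?L"
    then have "d (h (1, y)) \<le> R" by (rule dL)
    moreover have "d (h (1, y)) = d y + R"
    proof -
      have "\<bar>h (1, y) i - x i\<bar> = (1 + R / d y) * \<bar>y i - x i\<bar>" if "i < n" for i
      proof -
        have "h (1, y) i - x i = (1 + R / d y) * (y i - x i)"
          using that by (simp add: h_def algebra_simps)
        moreover have "1 + R / d y \<ge> 0"
          using R0 dpos [OF y] by simp
        ultimately show ?thesis
          by (simp add: abs_mult)
      qed
      then have "(\<Sum>i<n. \<bar>h (1, y) i - x i\<bar>) = (\<Sum>i<n. (1 + R / d y) * \<bar>y i - x i\<bar>)"
        by (intro sum.cong) auto
      then have "d (h (1, y)) = (1 + R / d y) * d y"
        by (simp only: d_def sum_distrib_left)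
      then show ?thesis
        using dpos [OF y] by (simp add: algebra_simps)
    qed
    ultimately show False
      using dpos [OF y] by simp
  qed
  have "mod2_null p ?E (- ?L) (chain_map p (\<lambda>y. h (1, y)) s - chain_map p (\<lambda>y. h (0, y)) s)"
    by (rule mod2_null_homotopy [OF ch hL s Ds])
  moreover have "chain_map p (\<lambda>y. h (0, y)) s = s"
    by (rule chain_map_id_gen [OF s]) (auto simp: h_def topspace_Euclidean_space fun_eq_iff)
  moreover have "mod2_null p ?E (- ?L) (chain_map p (\<lambda>y. h (1, y)) s)"
  proof -
    have "continuous_map ?Y (subtopology ?E (- ?L)) (\<lambda>y. h (1, y))"
      using continuous_map_slice [OF ch, of 1] h1 by (auto simp: continuous_map_in_subtopology)
    then show ?thesis
      by (intro mod2_nullI mod2_chain_of singular_chain_chain_map [OF s])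
  qed
  ultimately have "mod2_null p ?E (- ?L) s"
    using mod2_null_diff [of p ?E "- ?L" "chain_map p (\<lambda>y. h (1, y)) s" "chain_map p (\<lambda>y. h (1, y)) s - s"] by simp
  then have "mod2_null p ?E (- ?L) ((s + (u + u)) + chain_boundary (Suc p) e)"
    by (intro mod2_null_add mod2_null_boundary e mod2_nullI [OF mod2_chain_double] u)
  then show ?thesis
    unfolding eq [symmetric] by simp
qed

lemma mod2_null_Un:
  assumes K: "closedin X K" and L: "closedin X L" and n: "mod2_null p X (- K) c" "mod2_null p X (- L) c"
    and van: "\<And>d. mod2_cycle (Suc p) X (- (K \<inter> L)) d \<Longrightarrow> mod2_null (Suc p) X (- (K \<inter> L)) d"
  shows "mod2_null p X (- (K \<union> L)) c"
proof -
  have "mod2_null p X ((topspace X - K) \<inter> (topspace X - L)) c"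
  proof (rule mod2_null_Int)
    fix d assume d: "singular_chain (Suc p) X d" "mod2_chain p X ((topspace X - K) \<union> (topspace X - L)) (chain_boundary (Suc p) d)"
    have eq: "(topspace X - K) \<union> (topspace X - L) = topspace X - (K \<inter> L)" by blast
    have "mod2_cycle (Suc p) X (- (K \<inter> L)) d"
      using d unfolding eq mod2_restrict_Diff mod2_cycle_def by simp
    from van [OF this] show "mod2_null (Suc p) X ((topspace X - K) \<union> (topspace X - L)) d"
      unfolding eq mod2_restrict_Diff .
  qed (use K L n in \<open>auto simp: mod2_restrict_Diff\<close>)
  moreover have "(topspace X - K) \<inter> (topspace X - L) = topspace X - (K \<union> L)" by blast
  ultimately show ?thesis
    by (simp only: mod2_restrict_Diff)
qed

text \<open>Induction on the number of boxes by Mayer-Vietoris; a single box reduces to a point by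
  \<open>mod2_null_box\<close>. Intersecting the other boxes with the new one gives no more boxes
  than before, but one degree higher, so all degrees above \<open>n\<close> are treated
  together.\<close>

lemma mod2_vanishing_boxes:
  assumes "finite F" "\<And>L. L \<in> F \<Longrightarrow> \<exists>a b. L = coord_box n a b" "n < p"
    and "mod2_cycle p (Euclidean_space n) (- \<Union>F) c"
  shows "mod2_null p (Euclidean_space n) (- \<Union>F) c"
proof -
  have "\<forall>F p c. finite F \<and> card F \<le> k \<and> (\<forall>L\<in>F. \<exists>a b. L = coord_box n a b) \<and> n < p \<and>
      mod2_cycle p (Euclidean_space n) (- \<Union>F) c \<longrightarrow> mod2_null p (Euclidean_space n) (- \<Union>F) c" for k
  proof (induction k)
    case 0
    show ?case
    proof (intro allI impI, elim conjE)
      fix F :: "(nat \<Rightarrow> real) set set" and p c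
      assume "finite F" "card F \<le> 0" and c: "mod2_cycle p (Euclidean_space n) (- \<Union>F) c"
      then have "F = {}" by simp
      with c show "mod2_null p (Euclidean_space n) (- \<Union>F) c"
        by (simp add: mod2_cycle_def mod2_null_UNIV)
    qed
  next
    case (Suc k)
    have IH: "mod2_null p (Euclidean_space n) (- \<Union>F) c"
      if "finite F" "card F \<le> k" "\<forall>L\<in>F. \<exists>a b. L = coord_box n a b" "n < p"
        "mod2_cycle p (Euclidean_space n) (- \<Union>F) c" for F p c
      using Suc that by blast
    show ?case
    proof (intro allI impI, elim conjE)
      fix F :: "(nat \<Rightarrow> real) set set" and p c
      assume F: "finite F" "card F \<le> Suc k" and bF: "\<forall>L\<in>F. \<exists>a b. L = coord_box n a b" and p: "n < p"
        and c: "mod2_cycle p (Euclidean_space n) (- \<Union>F) c"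
      show "mod2_null p (Euclidean_space n) (- \<Union>F) c"
      proof (cases "F = {}")
        case True
        with c show ?thesis
          by (simp add: mod2_cycle_def mod2_null_UNIV)
      next
        case False
        then obtain L G where LG: "F = insert L G" "L \<notin> G"
          by (meson Set.set_insert ex_in_conv)
        then have G: "finite G" "card G \<le> k" "\<forall>L\<in>G. \<exists>a b. L = coord_box n a b"
          using F bF by auto
        obtain a b where L: "L = coord_box n a b"
          using LG bF by blast
        have "mod2_null p (Euclidean_space n) (- \<Union>G) c"
          by (rule IH [OF G p mod2_cycle_mono [OF c]]) (use LG in auto)
        moreover have "mod2_null p (Euclidean_space n) (- L) c"
        proof (cases "L = {}")
          case True
          then show ?thesis
            using c by (simp add: mod2_cycle_def mod2_null_UNIV)
        next
          case False
          then obtain x where x: "x \<in> L" by blast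
          then have "local_Z2 n (Euclidean_space n) x"
            using L by (intro local_Z2_Euclidean_space) (auto simp: coord_box_def)
          moreover have "mod2_cycle p (Euclidean_space n) (- {x}) c"
            using c x LG by (intro mod2_cycle_mono [OF c]) auto
          ultimately have "mod2_null p (Euclidean_space n) (- {x}) c"
            using p by (simp add: local_Z2_def)
          moreover have "mod2_cycle p (Euclidean_space n) (- L) c"
            using LG by (intro mod2_cycle_mono [OF c]) auto
          ultimately show ?thesis
            using mod2_null_box x unfolding L by blast
        qed
        moreover have "mod2_null (Suc p) (Euclidean_space n) (- (\<Union>G \<inter> L)) d"
          if d: "mod2_cycle (Suc p) (Euclidean_space n) (- (\<Union>G \<inter> L)) d" for d
        proof -
          let ?H = "(\<lambda>B. B \<inter> L) ` G"
          have bH: "\<forall>B\<in>?H. \<exists>a b. B = coord_box n a b"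
          proof
            fix B assume "B \<in> ?H"
            then obtain B' where B': "B' \<in> G" "B = B' \<inter> L"
              by (elim imageE) (rule that)
            have "\<exists>a b. L = coord_box n a b" using L by (intro exI)
            from coord_box_Int_ex [OF bspec [OF G(3) B'(1)] this] show "\<exists>a b. B = coord_box n a b"
              unfolding B'(2) .
          qed
          have cH: "card ?H \<le> k"
            by (rule le_trans [OF card_image_le [OF G(1)] G(2)])
          have eq: "\<Union>?H = \<Union>G \<inter> L" by blast
          have "mod2_null (Suc p) (Euclidean_space n) (- \<Union>?H) d"
            by (rule IH [OF finite_imageI [OF G(1)] cH bH]) (use p d eq in auto)
          then show ?thesis by (simp only: eq)
        qed
        ultimately have "mod2_null p (Euclidean_space n) (- (\<Union>G \<union> L)) c"
          using L closedin_coord_box by (intro mod2_null_Un closedin_Union_coord_boxes [OF G(1) bspec [OF G(3)]]) auto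
        then show ?thesis
          using LG by (simp add: Un_commute)
      qed
    qed
  qed
  then show ?thesis
    using assms by blast
qed

text \<open>Here nullness is known for each single box. The Mayer-Vietoris step only needs vanishing
  for unions of boxes in degree \<open>n + 1\<close>, which \<open>mod2_vanishing_boxes\<close>
  provides.\<close>

lemma mod2_null_Union_boxes:
  assumes "finite F" "\<And>L. L \<in> F \<Longrightarrow> \<exists>a b. L = coord_box n a b"
    and "singular_chain n (Euclidean_space n) c"
    and "\<And>L. L \<in> F \<Longrightarrow> mod2_null n (Euclidean_space n) (- L) c"
  shows "mod2_null n (Euclidean_space n) (- \<Union>F) c"
  using assms
proof (induction F rule: finite_induct)
  case empty
  then show ?case by (simp add: mod2_null_UNIV)
next
  case (insert L G)
  obtain a b where L: "L = coord_box n a b"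
    using insert.prems(1) by blast
  have "mod2_null (Suc n) (Euclidean_space n) (- (\<Union>G \<inter> L)) d"
    if d: "mod2_cycle (Suc n) (Euclidean_space n) (- (\<Union>G \<inter> L)) d" for d
  proof -
    let ?H = "(\<lambda>B. B \<inter> L) ` G"
    have eq: "\<Union>?H = \<Union>G \<inter> L" by blast
    have "mod2_null (Suc n) (Euclidean_space n) (- \<Union>?H) d"
    proof (rule mod2_vanishing_boxes)
      fix B assume "B \<in> ?H"
      then obtain B' where B': "B' \<in> G" "B = B' \<inter> L"
        by (elim imageE) (rule that)
      show "\<exists>a b. B = coord_box n a b"
        unfolding B'(2) by (intro coord_box_Int_ex insert.prems(1)) (use B' in auto)
    qed (use insert.hyps d eq in auto)
    then show ?thesis by (simp only: eq)
  qed
  moreover have "closedin (Euclidean_space n) (\<Union>G)"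
    by (intro closedin_Union_coord_boxes insert.hyps insert.prems(1)) auto
  ultimately have "mod2_null n (Euclidean_space n) (- (\<Union>G \<union> L)) c"
    using insert L by (intro mod2_null_Un) (auto simp: closedin_coord_box)
  then show ?case
    by (simp add: Un_commute)
qed

lemma mod2_null_box_neighbourhood:
  assumes N: "compactin (Euclidean_space n) N" "x \<notin> N" and x: "x \<in> topspace (Euclidean_space n)"
  obtains d where "d > 0" "coord_box n (\<lambda>i. x i - d) (\<lambda>i. x i + d) \<inter> N = {}"
proof -
  have "closedin (Euclidean_space n) N"
    using N Hausdorff_Euclidean_space compactin_imp_closedin by blast
  then have "openin (Euclidean_space n) (topspace (Euclidean_space n) - N)" "x \<in> topspace (Euclidean_space n) - N"
    using N x by auto
  then obtain d where "d > 0"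
    "\<And>u. \<lbrakk>u \<in> topspace (Euclidean_space n); \<And>i. i < n \<Longrightarrow> \<bar>u i - x i\<bar> \<le> d\<rbrakk> \<Longrightarrow> u \<in> topspace (Euclidean_space n) - N"
    by (rule Euclidean_box_neighbourhood) blast
  then show thesis
    by (intro that [of d]) (auto simp: coord_box_def abs_le_iff algebra_simps)
qed

text \<open>Nullness at \<open>x\<close> leaves, up to doubles, a remainder with compact support off
  \<open>x\<close>, so it persists relative to the complement of a small box. Finitely many boxes
  cover \<open>K\<close>, and \<open>mod2_null_Union_boxes\<close> combines them.\<close>

lemma mod2_null_locally_imp_null:
  assumes K: "compactin (Euclidean_space n) K" and c: "singular_chain n (Euclidean_space n) c"
    and loc: "\<And>x. x \<in> K \<Longrightarrow> mod2_null n (Euclidean_space n) (- {x}) c"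
  shows "mod2_null n (Euclidean_space n) (- K) c"
proof -
  let ?E = "Euclidean_space n"
  have KE: "K \<subseteq> topspace ?E"
    using K compactin_subset_topspace by blast
  have "\<forall>x\<in>K. \<exists>d>0. mod2_null n ?E (- coord_box n (\<lambda>i. x i - d) (\<lambda>i. x i + d)) c"
  proof
    fix x assume x: "x \<in> K"
    obtain e where e: "singular_chain (Suc n) ?E e" and m: "mod2_chain n ?E (- {x}) (c - chain_boundary (Suc n) e)"
      using loc [OF x] unfolding mod2_null_def by blast
    obtain s u where s: "singular_chain n (subtopology ?E (- {x})) s" and u: "singular_chain n ?E u"
      and eq: "c - chain_boundary (Suc n) e = s + (u + u)"
      using m by (rule mod2_chainE)
    obtain N where N: "compactin ?E N" "N \<subseteq> - {x}" "singular_chain n (subtopology ?E N) s"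
      by (rule singular_chain_compact_support [OF s])
    obtain d where d: "d > 0" "coord_box n (\<lambda>i. x i - d) (\<lambda>i. x i + d) \<inter> N = {}"
      using mod2_null_box_neighbourhood [OF N(1), of x] N(2) x KE by blast
    have "mod2_chain n ?E (- coord_box n (\<lambda>i. x i - d) (\<lambda>i. x i + d)) (s + (u + u))"
      using d(2) mod2_chain_mono [OF mod2_chain_of [OF N(3)]] by (intro mod2_chain_add mod2_chain_double u) blast
    then have "mod2_null n ?E (- coord_box n (\<lambda>i. x i - d) (\<lambda>i. x i + d)) c"
      using e eq unfolding mod2_null_def by metis
    with d(1) show "\<exists>d>0. mod2_null n ?E (- coord_box n (\<lambda>i. x i - d) (\<lambda>i. x i + d)) c"
      by blast
  qed
  from bchoice [OF this] obtain d where
    d: "\<And>x. x \<in> K \<Longrightarrow> d x > 0 \<and> mod2_null n ?E (- coord_box n (\<lambda>i. x i - d x) (\<lambda>i. x i + d x)) c"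
    by blast
  let ?O = "\<lambda>x. {u \<in> topspace ?E. \<forall>i<n. \<bar>u i - x i\<bar> < d x}"
  let ?B = "\<lambda>x. coord_box n (\<lambda>i. x i - d x) (\<lambda>i. x i + d x)"
  have "K \<subseteq> \<Union>(?O ` K)"
    using d KE by fastforce
  then have "(\<forall>V\<in>?O ` K. openin ?E V) \<and> K \<subseteq> \<Union>(?O ` K)"
    using openin_Euclidean_box by blast
  with K have "\<exists>\<F>. finite \<F> \<and> \<F> \<subseteq> ?O ` K \<and> K \<subseteq> \<Union>\<F>"
    unfolding compactin_def by blast
  then obtain \<F> where \<F>: "finite \<F>" "\<F> \<subseteq> ?O ` K" "K \<subseteq> \<Union>\<F>"
    by (elim exE conjE) (rule that)
  from finite_subset_image [OF \<F>(1,2)] obtain T where "T \<subseteq> K" "finite T" "\<F> = ?O ` T"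
    by (elim exE conjE) (rule that)
  with \<F>(3) have T: "finite T" "T \<subseteq> K" "K \<subseteq> \<Union>(?O ` T)"
    by simp_all
  have "mod2_null n ?E (- \<Union>(?B ` T)) c"
    using T d by (intro mod2_null_Union_boxes c) blast+
  moreover have "?O x \<subseteq> ?B x" for x
    by (auto simp: coord_box_def abs_less_iff algebra_simps less_imp_le)
  then have "\<Union>(?O ` T) \<subseteq> \<Union>(?B ` T)"
    by (rule UN_mono [OF subset_refl])
  with T(3) have "K \<subseteq> \<Union>(?B ` T)"
    by (rule order_trans)
  ultimately show ?thesis
    by (elim mod2_null_mono) blast
qed

text \<open>At an interior point the local homology modulo 2 has a single nonzero class, so being
  nonzero at each point of \<open>K\<close> means being a generator there.\<close>

definition fundamental_on :: "nat \<Rightarrow> 'a topology \<Rightarrow> 'a set \<Rightarrow> 'a chain \<Rightarrow> bool" where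
  "fundamental_on n M K c \<longleftrightarrow> mod2_cycle n M (- K) c \<and> (\<forall>x\<in>K. \<not> mod2_null n M (- {x}) c)"

text \<open>The boundary of a local generator at \<open>x\<close> has, up to doubles, compact
  support off \<open>x\<close>, so the generator is a cycle relative to the complement of a small
  box. By \<open>mod2_null_box\<close>, if it were null at one point of the box, it would be null at
  \<open>x\<close> too.\<close>

lemma fundamental_on_box_exists:
  assumes x: "x \<in> topspace (Euclidean_space n)"
  obtains d c where "d > 0" "fundamental_on n (Euclidean_space n) (coord_box n (\<lambda>i. x i - d) (\<lambda>i. x i + d)) c"
proof -
  let ?E = "Euclidean_space n"
  obtain c where c: "mod2_cycle n ?E (- {x}) c" "\<not> mod2_null n ?E (- {x}) c"
    using local_Z2_Euclidean_space [OF x] unfolding local_Z2_def by blast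
  then have sc: "singular_chain n ?E c" and m: "mod2_chain (n - Suc 0) ?E (- {x}) (chain_boundary n c)"
    by (auto simp: mod2_cycle_def)
  obtain s u where s: "singular_chain (n - Suc 0) (subtopology ?E (- {x})) s" and u: "singular_chain (n - Suc 0) ?E u"
    and eq: "chain_boundary n c = s + (u + u)"
    using m by (rule mod2_chainE)
  obtain N where N: "compactin ?E N" "N \<subseteq> - {x}" "singular_chain (n - Suc 0) (subtopology ?E N) s"
    by (rule singular_chain_compact_support [OF s])
  obtain d where d: "d > 0" "coord_box n (\<lambda>i. x i - d) (\<lambda>i. x i + d) \<inter> N = {}"
    using mod2_null_box_neighbourhood [OF N(1), of x] N(2) x by blast
  let ?L = "coord_box n (\<lambda>i. x i - d) (\<lambda>i. x i + d)"
  have "mod2_chain (n - Suc 0) ?E (- ?L) (s + (u + u))"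
    using d(2) mod2_chain_mono [OF mod2_chain_of [OF N(3)]] by (intro mod2_chain_add mod2_chain_double u) blast
  then have cL: "mod2_cycle n ?E (- ?L) c"
    using sc eq by (simp add: mod2_cycle_def)
  have xL: "x \<in> ?L"
    using x d(1) by (simp add: coord_box_def)
  have "\<not> mod2_null n ?E (- {y}) c" if "y \<in> ?L" for y
  proof
    assume "mod2_null n ?E (- {y}) c"
    from mod2_null_box [OF cL that this] have "mod2_null n ?E (- {x}) c"
      by (rule mod2_null_mono) (use xL in auto)
    with c(2) show False by blast
  qed
  then show thesis
    using that [OF d(1)] cL unfolding fundamental_on_def by blast
qed

text \<open>\<open>good_piece\<close>: a compact piece of the manifold on which a fundamental class exists and classes
  are determined locally, so that fundamental classes on good pieces can be glued.\<close>

definition good_piece :: "nat \<Rightarrow> 'a topology \<Rightarrow> 'a set \<Rightarrow> bool" where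
  "good_piece n M L \<longleftrightarrow> compactin M L \<and> (\<forall>x\<in>L. local_Z2 n M x) \<and> (\<exists>c. fundamental_on n M L c) \<and>
     (\<forall>K c. compactin M K \<and> K \<subseteq> L \<and> mod2_cycle n M (- K) c \<and> (\<forall>x\<in>K. mod2_null n M (- {x}) c)
        \<longrightarrow> mod2_null n M (- K) c)"

text \<open>The preimage of a box in a chart around \<open>y\<close> is a good piece. The class
  comes from \<open>fundamental_on_box_exists\<close>, and local determination from
  \<open>mod2_null_locally_imp_null\<close> after excision to the chart.\<close>

lemma good_piece_neighbourhood:
  assumes M: "Hausdorff_space M" and y: "euclidean_point n M y"
  obtains V L where "openin M V" "y \<in> V" "V \<subseteq> L" "good_piece n M L"
proof -
  let ?E = "Euclidean_space n"
  obtain U where U: "openin M U" "y \<in> U" "subtopology M U homeomorphic_space ?E"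
    using y by (auto simp: euclidean_point_def)
  let ?U = "subtopology M U"
  obtain f g where fg: "homeomorphic_maps ?U ?E f g"
    using U(3) unfolding homeomorphic_space_def by blast
  have UM: "U \<subseteq> topspace M"
    using U openin_subset by blast
  have cf: "continuous_map ?U ?E f" and cg: "continuous_map ?E ?U g"
    and gf: "\<And>x. x \<in> U \<Longrightarrow> g (f x) = x" and fg': "\<And>u. u \<in> topspace ?E \<Longrightarrow> f (g u) = u"
    using fg UM by (auto simp: homeomorphic_maps_def)
  have fE: "f x \<in> topspace ?E" if "x \<in> U" for x
    using cf that UM by (auto simp: continuous_map_def Pi_iff)
  have gU: "g u \<in> U" if "u \<in> topspace ?E" for u
    using cg that by (auto simp: continuous_map_def Pi_iff)
  have euc: "local_Z2 n M x" if "x \<in> U" for x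
    using that U by (intro local_Z2_euclidean_point [OF M]) (auto simp: euclidean_point_def)
  have cl: "closedin M {x}" if "x \<in> U" for x
    using M that UM by (auto simp: closedin_Hausdorff_singleton)
  obtain d c0 where d: "d > 0" and c0: "fundamental_on n ?E (coord_box n (\<lambda>i. f y i - d) (\<lambda>i. f y i + d)) c0"
    by (rule fundamental_on_box_exists [OF fE [OF U(2)]])
  let ?L0 = "coord_box n (\<lambda>i. f y i - d) (\<lambda>i. f y i + d)"
  let ?O0 = "{u \<in> topspace ?E. \<forall>i<n. \<bar>u i - f y i\<bar> < d}"
  have L0: "?L0 \<subseteq> topspace ?E" "?O0 \<subseteq> ?L0"
    by (auto simp: coord_box_def abs_less_iff algebra_simps less_imp_le)
  define L where "L = g ` ?L0"
  define V where "V = g ` ?O0"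
  have LU: "L \<subseteq> U"
    using gU L0(1) by (auto simp: L_def)
  have "homeomorphic_map ?E ?U g"
    using fg homeomorphic_maps_map by blast
  then have "openin ?U V"
    unfolding V_def using openin_Euclidean_box homeomorphic_map_openness_eq by blast
  then have oV: "openin M V"
    using U(1) openin_open_subtopology by blast
  have "f y \<in> ?O0"
    using fE [OF U(2)] d by auto
  then have yV: "y \<in> V"
    unfolding V_def using gf [OF U(2)] by force
  have VL: "V \<subseteq> L"
    unfolding V_def L_def using L0(2) by blast
  have cL: "compactin M L"
    using image_compactin [OF compactin_coord_box cg] by (simp add: L_def compactin_subtopology)
  have nullE: "mod2_null n ?E (- {f x}) (chain_map n f a)"
    if x: "x \<in> U" and a: "singular_chain n ?U a" and na: "mod2_null n M (- {x}) a" for x a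
  proof -
    have "mod2_null n ?U (- {x}) a"
      by (rule mod2_null_excise_point [OF U(1) x cl [OF x] a na])
    then show ?thesis
    proof (rule mod2_null_chain_map [OF _ cf])
      show "f \<in> topspace ?U \<inter> - {x} \<rightarrow> - {f x}"
        using gf x by (auto simp: Pi_iff) (metis)
    qed
  qed
  have "\<exists>c. fundamental_on n M L c"
  proof (intro exI)
    let ?c = "chain_map n g c0"
    have c0': "mod2_cycle n ?E (- ?L0) c0" "\<And>u. u \<in> ?L0 \<Longrightarrow> \<not> mod2_null n ?E (- {u}) c0"
      using c0 by (auto simp: fundamental_on_def)
    have "g \<in> topspace ?E \<inter> - ?L0 \<rightarrow> - L"
    proof
      fix u assume u: "u \<in> topspace ?E \<inter> - ?L0"
      show "g u \<in> - L"
      proof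
        assume "g u \<in> L"
        then obtain v where "v \<in> ?L0" "g u = g v"
          by (auto simp: L_def)
        then have "u = v"
          using u L0(1) fg' by (metis IntD1 subsetD)
        with u \<open>v \<in> ?L0\<close> show False by blast
      qed
    qed
    then have cU: "mod2_cycle n ?U (- L) ?c"
      by (rule mod2_cycle_chain_map [OF c0'(1) cg])
    then have sU: "singular_chain n ?U ?c"
      by (simp add: mod2_cycle_def)
    have inv: "chain_map n f ?c = c0"
      using chain_map_inverse [OF homeomorphic_maps_sym [THEN iffD1, OF fg]] c0'(1) by (simp add: mod2_cycle_def)
    have "\<not> mod2_null n M (- {x}) ?c" if "x \<in> L" for x
    proof
      assume "mod2_null n M (- {x}) ?c"
      then have "mod2_null n ?E (- {f x}) c0"
        using nullE [of x ?c] that LU sU inv by auto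
      moreover have "f x \<in> ?L0"
        using that fg' L0(1) by (force simp: L_def)
      ultimately show False
        using c0'(2) by blast
    qed
    then show "fundamental_on n M L ?c"
      unfolding fundamental_on_def using mod2_cycle_from_subtopology [OF cU] by blast
  qed
  moreover have "mod2_null n M (- K) c"
    if K: "compactin M K" "K \<subseteq> L" and c: "mod2_cycle n M (- K) c" and loc: "\<And>x. x \<in> K \<Longrightarrow> mod2_null n M (- {x}) c" for K c
  proof -
    have KU: "K \<subseteq> U" using K LU by blast
    have "closedin M K"
      using M K compactin_imp_closedin by blast
    then have oK: "openin M (topspace M - K)" by blast
    have c': "singular_chain n M c" "mod2_chain (n - Suc 0) M (topspace M - K) (chain_boundary n c)"
      using c by (auto simp: mod2_cycle_def mod2_restrict_Diff)
    obtain a where a: "singular_chain n ?U a" "mod2_null n M (topspace M - K) (c - a)"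
      by (rule mod2_excise_cycle [OF U(1) oK _ c']) (use KU in blast)+
    then have ca: "mod2_null n M (- K) (c - a)"
      by (simp add: mod2_restrict_Diff)
    have "mod2_null n ?E (- (f ` K)) (chain_map n f a)"
    proof (rule mod2_null_locally_imp_null)
      have "compactin ?U K"
        using K KU by (simp add: compactin_subtopology)
      then show "compactin ?E (f ` K)"
        using cf image_compactin by blast
      show "singular_chain n ?E (chain_map n f a)"
        by (rule singular_chain_chain_map [OF a(1) cf])
      fix u assume "u \<in> f ` K"
      then obtain x where x: "x \<in> K" "u = f x" by blast
      have "mod2_null n M (- {x}) (c - a)"
        by (rule mod2_null_mono [OF ca]) (use x in auto)
      from mod2_null_diff [OF loc [OF x(1)] this] have "mod2_null n M (- {x}) a" by simp
      then show "mod2_null n ?E (- {u}) (chain_map n f a)"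
        unfolding x(2) using x KU a(1) by (intro nullE) auto
    qed
    moreover have "g \<in> topspace ?E \<inter> - (f ` K) \<rightarrow> - K"
      using fg' by (force simp: image_iff)
    ultimately have "mod2_null n ?U (- K) (chain_map n g (chain_map n f a))"
      using mod2_null_chain_map [OF _ cg] by blast
    then have "mod2_null n M (- K) a"
      unfolding chain_map_inverse [OF fg a(1)] by (rule mod2_null_from_subtopology)
    from mod2_null_add [OF ca this] show ?thesis by simp
  qed
  ultimately have "good_piece n M L"
    unfolding good_piece_def using cL euc LU by blast
  then show thesis
    using that [OF oV yV VL] by blast
qed

text \<open>On the overlap both classes are the nonzero local class, so their difference is null at
  each point, and hence relative to the complement of the overlap because \<open>L\<close> is a good
  piece. Then \<open>mod2_glue\<close> joins them.\<close>

lemma fundamental_on_Union: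
  assumes M: "Hausdorff_space M" and "finite F" "\<And>L. L \<in> F \<Longrightarrow> good_piece n M L"
  shows "\<exists>c. fundamental_on n M (\<Union>F) c"
  using assms(2,3)
proof (induction F rule: finite_induct)
  case empty
  have "fundamental_on n M {} 0"
    by (simp add: fundamental_on_def mod2_cycle_def)
  then show ?case by auto
next
  case (insert L F)
  obtain c1 where c1: "fundamental_on n M (\<Union>F) c1"
    using insert by auto
  have L: "good_piece n M L" using insert.prems by blast
  then obtain c2 where c2: "fundamental_on n M L c2"
    by (auto simp: good_piece_def)
  have cpF: "compactin M (\<Union>F)"
    using insert by (intro compactin_Union) (auto simp: good_piece_def)
  have cpL: "compactin M L"
    using L by (simp add: good_piece_def)
  have clF: "closedin M (\<Union>F)" and clL: "closedin M L"
    using M cpF cpL compactin_imp_closedin by auto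
  let ?K = "\<Union>F \<inter> L"
  have c1': "mod2_cycle n M (- \<Union>F) c1" "\<And>x. x \<in> \<Union>F \<Longrightarrow> \<not> mod2_null n M (- {x}) c1"
    and c2': "mod2_cycle n M (- L) c2" "\<And>x. x \<in> L \<Longrightarrow> \<not> mod2_null n M (- {x}) c2"
    using c1 c2 by (auto simp: fundamental_on_def)
  have "mod2_null n M (- ?K) (c1 - c2)"
  proof -
    have "compactin M ?K"
      using cpF clL by (simp add: Int_commute closed_Int_compactin)
    moreover have "mod2_cycle n M (- ?K) (c1 - c2)"
      by (intro mod2_cycle_diff mod2_cycle_mono [OF c1'(1)] mod2_cycle_mono [OF c2'(1)]) auto
    moreover have "mod2_null n M (- {x}) (c1 - c2)" if x: "x \<in> ?K" for x
    proof (rule local_Z2_diff)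
      show "local_Z2 n M x"
        using L x by (auto simp: good_piece_def)
      show "mod2_cycle n M (- {x}) c1"
        by (rule mod2_cycle_mono [OF c1'(1)]) (use x in auto)
      show "mod2_cycle n M (- {x}) c2"
        by (rule mod2_cycle_mono [OF c2'(1)]) (use x in auto)
    qed (use c1' c2' x in auto)
    ultimately show ?thesis
      using L unfolding good_piece_def by (metis inf_le2)
  qed
  moreover have eq: "topspace M - ?K = (topspace M - \<Union>F) \<union> (topspace M - L)" by blast
  ultimately have null: "mod2_null n M ((topspace M - \<Union>F) \<union> (topspace M - L)) (c1 - c2)"
    unfolding eq [symmetric] by (simp add: mod2_restrict_Diff)
  have o: "openin M (topspace M - \<Union>F)" "openin M (topspace M - L)"
    using clF clL by auto
  have b1: "singular_chain n M c1" "mod2_chain (n - Suc 0) M (topspace M - \<Union>F) (chain_boundary n c1)"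
    using c1'(1) by (auto simp: mod2_cycle_def mod2_restrict_Diff)
  have b2: "singular_chain n M c2" "mod2_chain (n - Suc 0) M (topspace M - L) (chain_boundary n c2)"
    using c2'(1) by (auto simp: mod2_cycle_def mod2_restrict_Diff)
  obtain c where c: "singular_chain n M c"
    "mod2_chain (n - Suc 0) M ((topspace M - \<Union>F) \<inter> (topspace M - L)) (chain_boundary n c)"
    "mod2_null n M (topspace M - \<Union>F) (c - c1)" "mod2_null n M (topspace M - L) (c - c2)"
    by (rule mod2_glue [OF o b1 b2 null])
  have eq': "(topspace M - \<Union>F) \<inter> (topspace M - L) = topspace M - \<Union>(insert L F)" by blast
  have "mod2_cycle n M (- \<Union>(insert L F)) c"
    using c(1,2) unfolding eq' by (simp only: mod2_restrict_Diff mod2_cycle_def)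
  moreover have "\<not> mod2_null n M (- {x}) c" if "x \<in> \<Union>(insert L F)" for x
  proof
    assume nx: "mod2_null n M (- {x}) c"
    show False
    proof (cases "x \<in> L")
      case True
      have "mod2_null n M (- {x}) (c - c2)"
        by (rule mod2_null_mono [OF c(4) [unfolded mod2_restrict_Diff]]) (use True in auto)
      from mod2_null_diff [OF nx this] show False
        using c2'(2) [OF True] by simp
    next
      case False
      then have xF: "x \<in> \<Union>F" using that by auto
      have "mod2_null n M (- {x}) (c - c1)"
        by (rule mod2_null_mono [OF c(3) [unfolded mod2_restrict_Diff]]) (use xF in auto)
      from mod2_null_diff [OF nx this] show False
        using c1'(2) [OF xF] by simp
    qed
  qed
  ultimately show ?case
    unfolding fundamental_on_def by blast
qed

lemma fundamental_class_exists:
  assumes M: "Hausdorff_space M" and K: "compactin M K" and eu: "\<And>x. x \<in> K \<Longrightarrow> euclidean_point n M x"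
  obtains c where "fundamental_on n M K c"
proof -
  have "\<forall>y\<in>K. \<exists>V. openin M V \<and> y \<in> V \<and> (\<exists>L. V \<subseteq> L \<and> good_piece n M L)"
  proof
    fix y assume "y \<in> K"
    then show "\<exists>V. openin M V \<and> y \<in> V \<and> (\<exists>L. V \<subseteq> L \<and> good_piece n M L)"
      using good_piece_neighbourhood [OF M eu] by metis
  qed
  from bchoice [OF this] obtain V where V: "\<forall>y\<in>K. openin M (V y) \<and> y \<in> V y \<and> (\<exists>L. V y \<subseteq> L \<and> good_piece n M L)"
    by blast
  then have "\<forall>y\<in>K. \<exists>L. V y \<subseteq> L \<and> good_piece n M L" by blast
  from bchoice [OF this] obtain L where L: "\<forall>y\<in>K. V y \<subseteq> L y \<and> good_piece n M (L y)" by blast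
  have "(\<forall>U\<in>V ` K. openin M U) \<and> K \<subseteq> \<Union>(V ` K)"
    using V by blast
  with K have "\<exists>\<F>. finite \<F> \<and> \<F> \<subseteq> V ` K \<and> K \<subseteq> \<Union>\<F>"
    unfolding compactin_def by blast
  then obtain \<F> where \<F>: "finite \<F>" "\<F> \<subseteq> V ` K" "K \<subseteq> \<Union>\<F>"
    by (elim exE conjE) (rule that)
  from finite_subset_image [OF \<F>(1,2)] obtain T where "T \<subseteq> K" "finite T" "\<F> = V ` T"
    by (elim exE conjE) (rule that)
  with \<F>(3) have T: "finite T" "T \<subseteq> K" "K \<subseteq> \<Union>(V ` T)"
    by simp_all
  have "\<exists>c. fundamental_on n M (\<Union>(L ` T)) c"
    by (rule fundamental_on_Union [OF M]) (use T L in auto)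
  then obtain c where c: "fundamental_on n M (\<Union>(L ` T)) c" by blast
  have "K \<subseteq> \<Union>(L ` T)"
    using T L by blast
  then have "fundamental_on n M K c"
    using c mod2_cycle_mono [of n M "- \<Union>(L ` T)" c "- K"] unfolding fundamental_on_def by blast
  then show thesis by (rule that)
qed

section \<open>Collapsing onto a chart\<close>

lemma compact_space_nsphere: "compact_space (nsphere n)"
proof -
  let ?C = "{x :: nat \<Rightarrow> real. (\<Sum>i\<le>n. (x i)\<^sup>2) = 1 \<and> (\<forall>i>n. x i = 0)}"
  have sum: "closed {x :: nat \<Rightarrow> real. (\<Sum>i\<le>n. (x i)\<^sup>2) = 1}"
    by (intro closed_Collect_eq continuous_intros continuous_on_coordinate)
  have zero: "closed (\<Inter>i\<in>{n<..}. {x :: nat \<Rightarrow> real. x i = 0})"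
    by (intro closed_INT ballI closed_Collect_eq continuous_on_coordinate continuous_on_const)
  have "?C = {x. (\<Sum>i\<le>n. (x i)\<^sup>2) = 1} \<inter> (\<Inter>i\<in>{n<..}. {x. x i = 0})"
    by auto
  with closed_Int [OF sum zero] have "closed ?C"
    by (rule ssubst [where P = closed, rotated])
  then have "closedin (powertop_real UNIV) ?C"
    by (simp add: euclidean_product_topology)
  moreover have "compactin (powertop_real UNIV) (\<Pi>\<^sub>E i\<in>UNIV. {-1..1})"
    by (auto simp: compactin_PiE)
  moreover have "?C \<subseteq> (\<Pi>\<^sub>E i\<in>UNIV. {-1..1})"
  proof
    fix x assume x: "x \<in> ?C"
    have "x i \<in> {-1..1}" for i
    proof (cases "i \<le> n")
      case True
      then have "(x i)\<^sup>2 \<le> (\<Sum>i\<le>n. (x i)\<^sup>2)"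
        by (intro member_le_sum) auto
      then have "(x i)\<^sup>2 \<le> 1" using x by simp
      then show ?thesis
        using abs_square_le_1 [of "x i"] by (auto simp: abs_le_iff)
    qed (use x in auto)
    then show "x \<in> (\<Pi>\<^sub>E i\<in>UNIV. {-1..1})" by auto
  qed
  ultimately have "compactin (powertop_real UNIV) ?C"
    using closed_compactin by blast
  then show ?thesis
    by (simp add: nsphere compact_space_subtopology)
qed

lemma euclidean_imp_not_boundary_point: "euclidean_point n M x \<Longrightarrow> \<not> boundary_point n M x"
  using not_euclidean_and_boundary_point by (intro notI)

text \<open>By \<open>not_euclidean_and_boundary_point\<close> the complement consists of the
  Euclidean points, and the chart of one such point serves all points in its domain.\<close>

lemma closedin_manifold_boundary:
  assumes "manifold_with_boundary n M"
  shows "closedin M (manifold_boundary n M)"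
proof -
  let ?E = "{x \<in> topspace M. euclidean_point n M x}"
  have eq: "topspace M - manifold_boundary n M = ?E"
  proof (intro equalityI subsetI)
    fix x assume "x \<in> topspace M - manifold_boundary n M"
    then show "x \<in> ?E"
      using assms by (simp add: manifold_with_boundary_def manifold_boundary_def) blast
  next
    fix x assume "x \<in> ?E"
    then show "x \<in> topspace M - manifold_boundary n M"
      by (simp add: manifold_boundary_def euclidean_imp_not_boundary_point)
  qed
  have "\<exists>U. openin M U \<and> x \<in> U \<and> U \<subseteq> ?E" if "x \<in> ?E" for x
  proof -
    have "euclidean_point n M x" using that by simp
    then obtain U where U: "openin M U" "x \<in> U" "subtopology M U homeomorphic_space Euclidean_space n"
      unfolding euclidean_point_def by (elim exE conjE) (rule that)
    have "U \<subseteq> ?E"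
    proof
      fix y assume y: "y \<in> U"
      then have "euclidean_point n M y"
        unfolding euclidean_point_def using U(1,3) by (intro exI [of _ U] conjI)
      then show "y \<in> ?E"
        using y openin_subset [OF U(1)] by auto
    qed
    with U(1,2) show ?thesis by blast
  qed
  then have "openin M ?E"
    by (subst openin_subopen) (rule ballI)
  then show ?thesis
    unfolding closedin_def eq by (auto simp: manifold_boundary_def)
qed

text \<open>A half-space chart is onto, so it contains points with positive last coordinate, which
  are Euclidean.\<close>

lemma manifold_with_boundary_has_euclidean_point:
  assumes "manifold_with_boundary n M" "topspace M \<noteq> {}"
  obtains x where "x \<in> topspace M" "euclidean_point n M x"
proof -
  obtain y where y: "y \<in> topspace M" "euclidean_point n M y \<or> boundary_point n M y"
    using assms unfolding manifold_with_boundary_def by blast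
  show thesis
  proof (cases "euclidean_point n M y")
    case True
    with y that show thesis by blast
  next
    case False
    with y obtain U h where U: "openin M U" and h: "homeomorphic_map (subtopology M U) (half_space n) h" and "0 < n"
      unfolding boundary_point_def by blast
    define e where "e = (\<lambda>i. if i = n - 1 then 1 else (0::real))"
    have "e \<in> topspace (half_space n)"
      using \<open>0 < n\<close> by (auto simp: e_def half_space_def topspace_Euclidean_space)
    moreover have "h ` topspace (subtopology M U) = topspace (half_space n)"
      using h by (rule homeomorphic_imp_surjective_map)
    ultimately obtain x where x: "x \<in> topspace (subtopology M U)" "h x = e"
      by (metis imageE)
    have "euclidean_point n M x"
      by (rule euclidean_point_half_space_interior [OF U _ h _ \<open>0 < n\<close>]) (use x in \<open>auto simp: e_def\<close>)
    then show thesis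
      using that x by auto
  qed
qed

text \<open>Continuity at the points sent to \<open>p\<close> rests on compactness: the complement
  of an open set around \<open>p\<close> is compact in the punctured sphere, so its image under
  \<open>g\<close> is closed in the Hausdorff space \<open>M\<close>.\<close>

lemma continuous_map_collapse:
  assumes M: "Hausdorff_space M" and U: "openin M U" and p: "p \<in> topspace (nsphere n)"
    and h: "homeomorphic_maps (subtopology M U) (subtopology (nsphere n) (topspace (nsphere n) - {p})) f g"
  shows "continuous_map M (nsphere n) (\<lambda>y. if y \<in> U then f y else p)"
proof -
  let ?N = "nsphere n" and ?F = "\<lambda>y. if y \<in> U then f y else p"
  let ?V = "topspace ?N - {p}"
  have UM: "U \<subseteq> topspace M" using U openin_subset by blast
  have cf: "continuous_map (subtopology M U) (subtopology ?N ?V) f" and cg: "continuous_map (subtopology ?N ?V) (subtopology M U) g"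
    and gf: "\<And>y. y \<in> U \<Longrightarrow> g (f y) = y" and fg: "\<And>v. v \<in> ?V \<Longrightarrow> f (g v) = v"
    using h UM by (auto simp: homeomorphic_maps_def)
  have fV: "f y \<in> ?V" if "y \<in> U" for y
    using cf that UM by (auto simp: continuous_map_def Pi_iff)
  have gU: "g v \<in> U" if "v \<in> ?V" for v
    using cg that by (auto simp: continuous_map_def Pi_iff)
  show ?thesis
    unfolding continuous_map_def
  proof (intro conjI allI impI)
    show "?F \<in> topspace M \<rightarrow> topspace ?N"
      using fV p by auto
    fix W assume W: "openin ?N W"
    show "openin M {y \<in> topspace M. ?F y \<in> W}"
    proof (cases "p \<in> W")
      case False
      then have "{y \<in> topspace M. ?F y \<in> W} = {y \<in> topspace (subtopology M U). f y \<in> W}"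
        using UM by auto
      moreover have "openin (subtopology M U) {y \<in> topspace (subtopology M U). f y \<in> W}"
        using cf W by (intro openin_continuous_map_preimage [where Y = ?N]) (auto intro: continuous_map_into_fulltopology)
      ultimately show ?thesis
        using U openin_trans_full by metis
    next
      case True
      let ?C = "topspace ?N - W"
      have "compactin ?N ?C"
        using W compact_space_nsphere by (intro closedin_compact_space) auto
      then have "compactin (subtopology ?N ?V) ?C"
        using True by (auto simp: compactin_subtopology)
      from image_compactin [OF this cg] have "closedin M (g ` ?C)"
        by (intro compactin_imp_closedin [OF M]) (auto simp: compactin_subtopology)
      moreover have "{y \<in> topspace M. ?F y \<in> W} = topspace M - g ` ?C"
      proof (intro equalityI subsetI)
        fix y assume y: "y \<in> {y \<in> topspace M. ?F y \<in> W}"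
        have "y \<notin> g ` ?C"
        proof
          assume "y \<in> g ` ?C"
          then obtain v where v: "v \<in> ?C" "y = g v" by blast
          then have "v \<in> ?V" using True by blast
          then show False using y v gU fg by auto
        qed
        with y show "y \<in> topspace M - g ` ?C" by blast
      next
        fix y assume y: "y \<in> topspace M - g ` ?C"
        have "?F y \<in> W"
        proof (cases "y \<in> U")
          case U: True
          show ?thesis
          proof (rule ccontr)
            assume "?F y \<notin> W"
            then have "f y \<in> ?C" using U fV by auto
            then have "g (f y) \<in> g ` ?C" by blast
            with y gf [OF U] show False by simp
          qed
        qed (use True in auto)
        with y show "y \<in> {y \<in> topspace M. ?F y \<in> W}" by blast
      qed
      ultimately show ?thesis by auto
    qed
  qed
qed

text \<open>The collapse onto the one-point compactification of a chart is essential: along a null-homotopy, the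
  preimage of a point \<open>q \<noteq> p\<close> is compact and misses the boundary, so the image of a mod 2 fundamental class
  on it is null at \<open>q\<close>, although the collapse is a homeomorphism near its only preimage of \<open>q\<close>.\<close>

lemma boundary_pair_in_H:
  assumes p: "p \<in> topspace (nsphere n)" and cM: "compact_space M" and ne: "topspace M \<noteq> {}"
    and mf: "manifold_with_boundary n M"
  shows "in_H n p M (manifold_boundary n M)"
proof -
  let ?N = "nsphere n" and ?B = "manifold_boundary n M"
  let ?V = "topspace ?N - {p}"
  have HM: "Hausdorff_space M"
    using mf by (simp add: manifold_with_boundary_def)
  have cB: "compactin M ?B"
    using closedin_compact_space [OF cM closedin_manifold_boundary [OF mf]] .
  obtain x0 where "x0 \<in> topspace M" "euclidean_point n M x0"
    by (rule manifold_with_boundary_has_euclidean_point [OF mf ne])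
  then obtain U where U: "openin M U" "x0 \<in> U" and hU: "subtopology M U homeomorphic_space Euclidean_space n"
    unfolding euclidean_point_def by blast
  have UM: "U \<subseteq> topspace M"
    using U openin_subset by blast
  have Ueuc: "euclidean_point n M y" if "y \<in> U" for y
    using that U(1) hU unfolding euclidean_point_def by blast
  have "subtopology M U homeomorphic_space subtopology ?N ?V"
    using hU nsphere_punctured_homeomorphic [OF p] by (rule homeomorphic_space_trans)
  then obtain f g where fg: "homeomorphic_maps (subtopology M U) (subtopology ?N ?V) f g"
    unfolding homeomorphic_space_def by blast
  define F where "F = (\<lambda>y. if y \<in> U then f y else p)"
  have cF: "continuous_map M ?N F"
    unfolding F_def by (rule continuous_map_collapse [OF HM U(1) p fg])
  have Fg: "homeomorphic_maps (subtopology M U) (subtopology ?N ?V) F g"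
    by (rule homeomorphic_maps_eq [OF fg]) (auto simp: F_def)
  have cF': "continuous_map (subtopology M U) (subtopology ?N ?V) F" and cg: "continuous_map (subtopology ?N ?V) (subtopology M U) g"
    and gF: "\<And>y. y \<in> U \<Longrightarrow> g (F y) = y" and Fg': "\<And>v. v \<in> ?V \<Longrightarrow> F (g v) = v"
    using Fg UM by (auto simp: homeomorphic_maps_def)
  have FV: "F y \<in> ?V" if "y \<in> U" for y
    using cF' that UM by (auto simp: continuous_map_def Pi_iff)
  have FB: "F a = p" if "a \<in> ?B" for a
    using that by (auto simp: F_def manifold_boundary_def dest: Ueuc euclidean_imp_not_boundary_point)
  \<comment> \<open>\<open>F\<close> takes the value \<open>q\<close> at \<open>x0\<close> only, so
    the class of the image at \<open>q\<close> depends only on what happens at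
    \<open>x0\<close>.\<close>
  define q where "q = F x0"
  have q: "q \<in> topspace ?N" "q \<noteq> p"
    using FV [OF U(2)] by (auto simp: q_def)
  have Fq: "F y \<noteq> q" if "y \<noteq> x0" for y
  proof (cases "y \<in> U")
    case True
    show ?thesis
    proof
      assume "F y = q"
      then have "g (F y) = g (F x0)" by (simp add: q_def)
      with gF [OF True] gF [OF U(2)] that show False by simp
    qed
  next
    case False
    with q show ?thesis by (simp add: F_def)
  qed
  have "\<not> homotopic_with (\<lambda>g. \<forall>a\<in>?B. g a = p) M ?N F (\<lambda>x. p)"
  proof
    assume "homotopic_with (\<lambda>g. \<forall>a\<in>?B. g a = p) M ?N F (\<lambda>x. p)"
    then obtain H where cH: "continuous_map (prod_topology interval M) ?N H"
      and H0: "\<And>x. H (0, x) = F x" and H1: "\<And>x. H (1, x) = p"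
      and HB: "\<And>t a. \<lbrakk>t \<in> {0..1}; a \<in> ?B\<rbrakk> \<Longrightarrow> H (t, a) = p"
      unfolding homotopic_with_def by blast
    \<comment> \<open>The points that the homotopy carries through \<open>q\<close> at some time. It
      stays at \<open>p\<close> on the boundary, so \<open>K\<close> consists of interior points and
      carries a fundamental class.\<close>
    define K where "K = snd ` {z \<in> topspace (prod_topology interval M). H z \<in> {q}}"
    have "closedin (prod_topology interval M) {z \<in> topspace (prod_topology interval M). H z \<in> {q}}"
      by (rule closedin_continuous_map_preimage [OF cH closedin_nsphere_singleton [OF q(1)]])
    moreover have "closed_map (prod_topology interval M) M snd"
      by (rule Abstract_Topological_Spaces.closed_map_snd) (simp add: compact_space_subtopology)
    ultimately have "closedin M K"
      unfolding K_def closed_map_def by blast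
    then have cK: "compactin M K"
      by (rule closedin_compact_space [OF cM])
    have KM: "K \<subseteq> topspace M"
      by (auto simp: K_def)
    have KB: "y \<notin> ?B" if "y \<in> K" for y
      using that HB q(2) by (fastforce simp: K_def)
    have Keuc: "euclidean_point n M y" if "y \<in> K" for y
      using KB [OF that] KM that mf unfolding manifold_with_boundary_def manifold_boundary_def by blast
    have x0K: "x0 \<in> K"
      unfolding K_def using H0 U(2) UM q_def by (intro image_eqI [of _ _ "(0, x0)"]) auto
    obtain c where c: "fundamental_on n M K c"
      by (rule fundamental_class_exists [OF HM cK Keuc])
    have cyc: "mod2_cycle n M (- K) c" and nn: "\<not> mod2_null n M (- {x0}) c"
      using c x0K by (auto simp: fundamental_on_def)
    have sc: "singular_chain n M c" and bc: "mod2_chain (n - Suc 0) M (- K) (chain_boundary n c)"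
      using cyc by (auto simp: mod2_cycle_def)
    \<comment> \<open>Outside \<open>K\<close> the homotopy avoids \<open>q\<close>, so both ends
      give the same class at \<open>q\<close>; the constant end gives zero.\<close>
    have "mod2_null n ?N (- {q}) (chain_map n (\<lambda>x. H (1, x)) c - chain_map n (\<lambda>x. H (0, x)) c)"
    proof (rule mod2_null_homotopy [OF cH _ sc bc])
      fix t :: real and x assume "t \<in> {0..1}" "x \<in> topspace M" "x \<in> - K"
      then show "H (t, x) \<in> - {q}"
        by (force simp: K_def)
    qed
    then have hom: "mod2_null n ?N (- {q}) (chain_map n (\<lambda>x. p) c - chain_map n F c)"
      by (simp add: H0 H1)
    have "continuous_map M (subtopology ?N (- {q})) (\<lambda>x. p)"
      using p q by (auto simp: continuous_map_in_subtopology)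
    then have "mod2_null n ?N (- {q}) (chain_map n (\<lambda>x. p) c)"
      by (intro mod2_nullI mod2_chain_of singular_chain_chain_map [OF sc])
    from mod2_null_diff [OF this hom] have Fc: "mod2_null n ?N (- {q}) (chain_map n F c)"
      by simp
    have cl: "closedin M {x0}"
      using HM U(2) UM by (auto simp: closedin_Hausdorff_singleton)
    have "mod2_cycle n M (topspace M - {x0}) c"
      unfolding mod2_restrict_Diff by (rule mod2_cycle_mono [OF cyc]) (use x0K in auto)
    then have bc': "mod2_chain (n - Suc 0) M (topspace M - {x0}) (chain_boundary n c)"
      by (simp add: mod2_cycle_def)
    have op: "openin M (topspace M - {x0})"
      using cl by blast
    have cov: "topspace M \<subseteq> U \<union> (topspace M - {x0})"
      using U(2) by blast
    \<comment> \<open>Once excised to the chart, the class can be carried back by \<open>g\<close>,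
      the inverse of \<open>F\<close> there.\<close>
    obtain a where a: "singular_chain n (subtopology M U) a" "mod2_null n M (topspace M - {x0}) (c - a)"
      by (rule mod2_excise_cycle [OF U(1) op cov sc bc'])
    then have ca: "mod2_null n M (- {x0}) (c - a)"
      by (simp add: mod2_restrict_Diff)
    have "mod2_null n ?N (- {q}) (chain_map n F (c - a))"
      by (rule mod2_null_chain_map [OF ca cF]) (use Fq in auto)
    from mod2_null_diff [OF Fc this] have "mod2_null n ?N (- {q}) (chain_map n F a)"
      by (simp add: chain_map_diff)
    moreover have "openin ?N ?V"
      using closedin_nsphere_singleton [OF p] by blast
    moreover have "singular_chain n (subtopology ?N ?V) (chain_map n F a)"
      by (rule singular_chain_chain_map [OF a(1) cF'])
    ultimately have "mod2_null n (subtopology ?N ?V) (- {q}) (chain_map n F a)"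
      using q by (intro mod2_null_excise_point closedin_nsphere_singleton) auto
    then have "mod2_null n (subtopology M U) (- {x0}) (chain_map n g (chain_map n F a))"
    proof (rule mod2_null_chain_map [OF _ cg])
      show "g \<in> topspace (subtopology ?N ?V) \<inter> - {q} \<rightarrow> - {x0}"
      proof
        fix v assume "v \<in> topspace (subtopology ?N ?V) \<inter> - {q}"
        then have "v \<in> ?V" "v \<noteq> q" by auto
        then show "g v \<in> - {x0}"
          using Fg' [of v] by (auto simp: q_def)
      qed
    qed
    then have "mod2_null n M (- {x0}) a"
      unfolding chain_map_inverse [OF Fg a(1)] by (rule mod2_null_from_subtopology)
    from mod2_null_add [OF ca this] nn show False by simp
  qed
  then show ?thesis
    unfolding in_H_def using cB cF FB by blast
qed

text \<open>\<open>connected_space\<close> includes the empty space, on which all maps are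
  homotopic, hence the assumption that \<open>M\<close> has points. The first claim is the second
  one with empty boundary.\<close>

theorem theorem8p8:
  fixes M :: "'a topology" and n :: nat and p :: "nat \<Rightarrow> real"
  assumes "p \<in> topspace (nsphere n)"
    and "compact_space M" and "connected_space M" and "topspace M \<noteq> {}"
  shows "(manifold n M \<longrightarrow> H_minimal n p M {}) \<and>
         (manifold_with_boundary n M \<longrightarrow> H_minimal n p M (manifold_boundary n M))"
proof -
  have with_boundary: "H_minimal n p M (manifold_boundary n M)" if "manifold_with_boundary n M"
    unfolding H_minimal_def
    using boundary_pair_in_H [OF assms(1,2,4) that] proper_subspace_not_in_H [OF assms(1-3) that] by blast
  moreover have "H_minimal n p M {}" if m: "manifold n M"
  proof -
    have "manifold_with_boundary n M"
      using m by (simp add: manifold_def manifold_with_boundary_def)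
    moreover have "manifold_boundary n M = {}"
      using m by (auto simp: manifold_def manifold_boundary_def dest!: euclidean_imp_not_boundary_point)
    ultimately show ?thesis
      using with_boundary by simp
  qed
  ultimately show ?thesis by blast
qed

end
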